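(* Let $0<|q|<1$ and let $n=1,2,3,\dots$. Then $$\vartheta_3(0,-q)^{4n(n+1)}=1+\sum_{p=1}^{n}(-1)^{n-p}2^{2n^2+3n}\prod_{r=1}^{2n}(r!)^{-1}\sum_{\substack{\emptyset\subset S\subseteq I_n\\ \|S\|=p}}\det(M_{n,S}),$$ where $M_{n,S}$ is the $n\times n$ matrix whose $i$-th row is $$G_{2i+1},\,G_{2(i+1)+1},\,\dots,\,G_{2(i+n-1)+1}\quad\text{if } i\in S,\qquad\text{and}\qquad a_i,\,a_{i+1},\,\dots,\,a_{i+n-1}\quad\text{if } i\notin S,$$ with, for $i=1,2,3,\dots$, $$G_{2i+1}\equiv G_{2i+1}(q):=\sum_{r=1}^{\infty}(-1)^{r}\frac{r^{2i+1}q^r}{1-q^r},\qquad a_i:=(-1)^{i}\frac{2^{2i+2}-1}{4(i+1)}\,|B_{2i+2}|.$$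
   Context: $\vartheta_3(0,q):=\sum_{j=-\infty}^{\infty}q^{j^2}$, so $\vartheta_3(0,-q)=\sum_{j=-\infty}^{\infty}(-1)^{j}q^{j^2}$. $I_n:=\{1,2,\dots,n\}$, and $\|S\|$ is the cardinality of $S$; the inner sum is over all subsets $S$ of $I_n$ with exactly $p$ elements. The Bernoulli numbers $B_n$ are defined by $\frac{t}{e^t-1}=\sum_{n=0}^{\infty}B_n\frac{t^n}{n!}$, $|t|<2\pi$. *)

theory Defs
  imports
    "HOL-Complex_Analysis.Complex_Analysis"
    "Jordan_Normal_Form.Determinant"
begin

text \<open>The theta function \<open>\<vartheta>\<^sub>3(z, q)\<close> at \<open>z = 0\<close>, as a function of the nome \<open>q\<close>.\<close>

definition theta3_null :: "complex \<Rightarrow> complex" where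
  "theta3_null q = (\<Sum>\<^sub>\<infinity>j::int. q powi (j\<^sup>2))"

definition bernoulli :: "nat \<Rightarrow> real" where
  "bernoulli n = fact n * fps_nth (fps_X / (fps_exp 1 - 1)) n"

text \<open>The quotient above is one of formal power series; the following lemma shows that it agrees with
  the analytic definition of the Bernoulli numbers on the disc of radius \<open>2 * pi\<close>.\<close>

lemma bernoulli_sums:
  fixes t :: complex
  assumes "t \<noteq> 0" and "norm t < 2 * pi"
  shows "(\<lambda>n. of_real (bernoulli n) * t ^ n / fact n) sums (t / (exp t - 1))"
proof -
  define E :: "complex fps" where "E = fps_exp 1 - 1"
  define F :: "complex fps" where "F = fps_X / E"
  have subE: "subdegree E = 1"
    by (rule subdegreeI) (auto simp: E_def)
  have E0: "E \<noteq> 0" using subE by auto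
  have FE: "F * E = fps_X"
    unfolding F_def using subE E0 by (intro dvd_div_mult_self) (auto simp: fps_dvd_iff)
  define D :: "real fps" where "D = fps_exp 1 - 1"
  have subD: "subdegree D = 1"
    by (rule subdegreeI) (auto simp: D_def)
  have D0: "D \<noteq> 0" using subD by auto
  have DE: "fps_X / D * D = fps_X"
    using subD D0 by (intro dvd_div_mult_self) (auto simp: fps_dvd_iff)
  define G :: "complex fps" where "G = Abs_fps (\<lambda>n. of_real (fps_nth (fps_X / D) n))"
  have "G * E = fps_X"
  proof (rule fps_ext)
    fix n
    have "fps_nth (G * E) n = of_real (fps_nth (fps_X / D * D) n)"
      by (auto simp: fps_mult_nth G_def E_def D_def intro!: sum.cong)
    also have "\<dots> = fps_nth fps_X n" unfolding DE by (simp add: fps_X_def)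
    finally show "fps_nth (G * E) n = fps_nth fps_X n" .
  qed
  with FE E0 have GF: "G = F" by (metis mult_right_cancel)
  have nz: "exp z \<noteq> 1" if "z \<noteq> 0" "norm z < 2 * pi" for z :: complex
  proof
    assume "exp z = 1"
    then obtain n :: int where n: "Re z = 0" "Im z = of_int (2 * n) * pi"
      by (auto simp: exp_eq_1)
    hence "norm z = \<bar>Im z\<bar>" by (simp add: cmod_eq_Im)
    with n that(2) have "\<bar>real_of_int n\<bar> < 1" by (simp add: abs_mult)
    hence "n = 0" by linarith
    with n that(1) show False by (simp add: complex_eq_iff)
  qed
  define f where "f = (\<lambda>z::complex. if z = 0 then 1 else z / (exp z - 1))"
  have exp: "f has_fps_expansion F"
    unfolding f_def F_def
  proof (rule has_fps_expansion_divide)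
    show "(\<lambda>z. z) has_fps_expansion (fps_X :: complex fps)"
      by (rule has_fps_expansion_fps_X)
    show "(\<lambda>z. exp z - 1) has_fps_expansion E"
      unfolding E_def by (intro fps_expansion_intros)
  qed (use subE E0 in \<open>auto simp: E_def\<close>)
  have "f analytic_on ball 0 (2 * pi)"
  proof (subst analytic_on_analytic_at, safe)
    fix z :: complex assume z: "z \<in> ball 0 (2 * pi)"
    show "f analytic_on {z}"
    proof (cases "z = 0")
      case True
      thus ?thesis using has_fps_expansion_imp_analytic_0[OF exp] by simp
    next
      case False
      have "(\<lambda>z. z / (exp z - 1)) holomorphic_on ball 0 (2 * pi) - {0}"
        using nz by (intro holomorphic_intros) auto
      hence "f holomorphic_on ball 0 (2 * pi) - {0}"
        by (rule holomorphic_transform) (auto simp: f_def)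
      thus ?thesis using z False
        by (intro analytic_at[THEN iffD2] exI[of _ "ball 0 (2 * pi) - {0}"]) auto
    qed
  qed
  hence "f holomorphic_on eball 0 (ereal (2 * pi))"
    by (simp add: analytic_imp_holomorphic)
  from has_fps_expansion_imp_sums_complex[OF exp this, of t] assms
  have "(\<lambda>n. fps_nth F n * t ^ n) sums (t / (exp t - 1))"
    by (simp add: f_def)
  moreover have "fps_nth F n = of_real (bernoulli n) / fact n" for n
    by (simp add: GF[symmetric] G_def D_def bernoulli_def)
  ultimately show ?thesis by simp
qed

text \<open>\<open>lambert_G (2 * i + 1) q\<close> is the paper's \<open>G\<^sub>2\<^sub>i\<^sub>+\<^sub>1(q)\<close>; the summation variable is shifted
  so that the series starts at \<open>r = 1\<close>.\<close>

definition lambert_G :: "nat \<Rightarrow> complex \<Rightarrow> complex" where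
  "lambert_G m q = (\<Sum>k. (-1) ^ Suc k * (of_nat (Suc k) ^ m * q ^ Suc k / (1 - q ^ Suc k)))"

definition coeff_a :: "nat \<Rightarrow> real" where
  "coeff_a i = (-1) ^ i * ((2 ^ (2 * i + 2) - 1) / (4 * (real i + 1))) * \<bar>bernoulli (2 * i + 2)\<bar>"

text \<open>The library matrices are indexed from 0, so entry \<open>(i, j)\<close> below is the entry in
  row \<open>i + 1\<close> and column \<open>j + 1\<close> of the matrix \<open>M\<^sub>n\<^sub>,\<^sub>S\<close>; \<open>S\<close> is a subset of \<open>{1..n}\<close>.\<close>

definition M_matrix :: "nat \<Rightarrow> nat set \<Rightarrow> complex \<Rightarrow> complex mat" where
  "M_matrix n S q = Matrix.mat n n (\<lambda>(i, j).
     if Suc i \<in> S then lambert_G (2 * (Suc i + j) + 1) q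
     else of_real (coeff_a (Suc i + j)))"

end

theory Submission
  imports Defs
begin

text \<open>
  With \<open>koebe x = x / (1 - x)\<^sup>2\<close>, the bilateral sum \<open>F\<close> of \<open>koebe (x * q powi n)\<close> is, up to constants, the
  Weierstrass function in the variable \<open>ln x\<close>. Its expansion \<open>Y\<close> in \<open>u\<close> at \<open>x = - exp u\<close> is even, with
  derivatives \<open>2 (G\<^bsub>2k+1\<^esub> - a\<^sub>k)\<close> of order \<open>2k\<close>, and partial fractions with telescoping give
  \<open>Y'' = 6 Y\<^sup>2 + b Y + c\<close>. Hence the second derivative acts on the powers of \<open>Y - Y 0\<close> as a tridiagonal
  matrix, and an LU factorisation evaluates the Hankel determinant of the numbers \<open>G\<^bsub>2k+1\<^esub> - a\<^sub>k\<close> as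
  a product of factorials times the power \<open>n (n + 1) / 2\<close> of \<open>G\<^sub>3 - a\<^sub>1\<close>. Expanding each row of the difference
  gives the sum over subsets; the empty subset is the same determinant at \<open>q = 0\<close>.

  It remains to show the eight-square formula \<open>16 (G\<^sub>3 - a\<^sub>1) = \<vartheta>\<^sub>3(0, -q)\<^sup>8\<close>. Product identities for \<open>F\<close> at
  half periods give \<open>G\<^sub>3 - a\<^sub>1 = A\<^sup>2\<close> for the alternating sum \<open>A\<close> of \<open>q powi n / (1 + q powi n)\<^sup>2\<close>, and
  \<open>4 A = L(-q)\<^sup>2\<close> for \<open>L\<close> twice the sum of \<open>q powi n / (1 + q powi (2 n))\<close>. Both \<open>L\<close> and
  \<open>\<vartheta>\<^sub>3(0, q)\<^sup>2\<close> are of the form \<open>1 + 4 q + \<dots>\<close> and satisfy \<open>f(q) + f(-q) = 2 f(q\<^sup>2)\<close> and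
  \<open>f(q) f(-q) = f(-q\<^sup>2)\<^sup>2\<close>, which determines them.
\<close>

subsection \<open>Hankel determinants of tridiagonal matrices\<close>

text \<open>The point x = -1 is a half period away from the poles: this makes Y regular and even at
  u = 0 and produces the signs (-1)^r of the Lambert series. No theory of elliptic functions enters.
  The second derivative of \<open>koebe\<close> in u is koebe + 6 koebe^2, so Y'' is a bilateral sum
  of koebe and koebe^2; squaring the bilateral sum of \<open>koebe\<close> yields the same sum of
  squares, and eliminating it leaves the differential equation. Evenness matters for the
  determinant: with y = Y - Y 0 both y and y' vanish at 0, so the first integral is a cubic in y
  without constant term. With a constant term the second derivative of y^(m+1) would also involve
  y^(m-1), and the matrix would not be tridiagonal. The constant of the theorem has two sources.
  Each row of the Hankel matrix of Y carries a factor 2 relative to G - a, which gives 2^n; at q = 0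
  the coefficient of u^2 in Y is 1/16, and its power n(n+1)/2 gives 2^(2n^2+2n). The exponent
  4n(n+1) is 8 times n(n+1)/2.\<close>

text \<open>\<open>jacobi_orbit \<alpha> \<beta> \<gamma> k m\<close> is entry \<open>m\<close> of \<open>J\<^sup>k e\<^sub>0\<close>, where \<open>J\<close> is the infinite tridiagonal matrix with
  entries \<open>\<alpha> m\<close> at \<open>(m, m + 1)\<close>, \<open>\<beta> m\<close> at \<open>(m, m)\<close> and \<open>\<gamma> m\<close> at \<open>(m, m - 1)\<close>.\<close>

fun jacobi_orbit :: "(nat \<Rightarrow> 'a) \<Rightarrow> (nat \<Rightarrow> 'a) \<Rightarrow> (nat \<Rightarrow> 'a) \<Rightarrow> nat \<Rightarrow> nat \<Rightarrow> 'a :: comm_ring_1" where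
  "jacobi_orbit \<alpha> \<beta> \<gamma> 0 m = (if m = 0 then 1 else 0)"
| "jacobi_orbit \<alpha> \<beta> \<gamma> (Suc k) m = \<alpha> m * jacobi_orbit \<alpha> \<beta> \<gamma> k (Suc m) + \<beta> m * jacobi_orbit \<alpha> \<beta> \<gamma> k m
     + (if m = 0 then 0 else \<gamma> m * jacobi_orbit \<alpha> \<beta> \<gamma> k (m - 1))"

lemma jacobi_orbit_eq_0: "k < m \<Longrightarrow> jacobi_orbit \<alpha> \<beta> \<gamma> k m = 0"
  by (induction k arbitrary: m) auto

lemma jacobi_orbit_diag: "jacobi_orbit \<alpha> \<beta> \<gamma> k k = (\<Prod>m<k. \<gamma> (Suc m))"
  by (induction k) (auto simp: jacobi_orbit_eq_0 mult_ac)

text \<open>The first factor is the orbit of the transposed matrix, so the sum is an entry of \<open>J\<^sup>i J\<^sup>j\<close>.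
  For Hankel matrices this is an LU factorisation.\<close>

lemma jacobi_orbit_pairing:
  assumes "i + j \<le> N"
  shows "(\<Sum>m\<le>N. jacobi_orbit (\<lambda>m. \<gamma> (Suc m)) \<beta> (\<lambda>m. \<alpha> (m - 1)) i m * jacobi_orbit \<alpha> \<beta> \<gamma> j m)
       = jacobi_orbit \<alpha> \<beta> \<gamma> (i + j) 0"
  using assms
proof (induction i arbitrary: j)
  case 0
  show ?case by (simp add: if_distrib[of "\<lambda>x. x * _"] cong: if_cong)
next
  case (Suc i)
  let ?R = "jacobi_orbit (\<lambda>m. \<gamma> (Suc m)) \<beta> (\<lambda>m. \<alpha> (m - 1)) i" and ?L = "jacobi_orbit \<alpha> \<beta> \<gamma> j"
  from Suc.prems obtain M where N: "N = Suc M" by (cases N) auto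
  have z: "?R N = 0" "?L N = 0" "?L (Suc N) = 0" "?R (Suc N) = 0"
    using Suc.prems by (auto intro!: jacobi_orbit_eq_0)
  have up: "(\<Sum>m\<le>N. f (Suc m)) = (\<Sum>m\<le>N. if m = 0 then 0 else f m)" if "f (Suc N) = 0" for f :: "nat \<Rightarrow> 'a"
    using that unfolding N by (subst (2) sum.atMost_Suc_shift) simp
  \<comment> \<open>Summation by parts: one application of the transposed matrix to the left factor
    is moved to the right factor, the index shift \<open>up\<close> exchanging raising and lowering
    terms. The boundary terms vanish by \<open>z\<close>, since Suc i + j \<le> N.\<close>
  have "(\<Sum>m\<le>N. jacobi_orbit (\<lambda>m. \<gamma> (Suc m)) \<beta> (\<lambda>m. \<alpha> (m - 1)) (Suc i) m * ?L m)
      = (\<Sum>m\<le>N. \<gamma> (Suc m) * ?R (Suc m) * ?L m) + (\<Sum>m\<le>N. \<beta> m * ?R m * ?L m)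
        + (\<Sum>m\<le>N. if m = 0 then 0 else \<alpha> (m - 1) * ?R (m - 1) * ?L m)"
    unfolding sum.distrib[symmetric] by (intro sum.cong refl) (simp add: algebra_simps)
  also have "(\<Sum>m\<le>N. \<gamma> (Suc m) * ?R (Suc m) * ?L m) = (\<Sum>m\<le>N. if m = 0 then 0 else \<gamma> m * ?R m * ?L (m - 1))"
    using up[of "\<lambda>m. \<gamma> m * ?R m * ?L (m - 1)"] z by simp
  also have "(\<Sum>m\<le>N. if m = 0 then 0 else \<alpha> (m - 1) * ?R (m - 1) * ?L m) = (\<Sum>m\<le>N. \<alpha> m * ?R m * ?L (Suc m))"
    using up[of "\<lambda>m. \<alpha> (m - 1) * ?R (m - 1) * ?L m"] z by simp
  also have "(\<Sum>m\<le>N. if m = 0 then 0 else \<gamma> m * ?R m * ?L (m - 1)) + (\<Sum>m\<le>N. \<beta> m * ?R m * ?L m)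
      + (\<Sum>m\<le>N. \<alpha> m * ?R m * ?L (Suc m)) = (\<Sum>m\<le>N. ?R m * jacobi_orbit \<alpha> \<beta> \<gamma> (Suc j) m)"
    unfolding sum.distrib[symmetric] by (intro sum.cong refl) (simp add: algebra_simps)
  also have "\<dots> = jacobi_orbit \<alpha> \<beta> \<gamma> (Suc i + j) 0"
    using Suc.IH[of "Suc j"] Suc.prems by simp
  finally show ?case .
qed

lemma det_Hankel_jacobi:
  "Determinant.det (Matrix.mat n n (\<lambda>(i, j). jacobi_orbit \<alpha> \<beta> \<gamma> (i + j) 0))
     = (\<Prod>i<n. \<Prod>m<i. \<alpha> m * \<gamma> (Suc m))"
proof -
  let ?R = "jacobi_orbit (\<lambda>m. \<gamma> (Suc m)) \<beta> (\<lambda>m. \<alpha> (m - 1))" and ?L = "jacobi_orbit \<alpha> \<beta> \<gamma>"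
  define A where "A = Matrix.mat n n (\<lambda>(i, m). ?R i m)"
  define B where "B = Matrix.mat n n (\<lambda>(m, j). ?L j m)"
  have A: "A \<in> carrier_mat n n" and B: "B \<in> carrier_mat n n" by (auto simp: A_def B_def)
  have "Matrix.mat n n (\<lambda>(i, j). ?L (i + j) 0) = A * B"
  proof (rule eq_matI)
    fix i j assume "i < dim_row (A * B)" "j < dim_col (A * B)"
    hence ij: "i < n" "j < n" by (auto simp: A_def B_def)
    have "(A * B) $$ (i, j) = (\<Sum>m<n. ?R i m * ?L j m)"
      using ij by (simp add: A_def B_def scalar_prod_def atLeast0LessThan)
    \<comment> \<open>The orbits vanish for m > i and m > j, so the range may be enlarged to meet
      the hypothesis of \<open>jacobi_orbit_pairing\<close>.\<close>
    also have "\<dots> = (\<Sum>m\<le>2*n. ?R i m * ?L j m)"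
      using ij by (intro sum.mono_neutral_left) (auto simp: jacobi_orbit_eq_0)
    also have "\<dots> = ?L (i + j) 0"
      using ij by (intro jacobi_orbit_pairing) auto
    finally show "Matrix.mat n n (\<lambda>(i, j). ?L (i + j) 0) $$ (i, j) = (A * B) $$ (i, j)"
      using ij by simp
  qed (auto simp: A_def B_def)
  moreover have "Determinant.det A = (\<Prod>i<n. \<Prod>m<i. \<alpha> m)"
  proof -
    have "Determinant.det A = prod_list (diag_mat A)"
      by (rule det_lower_triangular[OF _ A]) (auto simp: A_def jacobi_orbit_eq_0)
    also have "\<dots> = (\<Prod>i<n. ?R i i)"
      by (auto simp: prod_list_diag_prod A_def atLeast0LessThan)
    finally show ?thesis by (simp add: jacobi_orbit_diag)
  qed
  moreover have "Determinant.det B = (\<Prod>i<n. \<Prod>m<i. \<gamma> (Suc m))"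
  proof -
    have "Determinant.det B = prod_list (diag_mat B)"
      by (rule det_upper_triangular[OF _ B]) (auto simp: B_def upper_triangular_def jacobi_orbit_eq_0)
    also have "\<dots> = (\<Prod>i<n. ?L i i)"
      by (auto simp: prod_list_diag_prod B_def atLeast0LessThan)
    finally show ?thesis by (simp add: jacobi_orbit_diag)
  qed
  ultimately show ?thesis by (simp add: det_mult[OF A B] prod.distrib)
qed

text \<open>The left side is (m + 1) (m y^(m-1) y'^2 + y^m y''). As the cubic for y'^2 has no
  constant term, y^(m-1) y'^2 starts with y^m, so only three consecutive powers occur.\<close>

lemma deriv2_power_of_quadratic_ode:
  fixes y :: "'a :: field_char_0 fps"
  assumes ode1: "fps_deriv y ^ 2 = fps_const (4 * a) * y + fps_const (4 * b) * y ^ 2 + 4 * y ^ 3"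
    and ode2: "fps_deriv (fps_deriv y) = fps_const (2 * a) + fps_const (4 * b) * y + 6 * y ^ 2"
  shows "fps_deriv (fps_deriv (y ^ Suc m)) = fps_const (of_nat (2 * (m + 1) * (2 * m + 1)) * a) * y ^ m
     + fps_const (of_nat (4 * (m + 1) ^ 2) * b) * y ^ Suc m + of_nat (2 * (m + 1) * (2 * m + 3)) * y ^ (m + 2)"
proof (cases m)
  case 0
  thus ?thesis using ode2 by (simp add: algebra_simps power2_eq_square)
next
  case (Suc k)
  have D1: "fps_deriv (y ^ Suc l) = of_nat (Suc l) * (y ^ l * fps_deriv y)" for l
    by (induction l) (simp_all add: algebra_simps)
  have D2: "fps_deriv (of_nat l * f) = of_nat l * fps_deriv f" for l and f :: "'a fps"
    by (simp add: fps_of_nat[symmetric])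
  have "fps_deriv (fps_deriv (y ^ Suc m)) =
     of_nat (Suc m) * (of_nat m * y ^ k * fps_deriv y ^ 2 + y ^ m * fps_deriv (fps_deriv y))"
    unfolding D1 D2 fps_deriv_mult unfolding Suc D1 by (simp add: algebra_simps power2_eq_square)
  also have "\<dots> = fps_const (of_nat (2 * (m + 1) * (2 * m + 1)) * a) * y ^ m
     + fps_const (of_nat (4 * (m + 1) ^ 2) * b) * y ^ Suc m + of_nat (2 * (m + 1) * (2 * m + 3)) * y ^ (m + 2)"
    unfolding ode1 ode2 Suc fps_const_mult[symmetric] fps_of_nat
    by (simp add: algebra_simps power2_eq_square power3_eq_cube flip: fps_numeral_simps numeral_fps_const)
  finally show ?thesis .
qed


text \<open>Multiply the equation by 2 y' and integrate. Since y and y' vanish at 0, the constant of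
  integration is 0; tridiagonality rests on this.\<close>

lemma first_integral_of_quadratic_ode:
  fixes y :: "'a :: field_char_0 fps"
  assumes "fps_nth y 0 = 0" "fps_nth y 1 = 0"
    and ode: "fps_deriv (fps_deriv y) = fps_const (2 * a) + fps_const (4 * b) * y + 6 * y ^ 2"
  shows "fps_deriv y ^ 2 = fps_const (4 * a) * y + fps_const (4 * b) * y ^ 2 + 4 * y ^ 3"
proof -
  have "fps_deriv (fps_deriv y ^ 2) = 2 * fps_deriv y * fps_deriv (fps_deriv y)"
    by (simp add: power2_eq_square algebra_simps)
  also have "\<dots> = fps_deriv (fps_const (4 * a) * y + fps_const (4 * b) * y ^ 2 + 4 * y ^ 3)"
  proof -
    have "fps_const (4 * a) = 2 * fps_const (2 * a)" by (simp add: numeral_fps_const)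
    thus ?thesis
      unfolding ode by (simp add: power2_eq_square power3_eq_cube algebra_simps)
  qed
  finally have "fps_deriv (fps_deriv y ^ 2) = fps_deriv (fps_const (4 * a) * y + fps_const (4 * b) * y ^ 2 + 4 * y ^ 3)" .
  hence "\<exists>c. fps_deriv y ^ 2 = fps_const c + (fps_const (4 * a) * y + fps_const (4 * b) * y ^ 2 + 4 * y ^ 3)"
    unfolding fps_deriv_eq_iff by (rule exI)
  then obtain c where c: "fps_deriv y ^ 2 = fps_const c + (fps_const (4 * a) * y + fps_const (4 * b) * y ^ 2 + 4 * y ^ 3)"
    by blast
  have "fps_nth (fps_deriv y ^ 2) 0 = c"
    unfolding c using assms(1) by (simp add: fps_power_zeroth)
  moreover have "fps_nth (fps_deriv y ^ 2) 0 = 0"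
    using assms(2) by (simp add: fps_power_zeroth)
  ultimately show ?thesis using c by simp
qed

lemma iterated_deriv2_nth:
  fixes y :: "'a :: field_char_0 fps"
  shows "fps_nth (((\<lambda>f. fps_deriv (fps_deriv f)) ^^ k) y) j = fact (2 * k + j) / fact j * fps_nth y (2 * k + j)"
proof (induction k arbitrary: j)
  case (Suc k)
  have "fps_nth (((\<lambda>f. fps_deriv (fps_deriv f)) ^^ Suc k) y) j
      = of_nat (j + 1) * of_nat (j + 2) * (fact (2 * k + (j + 2)) / fact (j + 2) * fps_nth y (2 * k + (j + 2)))"
    using Suc.IH[of "j + 2"] by simp
  also have "(fact (j + 2) :: 'a) = of_nat (j + 1) * of_nat (j + 2) * fact j"
    by (simp add: algebra_simps)
  finally show ?case by (simp del: of_nat_Suc of_nat_add)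
qed auto

text \<open>On the powers of \<open>y\<close>, modulo constants, the second derivative acts as a tridiagonal matrix.\<close>

lemma iterated_deriv2_of_quadratic_ode:
  fixes y :: "'a :: field_char_0 fps"
  assumes y: "fps_nth y 0 = 0" "fps_nth y 1 = 0"
    and ode: "fps_deriv (fps_deriv y) = fps_const (2 * a) + fps_const (4 * b) * y + 6 * y ^ 2"
  defines "L \<equiv> jacobi_orbit (\<lambda>m. of_nat (2 * (m + 2) * (2 * m + 3)) * a) (\<lambda>m. of_nat (4 * (m + 1) ^ 2) * b)
      (\<lambda>m. of_nat (2 * m * (2 * m + 1)))"
  shows "\<exists>c. ((\<lambda>f. fps_deriv (fps_deriv f)) ^^ k) y = fps_const c + (\<Sum>m\<le>k. fps_const (L k m) * y ^ Suc m)"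
proof (induction k)
  case 0
  show ?case by (intro exI[of _ 0]) (simp add: L_def)
next
  case (Suc k)
  then obtain c where c: "((\<lambda>f. fps_deriv (fps_deriv f)) ^^ k) y = fps_const c + (\<Sum>m\<le>k. fps_const (L k m) * y ^ Suc m)"
    by blast
  define \<alpha> where "\<alpha> = (\<lambda>m::nat. of_nat (2 * (m + 1) * (2 * m + 1)) * a)"
  define \<beta> where "\<beta> = (\<lambda>m::nat. of_nat (4 * (m + 1) ^ 2) * b)"
  define \<gamma> where "\<gamma> = (\<lambda>m::nat. of_nat (2 * m * (2 * m + 1)) :: 'a)"
  \<comment> \<open>Index m of \<open>L\<close> belongs to y^(m+1), so the contribution of y^(m+2)
    to y^(m+1) carries \<open>\<alpha> (Suc m)\<close>.\<close>
  have rec: "L (Suc k) m = \<alpha> (Suc m) * L k (Suc m) + \<beta> m * L k m + (if m = 0 then 0 else \<gamma> m * L k (m - 1))" for m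
    by (simp add: L_def \<alpha>_def \<beta>_def \<gamma>_def algebra_simps)
  have z: "L k (Suc k) = 0" "L k (Suc (Suc k)) = 0"
    by (simp_all only: L_def jacobi_orbit_eq_0 lessI less_Suc_eq simp_thms)
  have \<gamma>_Suc: "\<gamma> (Suc m) = of_nat (2 * (m + 1) * (2 * m + 3))" for m
    unfolding \<gamma>_def by (rule arg_cong[of _ _ of_nat]) (simp add: algebra_simps)
  have pw: "fps_deriv (fps_deriv (y ^ Suc m)) =
       fps_const (\<alpha> m) * y ^ m + fps_const (\<beta> m) * y ^ Suc m + fps_const (\<gamma> (Suc m)) * y ^ Suc (Suc m)" for m
    using deriv2_power_of_quadratic_ode[OF first_integral_of_quadratic_ode[OF y ode] ode, of m]
    by (simp add: \<alpha>_def \<beta>_def \<gamma>_Suc fps_of_nat[symmetric] del: of_nat_Suc of_nat_add of_nat_mult power_Suc)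
  have "((\<lambda>f. fps_deriv (fps_deriv f)) ^^ Suc k) y = (\<Sum>m\<le>k. fps_const (L k m) * fps_deriv (fps_deriv (y ^ Suc m)))"
    by (simp add: c fps_deriv_sum del: power_Suc)
  also have "\<dots> = (\<Sum>m\<le>k. fps_const (L k m * \<alpha> m) * y ^ m) + (\<Sum>m\<le>k. fps_const (L k m * \<beta> m) * y ^ Suc m)
      + (\<Sum>m\<le>k. fps_const (L k m * \<gamma> (Suc m)) * y ^ Suc (Suc m))"
    unfolding pw sum.distrib[symmetric]
    by (intro sum.cong refl) (simp add: algebra_simps del: power_Suc flip: fps_const_mult)
  also have "(\<Sum>m\<le>k. fps_const (L k m * \<alpha> m) * y ^ m) = (\<Sum>m\<le>Suc (Suc k). fps_const (L k m * \<alpha> m) * y ^ m)"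
    by (simp add: z)
  \<comment> \<open>The term of y^0 joins the constant that the statement leaves free. The padding
    with zero coefficients gives all three sums the same range.\<close>
  also have "\<dots> = fps_const (L k 0 * \<alpha> 0) + (\<Sum>m\<le>Suc k. fps_const (L k (Suc m) * \<alpha> (Suc m)) * y ^ Suc m)"
    by (subst sum.atMost_Suc_shift) simp
  also have "(\<Sum>m\<le>k. fps_const (L k m * \<beta> m) * y ^ Suc m) = (\<Sum>m\<le>Suc k. fps_const (L k m * \<beta> m) * y ^ Suc m)"
    by (simp add: z)
  also have "(\<Sum>m\<le>k. fps_const (L k m * \<gamma> (Suc m)) * y ^ Suc (Suc m))
      = (\<Sum>m\<le>Suc k. fps_const (if m = 0 then 0 else L k (m - 1) * \<gamma> m) * y ^ Suc m)"
    by (subst sum.atMost_Suc_shift) simp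
  also have "fps_const (L k 0 * \<alpha> 0) + (\<Sum>m\<le>Suc k. fps_const (L k (Suc m) * \<alpha> (Suc m)) * y ^ Suc m)
      + (\<Sum>m\<le>Suc k. fps_const (L k m * \<beta> m) * y ^ Suc m)
      + (\<Sum>m\<le>Suc k. fps_const (if m = 0 then 0 else L k (m - 1) * \<gamma> m) * y ^ Suc m)
      = fps_const (L k 0 * \<alpha> 0) + (\<Sum>m\<le>Suc k. fps_const (L (Suc k) m) * y ^ Suc m)"
    unfolding add.assoc sum.distrib[symmetric] rec
    by (intro arg_cong2[of _ _ _ _ "(+)"] sum.cong refl)
       (simp add: algebra_simps del: power_Suc flip: fps_const_add)
  finally show ?case by blast
qed

text \<open>With k = i + j the entry is the value at 0 of the (k+1)-fold second derivative of y. In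
  the expansion of the k-fold one in powers of y, only y itself has a nonzero second derivative at
  0, namely 2 a; so the entry is 2 a times entry 0 of an orbit vector, and
  \<open>det_Hankel_jacobi\<close> applies.\<close>

lemma det_Hankel_of_quadratic_ode:
  fixes y :: "'a :: field_char_0 fps"
  assumes y: "fps_nth y 0 = 0" "fps_nth y 1 = 0"
    and ode: "fps_deriv (fps_deriv y) = fps_const (2 * a) + fps_const (4 * b) * y + 6 * y ^ 2"
  shows "Determinant.det (Matrix.mat n n (\<lambda>(i, j). fact (2 * (i + j + 1)) * fps_nth y (2 * (i + j + 1))))
       = a ^ (n * (n + 1) div 2) * (\<Prod>r=1..2*n. fact r)"
proof -
  define L where "L = jacobi_orbit (\<lambda>m. of_nat (2 * (m + 2) * (2 * m + 3)) * a) (\<lambda>m. of_nat (4 * (m + 1) ^ 2) * b)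
      (\<lambda>m. of_nat (2 * m * (2 * m + 1)) :: 'a)"
  have coeff: "fact (2 * (i + j + 1)) * fps_nth y (2 * (i + j + 1)) = 2 * a * L (i + j) 0" for i j
  proof -
    define k where "k = i + j"
    obtain c where c: "((\<lambda>f. fps_deriv (fps_deriv f)) ^^ k) y = fps_const c + (\<Sum>m\<le>k. fps_const (L k m) * y ^ Suc m)"
      using iterated_deriv2_of_quadratic_ode[OF y ode, of k] unfolding L_def by blast
    have "fact (2 * Suc k) * fps_nth y (2 * Suc k) = fps_nth (((\<lambda>f. fps_deriv (fps_deriv f)) ^^ Suc k) y) 0"
      by (subst iterated_deriv2_nth) simp
    also have "\<dots> = (\<Sum>m\<le>k. L k m * fps_nth (fps_deriv (fps_deriv (y ^ Suc m))) 0)"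
      by (simp add: c fps_deriv_sum fps_sum_nth del: power_Suc)
    also have "\<dots> = (\<Sum>m\<le>k. if m = 0 then 2 * a * L k m else 0)"
    proof (intro sum.cong refl)
      fix m
      show "L k m * fps_nth (fps_deriv (fps_deriv (y ^ Suc m))) 0 = (if m = 0 then 2 * a * L k m else 0)"
        unfolding deriv2_power_of_quadratic_ode[OF first_integral_of_quadratic_ode[OF y ode] ode, of m]
        using y(1) by (auto simp: fps_mult_nth fps_power_zeroth fps_of_nat[symmetric] simp del: power_Suc)
    qed
    finally show ?thesis by (simp add: k_def del: fact_Suc)
  qed
  have "Matrix.mat n n (\<lambda>(i, j). fact (2 * (i + j + 1)) * fps_nth y (2 * (i + j + 1)))
      = (2 * a) \<cdot>\<^sub>m Matrix.mat n n (\<lambda>(i, j). L (i + j) 0)"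
    by (rule eq_matI) (simp_all only: coeff dim_row_mat dim_col_mat index_mat index_smult_mat split)
  hence "Determinant.det (Matrix.mat n n (\<lambda>(i, j). fact (2 * (i + j + 1)) * fps_nth y (2 * (i + j + 1))))
      = (2 * a) ^ n * (\<Prod>i<n. \<Prod>m<i. of_nat (2 * (m + 2) * (2 * m + 3)) * a * of_nat (2 * Suc m * (2 * Suc m + 1)))"
    by (simp only: det_smult dim_col_mat L_def det_Hankel_jacobi)
  also have "\<dots> = a ^ (n * (n + 1) div 2) * (\<Prod>r=1..2*n. fact r)"
  proof (induction n)
    case (Suc n)
    \<comment> \<open>The surplus 2 is 2! at i = 0; the factor of index m supplies the ratios
      (2m+3)!/(2m+1)! and (2m+4)!/(2m+2)!.\<close>
    have inner: "2 * (\<Prod>m<i. of_nat (2 * (m + 2) * (2 * m + 3)) * a * of_nat (2 * Suc m * (2 * Suc m + 1)))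
        = a ^ i * fact (2 * i + 1) * fact (2 * i + 2)" for i
    proof (induction i)
      case (Suc i)
      have f: "fact (2 * Suc i + 1) = (of_nat (2 * Suc i + 1) * of_nat (2 * Suc i) * fact (2 * i + 1) :: 'a)"
        "fact (2 * Suc i + 2) = (of_nat (2 * (i + 2)) * of_nat (2 * i + 3) * fact (2 * i + 2) :: 'a)"
        by (simp_all add: algebra_simps)
      show ?case
        unfolding f prod.lessThan_Suc mult.assoc[symmetric] Suc.IH by (simp only: of_nat_mult power_Suc mult_ac)
    qed simp
    have e: "Suc n * (Suc n + 1) div 2 = n * (n + 1) div 2 + n + 1" by simp
    have "(2 * a) ^ Suc n * (\<Prod>i<Suc n. \<Prod>m<i. of_nat (2 * (m + 2) * (2 * m + 3)) * a * of_nat (2 * Suc m * (2 * Suc m + 1)))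
       = ((2 * a) ^ n * (\<Prod>i<n. \<Prod>m<i. of_nat (2 * (m + 2) * (2 * m + 3)) * a * of_nat (2 * Suc m * (2 * Suc m + 1))))
          * (a * (2 * (\<Prod>m<n. of_nat (2 * (m + 2) * (2 * m + 3)) * a * of_nat (2 * Suc m * (2 * Suc m + 1)))))"
      by (simp only: prod.lessThan_Suc power_Suc mult_ac)
    also have "\<dots> = a ^ (n * (n + 1) div 2) * (\<Prod>r=1..2*n. fact r) * (a * (a ^ n * fact (2 * n + 1) * fact (2 * n + 2)))"
      unfolding Suc.IH inner ..
    also have "\<dots> = a ^ (Suc n * (Suc n + 1) div 2) * (\<Prod>r=1..2*Suc n. fact r)"
      unfolding e by (simp add: power_add mult_ac del: fact_Suc)
    finally show ?case .
  qed auto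
  finally show ?thesis .
qed

subsection \<open>Bilateral sums\<close>

lemma summable_on_intI:
  fixes f :: "int \<Rightarrow> complex"
  assumes "(\<lambda>n::nat. f (int n)) summable_on UNIV" "(\<lambda>n::nat. f (- int n)) summable_on UNIV"
  shows "f summable_on UNIV"
proof -
  have "f summable_on (range int)" "f summable_on (range (\<lambda>n. - int n))"
    using assms by (auto simp: summable_on_reindex inj_def o_def)
  hence "f summable_on (range int \<union> range (\<lambda>n. - int n))"
    by (rule summable_on_union)
  also have "range int \<union> range (\<lambda>n. - int n) = UNIV"
  proof -
    have "n \<in> range int \<union> range (\<lambda>n. - int n)" for n
      by (cases n rule: int_cases2) auto
    thus ?thesis by blast
  qed
  finally show ?thesis .
qed

lemma summable_power_times_geometric:
  fixes z :: "'a :: {real_normed_field, banach}"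
  assumes "norm z < 1"
  shows "summable (\<lambda>n. of_nat n ^ k * z ^ n)"
  using assms
proof (induction k arbitrary: z)
  case (Suc k)
  have "summable (\<lambda>n. diffs (\<lambda>n. of_nat n ^ k) n * z ^ n)"
    using termdiff_converges[of z 1 "\<lambda>n. of_nat n ^ k"] Suc by simp
  hence "summable (\<lambda>n. (\<lambda>n. of_nat n ^ Suc k * z ^ n) (Suc n))"
    using summable_mult[of "\<lambda>n. diffs (\<lambda>n. of_nat n ^ k) n * z ^ n" z]
    by (simp add: diffs_def mult_ac del: of_nat_Suc)
  thus ?case by (subst (asm) summable_Suc_iff)
qed (simp add: summable_geometric)

lemma summable_on_nat_bigo:
  fixes f :: "nat \<Rightarrow> complex"
  assumes "f \<in> O(\<lambda>n. of_nat n * z ^ n)" "norm z < 1"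
  shows "f summable_on UNIV"
proof -
  obtain c where c: "\<forall>\<^sub>F n in sequentially. norm (f n) \<le> c * norm (of_nat n * z ^ n)"
    using landau_o.bigE[OF assms(1)] by blast
  have "summable (\<lambda>n. real n ^ 1 * norm z ^ n)"
    using summable_power_times_geometric[of "norm z" 1] assms(2) by simp
  hence "summable (\<lambda>n. c * norm (of_nat n * z ^ n))"
    by (intro summable_mult) (simp add: norm_mult norm_power)
  moreover have "\<forall>\<^sub>F n in sequentially. norm (norm (f n)) \<le> c * norm (of_nat n * z ^ n)"
    using c by simp
  ultimately have "summable (\<lambda>n. norm (f n))"
    by (rule summable_comparison_test_ev[rotated])
  thus ?thesis by (rule norm_summable_imp_summable_on)
qed

text \<open>The filter \<open>at 0\<close> excludes 0, so the orbit must never hit it. The version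
  with weight n serves the sums that telescoping leaves behind.\<close>

lemma summable_on_geometric_orbit:
  fixes f :: "complex \<Rightarrow> complex"
  assumes f: "f \<in> O[at 0](\<lambda>z. z)" and x: "x \<noteq> 0" and p: "p \<noteq> 0" "norm p < 1"
  shows "(\<lambda>n::nat. of_nat n * f (x * p ^ n)) summable_on UNIV"
    and "(\<lambda>n::nat. f (x * p ^ n)) summable_on UNIV"
proof -
  have lim: "filterlim (\<lambda>n. x * p ^ n) (at 0) sequentially"
  proof (rule filterlim_atI)
    show "(\<lambda>n. x * p ^ n) \<longlonglongrightarrow> 0"
      using LIMSEQ_power_zero[OF p(2)] tendsto_mult_right_zero by blast
  qed (use x p in auto)
  have 1: "(\<lambda>n. f (x * p ^ n)) \<in> O(\<lambda>n. x * p ^ n)"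
    using landau_o.big.compose[OF f lim] .
  also have "(\<lambda>n. x * p ^ n) \<in> O(\<lambda>n. p ^ n)" by simp
  finally have 2: "(\<lambda>n. f (x * p ^ n)) \<in> O(\<lambda>n. p ^ n)" .
  hence "(\<lambda>n. of_nat n * f (x * p ^ n)) \<in> O(\<lambda>n. of_nat n * p ^ n)"
    by (intro landau_o.big.mult) auto
  thus "(\<lambda>n::nat. of_nat n * f (x * p ^ n)) summable_on UNIV"
    using p summable_on_nat_bigo by blast
  have "(\<lambda>n. 1 * p ^ n) \<in> O(\<lambda>n. of_nat n * p ^ n)"
    by (intro landau_o.big.mult bigoI[of _ 1] eventually_sequentiallyI[of 1] landau_o.big_refl) auto
  hence "(\<lambda>n. p ^ n) \<in> O(\<lambda>n. of_nat n * p ^ n)" by simp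
  with 2 have "(\<lambda>n. f (x * p ^ n)) \<in> O(\<lambda>n. of_nat n * p ^ n)"
    by (rule landau_o.big_trans)
  thus "(\<lambda>n::nat. f (x * p ^ n)) summable_on UNIV"
    using p summable_on_nat_bigo by blast
qed

text \<open>The half with negative n is an orbit of \<open>inverse x\<close> for the inverted
  function, hence the decay required at both 0 and infinity.\<close>

lemma summable_on_geometric_orbit_int:
  fixes f :: "complex \<Rightarrow> complex"
  assumes f: "f \<in> O[at 0](\<lambda>z. z)" "(\<lambda>z. f (inverse z)) \<in> O[at 0](\<lambda>z. z)"
    and x: "x \<noteq> 0" and p: "p \<noteq> 0" "norm p < 1"
  shows "(\<lambda>n::int. of_int n * f (x * p powi n)) summable_on UNIV"
    and "(\<lambda>n::int. f (x * p powi n)) summable_on UNIV"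
proof -
  note a = summable_on_geometric_orbit[OF f(1) x p]
  have "inverse x \<noteq> 0" using x by simp
  note b = summable_on_geometric_orbit[OF f(2) this p]
  have e: "inverse (inverse x * p ^ n) = x * p powi (- int n)" for n
    by (simp add: power_int_minus)
  show "(\<lambda>n::int. of_int n * f (x * p powi n)) summable_on UNIV"
  proof (rule summable_on_intI)
    show "(\<lambda>n. of_int (int n) * f (x * p powi int n)) summable_on UNIV"
      using a(1) by (simp only: of_int_of_nat_eq power_int_of_nat)
    show "(\<lambda>n. of_int (- int n) * f (x * p powi (- int n))) summable_on UNIV"
      using summable_on_uminus[THEN iffD2, OF b(1)]
      by (simp only: e of_int_minus of_int_of_nat_eq minus_mult_left)
  qed
  show "(\<lambda>n::int. f (x * p powi n)) summable_on UNIV"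
  proof (rule summable_on_intI)
    show "(\<lambda>n. f (x * p powi int n)) summable_on UNIV"
      using a(2) by (simp only: power_int_of_nat)
    show "(\<lambda>n. f (x * p powi (- int n))) summable_on UNIV"
      using b(2) by (simp only: e)
  qed
qed

lemma summable_on_times:
  fixes f :: "'a \<Rightarrow> complex" and g :: "'b \<Rightarrow> complex"
  assumes "f summable_on A" "g summable_on B"
  shows "(\<lambda>(x, y). f x * g y) summable_on A \<times> B"
proof -
  have f: "(\<lambda>x. norm (f x)) summable_on A"
    using assms(1) by (rule summable_on_iff_abs_summable_on_complex[THEN iffD1])
  have g: "(\<lambda>y. norm (g y)) summable_on B"
    using assms(2) by (rule summable_on_iff_abs_summable_on_complex[THEN iffD1])
  have "(\<lambda>(x, y). norm (f x) * norm (g y)) summable_on A \<times> B"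
  proof (rule summable_on_SigmaI)
    show "((\<lambda>y. case (x, y) of (x, y) \<Rightarrow> norm (f x) * norm (g y)) has_sum norm (f x) * (\<Sum>\<^sub>\<infinity>y\<in>B. norm (g y))) B" for x
      using has_sum_cmult_right[OF has_sum_infsum[OF g]] by simp
    show "(\<lambda>x. norm (f x) * (\<Sum>\<^sub>\<infinity>y\<in>B. norm (g y))) summable_on A"
      using f by (rule summable_on_cmult_left)
  qed auto
  hence "(\<lambda>z. norm (case z of (x, y) \<Rightarrow> f x * g y)) summable_on A \<times> B"
    by (simp add: case_prod_unfold norm_mult)
  thus ?thesis
    by (rule summable_on_iff_abs_summable_on_complex[THEN iffD2])
qed

text \<open>Grouping by the index difference d is chosen because x p^n and s x p^(n+d) have a ratio
  independent of n: partial fractions then have coefficients that are constant in the inner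
  sum.\<close>

lemma has_sum_int_convolution:
  fixes f g :: "int \<Rightarrow> complex"
  assumes "f summable_on UNIV" "g summable_on UNIV"
  shows "((\<lambda>d. \<Sum>\<^sub>\<infinity>n. f n * g (n + d)) has_sum (infsum f UNIV * infsum g UNIV)) UNIV"
    and "(\<lambda>n. f n * g (n + d)) summable_on UNIV"
proof -
  have S: "(\<lambda>(n, m). f n * g m) summable_on UNIV \<times> UNIV"
    using assms by (rule summable_on_times)
  have "infsum (\<lambda>(n, m). f n * g m) (UNIV \<times> UNIV) = (\<Sum>\<^sub>\<infinity>n. \<Sum>\<^sub>\<infinity>m. f n * g m)"
    using infsum_Sigma'_banach[OF S] by simp
  also have "\<dots> = infsum f UNIV * infsum g UNIV"
    by (simp add: infsum_cmult_right' infsum_cmult_left')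
  finally have H: "((\<lambda>(n, m). f n * g m) has_sum (infsum f UNIV * infsum g UNIV)) (UNIV \<times> UNIV)"
    using S by (simp add: has_sum_iff)
  have H': "((\<lambda>(d, n). f n * g (n + d)) has_sum (infsum f UNIV * infsum g UNIV)) (UNIV \<times> UNIV)"
    by (rule has_sum_reindex_bij_witness[of _ "\<lambda>(n, m). (m - n, n)" "\<lambda>(d, n). (n, n + d)", THEN iffD2, OF _ _ _ _ _ _ H]) auto
  show s: "(\<lambda>n. f n * g (n + d)) summable_on UNIV" for d
    using summable_on_SigmaD1[of "\<lambda>d n. f n * g (n + d)" UNIV "\<lambda>_. UNIV" d] H'
    by (auto simp: has_sum_iff)
  show "((\<lambda>d. \<Sum>\<^sub>\<infinity>n. f n * g (n + d)) has_sum (infsum f UNIV * infsum g UNIV)) UNIV"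
    using has_sum_SigmaD[OF H', of "\<lambda>d. \<Sum>\<^sub>\<infinity>n. f n * g (n + d)"] s by simp
qed

lemma has_sum_shift_int:
  fixes f :: "int \<Rightarrow> 'a :: {comm_monoid_add, topological_space}"
  shows "((\<lambda>n. f (n + d)) has_sum S) UNIV \<longleftrightarrow> (f has_sum S) UNIV"
proof -
  have "bij_betw (\<lambda>n. n + d) UNIV UNIV"
    by (rule bij_betw_byWitness[where f' = "\<lambda>n. n - d"]) auto
  thus ?thesis by (rule has_sum_reindex_bij_betw)
qed

text \<open>The functions \<open>g\<close> and \<open>h\<close> themselves need not be summable;
  they approach A and B at the two ends. Shifting the step function by d changes it at |d| places,
  by A - B for positive d and by B - A for negative d.\<close>

lemma has_sum_telescope_int:
  fixes g h :: "int \<Rightarrow> complex" and A B :: complex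
  assumes g: "((\<lambda>n. g n - (if n \<ge> 0 then A else B)) has_sum R) UNIV"
    and h: "((\<lambda>n. h n - (if n \<ge> 0 then A else B)) has_sum R') UNIV"
  shows "((\<lambda>n. g (n + d) - h n) has_sum (R - R' + of_int d * (A - B))) UNIV"
proof -
  define \<sigma> where "\<sigma> = (\<lambda>n::int. if n \<ge> 0 then A else B)"
  have \<sigma>: "((\<lambda>n. \<sigma> (n + d) - \<sigma> n) has_sum (of_int d * (A - B))) UNIV"
  proof (cases "d \<ge> 0")
    case True
    have "(\<Sum>n\<in>{-d..<0}. \<sigma> (n + d) - \<sigma> n) = (\<Sum>n\<in>{-d..<0}. A - B)"
      by (intro sum.cong) (auto simp: \<sigma>_def)
    hence "((\<lambda>n. \<sigma> (n + d) - \<sigma> n) has_sum (\<Sum>n\<in>{-d..<0}. A - B)) UNIV"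
      by (intro has_sum_finite_neutralI[of "{-d..<0}"]) (use True in \<open>auto simp: \<sigma>_def\<close>)
    thus ?thesis using True by simp
  next
    case False
    have "(\<Sum>n\<in>{0..<-d}. \<sigma> (n + d) - \<sigma> n) = (\<Sum>n\<in>{0..<-d}. B - A)"
      by (intro sum.cong) (auto simp: \<sigma>_def)
    hence "((\<lambda>n. \<sigma> (n + d) - \<sigma> n) has_sum (\<Sum>n\<in>{0..<-d}. B - A)) UNIV"
      by (intro has_sum_finite_neutralI[of "{0..<-d}"]) (use False in \<open>auto simp: \<sigma>_def\<close>)
    thus ?thesis using False by (simp add: algebra_simps)
  qed
  have \<sigma>_eq: "(if n \<ge> 0 then A else B) = \<sigma> n" for n
    by (simp add: \<sigma>_def)
  have g': "((\<lambda>n. g (n + d) - \<sigma> (n + d)) has_sum R) UNIV"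
    using g has_sum_shift_int[of "\<lambda>n. g n - \<sigma> n" d] by (simp only: \<sigma>_eq)
  have h': "((\<lambda>n. h n - \<sigma> n) has_sum R') UNIV"
    using h by (simp only: \<sigma>_eq)
  have "((\<lambda>n. g (n + d) - \<sigma> (n + d) + - (h n - \<sigma> n) + (\<sigma> (n + d) - \<sigma> n)) has_sum (R + - R' + of_int d * (A - B))) UNIV"
    by (intro has_sum_add has_sum_uminusI g' h' \<sigma>)
  also have "(\<lambda>n. g (n + d) - \<sigma> (n + d) + - (h n - \<sigma> n) + (\<sigma> (n + d) - \<sigma> n)) = (\<lambda>n. g (n + d) - h n)"
    by (simp add: fun_eq_iff)
  finally show ?thesis by simp
qed

section \<open>The kernel x / (1 - x)^2, its partial fractions and its bilateral sums\<close>

text \<open>In the variable \<open>u = ln x\<close>, \<open>koebe\<close> is the derivative of \<open>half_cayley\<close> and \<open>koebe'\<close> that of \<open>koebe\<close>.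
  All three vanish at their pole \<open>1\<close>, so that the sums below silently omit a polar term.\<close>

definition koebe :: "complex \<Rightarrow> complex" where "koebe x = x / (1 - x) ^ 2"
definition koebe' :: "complex \<Rightarrow> complex" where "koebe' x = x * (1 + x) / (1 - x) ^ 3"
definition half_cayley :: "complex \<Rightarrow> complex" where "half_cayley x = (1 + x) / (2 * (1 - x))"

text \<open>Partial fractions in x, with double poles at 1 and 1/Q. The simple-pole parts combine to
  a difference of values of \<open>half_cayley\<close>, which telescopes along an orbit.\<close>

lemma koebe_mult:
  assumes "x \<noteq> 1" "Q \<noteq> 1" "Q * x \<noteq> 1"
  shows "koebe x * koebe (Q * x) = koebe Q * (koebe x + koebe (Q * x)) + koebe' Q * (half_cayley (Q * x) - half_cayley x)"
proof -
  \<comment> \<open>In terms of 1 - x, 1 - Q and 1 - Q x = c every denominator is a power of a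
    single variable.\<close>
  define a b where "a = 1 - x" and "b = 1 - Q"
  define c where "c = a + b - a * b"
  have x: "x = 1 - a" "Q = 1 - b" "1 - (1 - b) * (1 - a) = c" "(1 - b) * (1 - a) = 1 - c"
    by (simp_all add: a_def b_def c_def algebra_simps)
  have nz: "a \<noteq> 0" "b \<noteq> 0" "c \<noteq> 0" using assms by (auto simp: a_def b_def c_def algebra_simps)
  have "(1 - a) / a\<^sup>2 * ((1 - c) / c\<^sup>2) = (1 - b) / b\<^sup>2 * ((1 - a) / a\<^sup>2 + (1 - c) / c\<^sup>2)
      + (1 - b) * (2 - b) / b ^ 3 * ((2 - c) / (2 * c) - (2 - a) / (2 * a))"
    using nz by (simp add: divide_simps) (simp add: c_def eval_nat_numeral algebra_simps)
  thus ?thesis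
    unfolding koebe_def koebe'_def half_cayley_def x by simp
qed

lemma koebe_inverse: "x \<noteq> 0 \<Longrightarrow> koebe (inverse x) = koebe x"
  by (cases "x = 1") (auto simp: koebe_def field_simps power2_eq_square)

lemma koebe'_inverse: "x \<noteq> 0 \<Longrightarrow> koebe' (inverse x) = - koebe' x"
proof (cases "x = 1")
  case False
  assume "x \<noteq> 0"
  have "1 - inverse x = - ((1 - x) / x)" "1 + inverse x = (1 + x) / x"
    using \<open>x \<noteq> 0\<close> by (simp_all add: field_simps)
  thus ?thesis
    using \<open>x \<noteq> 0\<close> False unfolding koebe'_def by (simp add: power3_eq_cube divide_simps) (simp add: algebra_simps)
qed (simp add: koebe'_def)

lemma half_cayley_inverse: "x \<noteq> 0 \<Longrightarrow> half_cayley (inverse x) = - half_cayley x"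
  by (cases "x = 1") (auto simp: half_cayley_def divide_simps algebra_simps)

lemma bigo_ident_at_0:
  fixes f g :: "complex \<Rightarrow> complex"
  assumes "(g \<longlongrightarrow> L) (at 0)" "\<And>z. z \<noteq> 0 \<Longrightarrow> z \<noteq> 1 \<Longrightarrow> f z = z * g z"
  shows "f \<in> O[at 0](\<lambda>z. z)"
proof (rule bigoI_tendsto)
  have "\<forall>\<^sub>F z::complex in at 0. z \<noteq> 0 \<and> z \<noteq> 1"
    by (intro eventually_conj eventually_neq_at_within)
  hence "\<forall>\<^sub>F z in at 0. g z = f z / z"
    by eventually_elim (simp add: assms(2))
  from Lim_transform_eventually[OF assms(1) this] show "((\<lambda>z. f z / z) \<longlongrightarrow> L) (at 0)" .
qed (auto simp: eventually_at_filter)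

lemma koebe_bigo: "koebe \<in> O[at 0](\<lambda>z. z)" "(\<lambda>z. koebe (inverse z)) \<in> O[at 0](\<lambda>z. z)"
proof -
  have "((\<lambda>z::complex. 1 / (1 - z) ^ 2) \<longlongrightarrow> 1) (at 0)" by (auto intro!: tendsto_eq_intros)
  thus "koebe \<in> O[at 0](\<lambda>z. z)" "(\<lambda>z. koebe (inverse z)) \<in> O[at 0](\<lambda>z. z)"
    by (rule bigo_ident_at_0; simp add: koebe_inverse; simp add: koebe_def)+
qed

lemma koebe'_bigo: "koebe' \<in> O[at 0](\<lambda>z. z)" "(\<lambda>z. koebe' (inverse z)) \<in> O[at 0](\<lambda>z. z)"
proof -
  have *: "((\<lambda>z::complex. (1 + z) / (1 - z) ^ 3) \<longlongrightarrow> 1) (at 0)" by (auto intro!: tendsto_eq_intros)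
  thus "koebe' \<in> O[at 0](\<lambda>z. z)"
    by (rule bigo_ident_at_0) (simp add: koebe'_def)
  have "((\<lambda>z::complex. - ((1 + z) / (1 - z) ^ 3)) \<longlongrightarrow> -1) (at 0)" by (intro tendsto_minus *)
  thus "(\<lambda>z. koebe' (inverse z)) \<in> O[at 0](\<lambda>z. z)"
    by (rule bigo_ident_at_0) (simp add: koebe'_inverse, simp add: koebe'_def)
qed

lemma half_cayley_bigo: "(\<lambda>z. half_cayley z - 1 / 2) \<in> O[at 0](\<lambda>z. z)"
proof -
  have "((\<lambda>z::complex. 1 / (1 - z)) \<longlongrightarrow> 1) (at 0)" by (auto intro!: tendsto_eq_intros)
  thus ?thesis
    by (rule bigo_ident_at_0) (simp add: half_cayley_def divide_simps)
qed

definition koebe_sum :: "complex \<Rightarrow> complex \<Rightarrow> complex" where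
  "koebe_sum p x = (\<Sum>\<^sub>\<infinity>n::int. koebe (x * p powi n))"

context
  fixes p :: complex
  assumes p: "p \<noteq> 0" "norm p < 1"
begin

lemma koebe_summable: "x \<noteq> 0 \<Longrightarrow> (\<lambda>n::int. koebe (x * p powi n)) summable_on UNIV"
  by (rule summable_on_geometric_orbit_int(2)[OF koebe_bigo _ p])

lemma koebe_has_sum: "x \<noteq> 0 \<Longrightarrow> ((\<lambda>n::int. koebe (x * p powi n)) has_sum koebe_sum p x) UNIV"
  unfolding koebe_sum_def using koebe_summable by simp

lemma koebe'_summable: 
  assumes "x \<noteq> 0"
  shows "(\<lambda>n::int. of_int n * koebe' (x * p powi n)) summable_on UNIV"
    and "(\<lambda>n::int. koebe' (x * p powi n)) summable_on UNIV"
  by (rule summable_on_geometric_orbit_int[OF koebe'_bigo assms p])+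

lemma koebe_square_summable:
  assumes "x \<noteq> 0"
  shows "(\<lambda>n::int. koebe (x * p powi n) ^ 2) summable_on UNIV"
proof -
  have "(\<lambda>z::complex. z) \<in> O[at 0](\<lambda>_. 1)"
    by (rule bigoI_tendsto[of _ _ 0]) (auto intro!: tendsto_eq_intros)
  hence *: "(\<lambda>z. f z ^ 2) \<in> O[at 0](\<lambda>z. z)" if "f \<in> O[at 0](\<lambda>z. z)" for f :: "complex \<Rightarrow> complex"
    using landau_o.big.mult[OF that landau_o.big_trans[OF that], of "\<lambda>_. 1"] by (simp add: power2_eq_square)
  show ?thesis
    using *[OF koebe_bigo(1)] *[OF koebe_bigo(2)] assms p
    by (rule summable_on_geometric_orbit_int(2)[where f = "\<lambda>z. koebe z ^ 2"])
qed

lemma half_cayley_summable: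
  assumes "x \<noteq> 0"
  shows "(\<lambda>n::int. half_cayley (x * p powi n) - (if n \<ge> 0 then 1 / 2 else - 1 / 2)) summable_on UNIV"
proof (rule summable_on_intI)
  show "(\<lambda>n. half_cayley (x * p powi int n) - (if int n \<ge> 0 then 1 / 2 else - 1 / 2)) summable_on UNIV"
    using summable_on_geometric_orbit(2)[OF half_cayley_bigo assms p] by simp
  have "inverse x \<noteq> 0" using assms by simp
  from summable_on_geometric_orbit(2)[OF half_cayley_bigo this p]
  have "(\<lambda>n. half_cayley (inverse x * p ^ n) - 1 / 2) summable_on UNIV" .
  from summable_on_uminus[THEN iffD2, OF this]
  have "(\<lambda>n. - (half_cayley (inverse x * p ^ n) - 1 / 2)) summable_on UNIV" .
  also have "(\<lambda>n. - (half_cayley (inverse x * p ^ n) - 1 / 2)) = (\<lambda>n. half_cayley (x * p powi - int n) - (- 1 / 2))"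
  proof
    fix n
    have "x * p powi - int n = inverse (inverse x * p ^ n)" by (simp add: power_int_minus)
    hence "half_cayley (x * p powi - int n) = half_cayley (inverse (inverse x * p ^ n))"
      by (rule arg_cong)
    also have "\<dots> = - half_cayley (inverse x * p ^ n)"
      by (rule half_cayley_inverse) (use assms p in simp)
    finally have "half_cayley (x * p powi - int n) = - half_cayley (inverse x * p ^ n)" .
    thus "- (half_cayley (inverse x * p ^ n) - 1 / 2) = half_cayley (x * p powi - int n) - (- 1 / 2)"
      by (simp only: minus_diff_eq) simp
  qed
  finally have "(\<lambda>n. half_cayley (x * p powi - int n) - (- 1 / 2)) summable_on UNIV" .
  \<comment> \<open>The reflected half contains the index 0 too, where the step function is 1/2 and
    not -1/2; this term is taken out and put back.\<close>
  hence "(\<lambda>n. half_cayley (x * p powi - int n) - (- 1 / 2)) summable_on (UNIV - {0})"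
    by (rule summable_on_subset_banach) auto
  also have "?this \<longleftrightarrow> (\<lambda>n. half_cayley (x * p powi - int n) - (if - int n \<ge> 0 then 1 / 2 else - 1 / 2)) summable_on (UNIV - {0})"
    by (intro summable_on_cong) auto
  finally have "(\<lambda>n. half_cayley (x * p powi - int n) - (if - int n \<ge> 0 then 1 / 2 else - 1 / 2)) summable_on insert 0 (UNIV - {0})"
    by (subst summable_on_insert_iff)
  thus "(\<lambda>n. half_cayley (x * p powi - int n) - (if - int n \<ge> 0 then 1 / 2 else - 1 / 2)) summable_on UNIV"
    by (simp add: insert_UNIV)
qed

end

lemma has_sum_int_even_odd:
  fixes f :: "int \<Rightarrow> complex"
  assumes "((\<lambda>n. f (2 * n)) has_sum A) UNIV" "((\<lambda>n. f (2 * n + 1)) has_sum B) UNIV"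
  shows "(f has_sum (A + B)) UNIV"
proof -
  have bij: "bij_betw (\<lambda>n. 2 * n) UNIV {n::int. even n}" "bij_betw (\<lambda>n. 2 * n + 1) UNIV {n::int. odd n}"
    by (rule bij_betw_byWitness[where f' = "\<lambda>n. n div 2"]; auto)+
  have "(f has_sum A) {n. even n}" "(f has_sum B) {n. odd n}"
    using assms has_sum_reindex_bij_betw[OF bij(1), of f A] has_sum_reindex_bij_betw[OF bij(2), of f B] by auto
  hence "(f has_sum (A + B)) ({n. even n} \<union> {n. odd n})"
    by (rule has_sum_Un_disjoint) auto
  also have "{n. even n} \<union> {n. odd n} = (UNIV :: int set)" by auto
  finally show ?thesis .
qed

lemma norm_power_int_eq_1_iff:
  fixes p :: complex
  assumes "p \<noteq> 0" "norm p < 1"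
  shows "norm (p powi n) = 1 \<longleftrightarrow> n = 0"
proof -
  have *: "norm p ^ k = 1 \<longleftrightarrow> k = 0" for k
    using power_Suc_less_one[of "norm p" "k - 1"] assms by (cases k) auto
  show ?thesis
    by (cases n rule: int_cases2) (auto simp: norm_power_int power_int_minus * norm_inverse norm_power)
qed

text \<open>The left side is the correction for the polar term omitted at x = 1 in
  \<open>koebe_sum_half_period\<close>. Without \<open>half_cayley\<close> its sum over the orbit is
  expressible by \<open>koebe_sum\<close> and \<open>koebe2_sum\<close>.\<close>

lemma koebe'_times_half_cayley: "Q \<noteq> 1 \<Longrightarrow> koebe Q ^ 2 + koebe' Q * half_cayley Q = koebe Q / 2 + 3 * koebe Q ^ 2"
proof -
  assume "Q \<noteq> 1"
  hence "1 - Q \<noteq> 0" by simp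
  define b where "b = 1 - Q"
  have Q: "Q = 1 - b" "b \<noteq> 0" using \<open>1 - Q \<noteq> 0\<close> by (simp_all add: b_def)
  show ?thesis
    unfolding koebe_def koebe'_def half_cayley_def Q using Q(2)
    by (simp add: divide_simps) (simp add: eval_nat_numeral algebra_simps)
qed

definition half_cayley_sum :: "complex \<Rightarrow> complex \<Rightarrow> complex" where
  "half_cayley_sum p x = (\<Sum>\<^sub>\<infinity>n::int. half_cayley (x * p powi n) - (if n \<ge> 0 then 1 / 2 else - 1 / 2))"

text \<open>The weight n comes from telescoping: shifting the orbit by d changes the regularised sum
  of \<open>half_cayley\<close> by d.\<close>

definition koebe'_sum :: "complex \<Rightarrow> complex \<Rightarrow> complex" where
  "koebe'_sum p x = (\<Sum>\<^sub>\<infinity>n::int. of_int n * koebe' (x * p powi n))"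

definition koebe2_sum :: "complex \<Rightarrow> complex \<Rightarrow> complex" where
  "koebe2_sum p x = (\<Sum>\<^sub>\<infinity>n::int. koebe (x * p powi n) ^ 2)"

context
  fixes p :: complex
  assumes p: "p \<noteq> 0" "norm p < 1"
begin

lemma half_cayley_has_sum:
  assumes "x \<noteq> 0" "y \<noteq> 0"
  shows "((\<lambda>n. half_cayley (y * p powi (n + d)) - half_cayley (x * p powi n)) has_sum
     (half_cayley_sum p y - half_cayley_sum p x + of_int d)) UNIV"
  using has_sum_telescope_int[OF has_sum_infsum[OF half_cayley_summable[OF p assms(2)]]
       has_sum_infsum[OF half_cayley_summable[OF p assms(1)]], of d]
  unfolding half_cayley_sum_def by simp

text \<open>Kept apart from the product that \<open>koebe_mult\<close> expands, because it is also
  needed at x = 1, where product and expansion differ at n = 0.\<close>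

lemma koebe_product_expansion_has_sum:
  assumes "x \<noteq> 0" "s \<noteq> 0"
  shows "((\<lambda>n. koebe (s * p powi d) * (koebe (x * p powi n) + koebe (s * x * p powi (n + d)))
       + koebe' (s * p powi d) * (half_cayley (s * x * p powi (n + d)) - half_cayley (x * p powi n)))
     has_sum (koebe (s * p powi d) * (koebe_sum p x + koebe_sum p (s * x))
       + koebe' (s * p powi d) * (half_cayley_sum p (s * x) - half_cayley_sum p x + of_int d))) UNIV"
proof (intro has_sum_add has_sum_cmult_right)
  show "((\<lambda>n. koebe (x * p powi n)) has_sum koebe_sum p x) UNIV"
    using koebe_has_sum[OF p] assms by simp
  show "((\<lambda>n. koebe (s * x * p powi (n + d))) has_sum koebe_sum p (s * x)) UNIV"
    using koebe_has_sum[OF p, of "s * x"] assms has_sum_shift_int[of "\<lambda>n. koebe (s * x * p powi n)" d] by simp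
  show "((\<lambda>n. half_cayley (s * x * p powi (n + d)) - half_cayley (x * p powi n)) has_sum
      (half_cayley_sum p (s * x) - half_cayley_sum p x + of_int d)) UNIV"
    using assms by (intro half_cayley_has_sum) auto
qed

lemma koebe_orbit_mult:
  assumes "x * p powi n \<noteq> 1" "s * p powi d \<noteq> 1" "s * x * p powi (n + d) \<noteq> 1"
  shows "koebe (x * p powi n) * koebe (s * x * p powi (n + d)) =
       koebe (s * p powi d) * (koebe (x * p powi n) + koebe (s * x * p powi (n + d)))
       + koebe' (s * p powi d) * (half_cayley (s * x * p powi (n + d)) - half_cayley (x * p powi n))"
proof -
  have "s * x * p powi (n + d) = (s * p powi d) * (x * p powi n)"
    using p by (simp add: power_int_add)
  thus ?thesis using assms koebe_mult[of "x * p powi n" "s * p powi d"] by (simp only: simp_thms)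
qed

lemma koebe_orbit_has_sum:
  assumes "x \<noteq> 0" "s \<noteq> 0" "\<And>n. x * p powi n \<noteq> 1" "\<And>n. s * x * p powi n \<noteq> 1" "s * p powi d \<noteq> 1"
  shows "((\<lambda>n. koebe (x * p powi n) * koebe (s * x * p powi (n + d))) has_sum
     (koebe (s * p powi d) * (koebe_sum p x + koebe_sum p (s * x))
       + koebe' (s * p powi d) * (half_cayley_sum p (s * x) - half_cayley_sum p x + of_int d))) UNIV"
  using koebe_product_expansion_has_sum[OF assms(1,2), of d] koebe_orbit_mult[OF assms(3,5,4)] by simp

text \<open>Convolution with s = 1: the values of \<open>half_cayley_sum\<close> cancel, d = 0
  leaves the sum of squares, and telescoping for d \<noteq> 0 leaves the constant
  \<open>koebe'_sum p 1\<close>. The identity serves to eliminate \<open>koebe2_sum\<close>.\<close>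

lemma koebe_sum_square:
  assumes x: "x \<noteq> 0" "\<And>n. x * p powi n \<noteq> 1"
  shows "koebe_sum p x ^ 2 = koebe2_sum p x + 2 * koebe_sum p 1 * koebe_sum p x + koebe'_sum p 1"
proof -
  let ?c = "\<lambda>d. \<Sum>\<^sub>\<infinity>n. koebe (x * p powi n) * koebe (x * p powi (n + d))"
  \<comment> \<open>Since \<open>koebe 1\<close> and \<open>koebe' 1\<close> are 0, the second
    summand can be written for d = 0 as well and summed over all d.\<close>
  have "?c d = (if d = 0 then koebe2_sum p x else 0) + (2 * koebe_sum p x * koebe (1 * p powi d) + of_int d * koebe' (1 * p powi d))" for d
  proof (cases "d = 0")
    case True
    thus ?thesis by (simp add: koebe2_sum_def power2_eq_square koebe_def koebe'_def)
  next
    case False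
    have "1 * p powi d \<noteq> 1"
      using norm_power_int_eq_1_iff[OF p, of d] False by auto
    from infsumI[OF koebe_orbit_has_sum[OF x(1) _ x(2) _ this]] x(2) show ?thesis
      using False by (simp add: algebra_simps)
  qed
  moreover have "(?c has_sum (koebe_sum p x * koebe_sum p x)) UNIV"
    using has_sum_int_convolution(1)[OF koebe_summable koebe_summable, OF p x(1) p x(1)]
    unfolding koebe_sum_def .
  moreover have "((\<lambda>d. (if d = 0 then koebe2_sum p x else 0) + (2 * koebe_sum p x * koebe (1 * p powi d) + of_int d * koebe' (1 * p powi d)))
      has_sum (koebe2_sum p x + (2 * koebe_sum p x * koebe_sum p 1 + koebe'_sum p 1))) UNIV"
  proof (intro has_sum_add has_sum_cmult_right)
    show "((\<lambda>d::int. if d = 0 then koebe2_sum p x else 0) has_sum koebe2_sum p x) UNIV"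
      by (rule has_sum_finite_neutralI[of "{0}"]) auto
    show "((\<lambda>d. koebe (1 * p powi d)) has_sum koebe_sum p 1) UNIV"
      by (rule koebe_has_sum[OF p]) simp
    show "((\<lambda>d. of_int d * koebe' (1 * p powi d)) has_sum koebe'_sum p 1) UNIV"
      unfolding koebe'_sum_def by (rule has_sum_infsum[OF koebe'_summable(1)[OF p]]) simp
  qed
  ultimately have "koebe_sum p x * koebe_sum p x = koebe2_sum p x + (2 * koebe_sum p x * koebe_sum p 1 + koebe'_sum p 1)"
    using has_sum_unique by (simp only:)
  thus ?thesis by (simp add: power2_eq_square algebra_simps)
qed

text \<open>As s s = p^j, the involution d -> - j - d inverts s p^d, and \<open>koebe'\<close> is
  odd under inversion; the sum equals its own negative.\<close>

lemma koebe'_has_sum_0: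
  assumes "s \<noteq> 0" "s * s = p powi j"
  shows "((\<lambda>d. koebe' (s * p powi d)) has_sum 0) UNIV"
proof -
  have bij: "bij_betw (\<lambda>d. - j - d) UNIV UNIV"
    by (rule bij_betw_byWitness[where f' = "\<lambda>d. - j - d"]) auto
  obtain S where S: "((\<lambda>d. koebe' (s * p powi d)) has_sum S) UNIV"
    using koebe'_summable(2)[OF p assms(1)] by (auto simp: summable_on_def)
  have "((\<lambda>d. koebe' (s * p powi (- j - d))) has_sum S) UNIV"
    using has_sum_reindex_bij_betw[OF bij, of "\<lambda>d. koebe' (s * p powi d)" S] S by simp
  also have "(\<lambda>d. koebe' (s * p powi (- j - d))) = (\<lambda>d. - koebe' (s * p powi d))"
  proof
    fix d
    have "s * p powi d * (s * p powi (- j - d)) = s * s * p powi (d + (- j - d))"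
      using p(1) by (subst power_int_add) auto
    also have "\<dots> = p powi (j + (d + (- j - d)))"
      using p(1) unfolding assms(2) by (subst power_int_add) auto
    finally have "s * p powi d * (s * p powi (- j - d)) = 1" by simp
    from inverse_unique[OF this] have "s * p powi (- j - d) = inverse (s * p powi d)" ..
    thus "koebe' (s * p powi (- j - d)) = - koebe' (s * p powi d)"
      using p assms(1) by (subst koebe'_inverse[symmetric]) auto
  qed
  finally have "((\<lambda>d. koebe' (s * p powi d)) has_sum - S) UNIV"
    by (subst (asm) has_sum_uminus) simp
  from has_sum_unique[OF this S] have "S = 0" by simp
  with S show ?thesis by simp
qed

text \<open>For a half period \<open>s\<close> the terms \<open>koebe' (s * p powi d)\<close> cancel in pairs, which removes the
  contribution of \<open>half_cayley_sum\<close>.\<close>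

lemma koebe_sum_mult_aux:
  assumes x: "x \<noteq> 0" and s: "s \<noteq> 0" "s * s = p powi j"
    and c: "\<And>d. (\<Sum>\<^sub>\<infinity>n. koebe (x * p powi n) * koebe (s * x * p powi (n + d))) =
      koebe (s * p powi d) * (koebe_sum p x + koebe_sum p (s * x))
       + koebe' (s * p powi d) * (half_cayley_sum p (s * x) - half_cayley_sum p x + of_int d) - h d"
    and h: "(h has_sum H) UNIV"
  shows "koebe_sum p x * koebe_sum p (s * x) = koebe_sum p s * (koebe_sum p x + koebe_sum p (s * x)) + koebe'_sum p s - H"
proof -
  have "((\<lambda>d. \<Sum>\<^sub>\<infinity>n. koebe (x * p powi n) * koebe (s * x * p powi (n + d))) has_sum (koebe_sum p x * koebe_sum p (s * x))) UNIV"
    using has_sum_int_convolution(1)[OF koebe_summable koebe_summable, OF p x p, of "s * x"] x s(1)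
    unfolding koebe_sum_def by simp
  moreover have "((\<lambda>d. koebe (s * p powi d) * (koebe_sum p x + koebe_sum p (s * x))
       + (koebe' (s * p powi d) * (half_cayley_sum p (s * x) - half_cayley_sum p x) + of_int d * koebe' (s * p powi d)) + - h d) has_sum
      (koebe_sum p s * (koebe_sum p x + koebe_sum p (s * x))
       + (0 * (half_cayley_sum p (s * x) - half_cayley_sum p x) + koebe'_sum p s) + - H)) UNIV"
  proof (intro has_sum_add has_sum_cmult_left has_sum_uminusI h)
    show "((\<lambda>d. koebe (s * p powi d)) has_sum koebe_sum p s) UNIV"
      by (rule koebe_has_sum[OF p s(1)])
    show "((\<lambda>d. koebe' (s * p powi d)) has_sum 0) UNIV"
      by (rule koebe'_has_sum_0[OF s])
    show "((\<lambda>d. of_int d * koebe' (s * p powi d)) has_sum koebe'_sum p s) UNIV"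
      unfolding koebe'_sum_def by (rule has_sum_infsum[OF koebe'_summable(1)[OF p s(1)]])
  qed
  moreover have "(\<lambda>d. \<Sum>\<^sub>\<infinity>n. koebe (x * p powi n) * koebe (s * x * p powi (n + d))) =
     (\<lambda>d. koebe (s * p powi d) * (koebe_sum p x + koebe_sum p (s * x))
       + (koebe' (s * p powi d) * (half_cayley_sum p (s * x) - half_cayley_sum p x) + of_int d * koebe' (s * p powi d)) + - h d)"
    unfolding c by (simp add: fun_eq_iff algebra_simps)
  ultimately have "koebe_sum p x * koebe_sum p (s * x) = (koebe_sum p s * (koebe_sum p x + koebe_sum p (s * x))
       + (0 * (half_cayley_sum p (s * x) - half_cayley_sum p x) + koebe'_sum p s) + - H)"
    using has_sum_unique by (simp only:)
  thus ?thesis by simp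
qed

text \<open>The counterpart of the classical fact that (P(u + w) - e) (P(u) - e) is constant for the
  Weierstrass function P, a half period w and e = P(w). The constant is half the second derivative
  at the half period, as \<open>koebe\<close> has second derivative koebe + 6 koebe^2 in ln
  x.\<close>

lemma koebe_sum_half_period:
  assumes s: "s \<noteq> 0" "s * s = p powi j" "\<And>n. s * p powi n \<noteq> 1"
    and x: "x \<noteq> 0" "\<And>n. x * p powi n \<noteq> 1" "\<And>n. s * x * p powi n \<noteq> 1"
  shows "(koebe_sum p x - koebe_sum p s) * (koebe_sum p (s * x) - koebe_sum p s)
       = koebe_sum p s / 2 + 3 * koebe2_sum p s"
proof -
  have 1: "koebe_sum p x * koebe_sum p (s * x) = koebe_sum p s * (koebe_sum p x + koebe_sum p (s * x)) + koebe'_sum p s - 0"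
  proof (rule koebe_sum_mult_aux[OF x(1) s(1,2)])
    show "(\<Sum>\<^sub>\<infinity>n. koebe (x * p powi n) * koebe (s * x * p powi (n + d))) =
      koebe (s * p powi d) * (koebe_sum p x + koebe_sum p (s * x))
       + koebe' (s * p powi d) * (half_cayley_sum p (s * x) - half_cayley_sum p x + of_int d) - 0" for d
      using infsumI[OF koebe_orbit_has_sum[OF x(1) s(1) x(2,3) s(3)]] by simp
  qed simp
  \<comment> \<open>The same product at \<open>x = 1\<close>, where the omitted polar term at \<open>n = 0\<close> leaves the correction \<open>h\<close>;
    it evaluates the constant \<open>koebe'_sum p s\<close>.\<close>
  have 2: "koebe_sum p 1 * koebe_sum p (s * 1) = koebe_sum p s * (koebe_sum p 1 + koebe_sum p (s * 1)) + koebe'_sum p s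
        - (koebe_sum p s * (1 / 2) + 3 * koebe2_sum p s)"
  proof (rule koebe_sum_mult_aux[OF _ s(1,2)])
    show "((\<lambda>d. koebe (s * p powi d) * (1 / 2) + 3 * koebe (s * p powi d) ^ 2) has_sum
        (koebe_sum p s * (1 / 2) + 3 * koebe2_sum p s)) UNIV"
      unfolding koebe2_sum_def
      by (intro has_sum_add has_sum_cmult_left has_sum_cmult_right has_sum_infsum koebe_has_sum koebe_square_summable p s)
    show "(\<Sum>\<^sub>\<infinity>n. koebe (1 * p powi n) * koebe (s * 1 * p powi (n + d))) =
      koebe (s * p powi d) * (koebe_sum p 1 + koebe_sum p (s * 1))
       + koebe' (s * p powi d) * (half_cayley_sum p (s * 1) - half_cayley_sum p 1 + of_int d) -
         (koebe (s * p powi d) * (1 / 2) + 3 * koebe (s * p powi d) ^ 2)" for d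
    proof (rule infsumI)
      let ?Q = "s * p powi d"
      define h where "h = koebe ?Q ^ 2 + koebe' ?Q * half_cayley ?Q"
      have "((\<lambda>n. koebe ?Q * (koebe (1 * p powi n) + koebe (s * 1 * p powi (n + d)))
         + koebe' ?Q * (half_cayley (s * 1 * p powi (n + d)) - half_cayley (1 * p powi n)) + (if n = 0 then - h else 0))
        has_sum (koebe ?Q * (koebe_sum p 1 + koebe_sum p (s * 1))
         + koebe' ?Q * (half_cayley_sum p (s * 1) - half_cayley_sum p 1 + of_int d) + - h)) UNIV"
      proof (rule has_sum_add)
        show "((\<lambda>n::int. if n = 0 then - h else 0) has_sum - h) UNIV"
          by (rule has_sum_finite_neutralI[of "{0}"]) auto
      qed (rule koebe_product_expansion_has_sum, use s in auto)
      also have "(\<lambda>n. koebe ?Q * (koebe (1 * p powi n) + koebe (s * 1 * p powi (n + d)))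
         + koebe' ?Q * (half_cayley (s * 1 * p powi (n + d)) - half_cayley (1 * p powi n)) + (if n = 0 then - h else 0))
         = (\<lambda>n. koebe (1 * p powi n) * koebe (s * 1 * p powi (n + d)))"
      proof
        fix n
        show "koebe ?Q * (koebe (1 * p powi n) + koebe (s * 1 * p powi (n + d)))
         + koebe' ?Q * (half_cayley (s * 1 * p powi (n + d)) - half_cayley (1 * p powi n)) + (if n = 0 then - h else 0)
         = koebe (1 * p powi n) * koebe (s * 1 * p powi (n + d))"
        proof (cases "n = 0")
          case True
          thus ?thesis by (simp add: h_def koebe_def[of 1] half_cayley_def[of 1] power2_eq_square)
        next
          case False
          have "1 * p powi n \<noteq> 1"
            using norm_power_int_eq_1_iff[OF p, of n] False by auto
          thus ?thesis
            using koebe_orbit_mult[of 1 n s d] s(3)[of d] s(3)[of "n + d"] False by simp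
        qed
      qed
      also have "koebe ?Q * (koebe_sum p 1 + koebe_sum p (s * 1))
         + koebe' ?Q * (half_cayley_sum p (s * 1) - half_cayley_sum p 1 + of_int d) + - h =
         koebe ?Q * (koebe_sum p 1 + koebe_sum p (s * 1))
         + koebe' ?Q * (half_cayley_sum p (s * 1) - half_cayley_sum p 1 + of_int d) - (koebe ?Q * (1 / 2) + 3 * koebe ?Q ^ 2)"
        using koebe'_times_half_cayley[OF s(3)[of d]] by (simp add: h_def)
      finally show "((\<lambda>n. koebe (1 * p powi n) * koebe (s * 1 * p powi (n + d))) has_sum
         koebe ?Q * (koebe_sum p 1 + koebe_sum p (s * 1))
         + koebe' ?Q * (half_cayley_sum p (s * 1) - half_cayley_sum p 1 + of_int d) - (koebe ?Q * (1 / 2) + 3 * koebe ?Q ^ 2)) UNIV" .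
    qed
  qed simp
  show ?thesis
    using 1 2 by (simp add: algebra_simps)
qed

end


section \<open>Half-period values and the alternating sum\<close>

definition koebe_alt_sum :: "complex \<Rightarrow> complex" where
  "koebe_alt_sum q = (\<Sum>\<^sub>\<infinity>n::int. (-1) powi n * q powi n / (1 + q powi n) ^ 2)"

text \<open>As koebe (- z) = - z / (1 + z)^2, the even indices run through the orbit of -1 under q^2
  with reversed sign, the odd ones through the orbit of -q.\<close>

lemma koebe_alt_has_sum:
  assumes q: "q \<noteq> 0" "norm q < 1"
  shows "((\<lambda>n::int. (-1) powi n * q powi n / (1 + q powi n) ^ 2) has_sum (koebe_sum (q\<^sup>2) (-q) - koebe_sum (q\<^sup>2) (-1))) UNIV"
proof -
  have p: "q\<^sup>2 \<noteq> 0" "norm (q\<^sup>2) < 1"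
    using q by (auto simp: norm_power power_less_one_iff)
  have e: "(q\<^sup>2) powi n = q powi (2 * n)" for n
    by (simp add: power_int_mult)
  have k: "koebe (- z) = - (z / (1 + z) ^ 2)" for z
    by (simp add: koebe_def)
  have "((\<lambda>n::int. koebe (-1 * (q\<^sup>2) powi n)) has_sum koebe_sum (q\<^sup>2) (-1)) UNIV"
    by (rule koebe_has_sum[OF p]) simp
  hence "((\<lambda>n::int. - koebe (-1 * (q\<^sup>2) powi n)) has_sum - koebe_sum (q\<^sup>2) (-1)) UNIV"
    by (rule has_sum_uminusI)
  also have "(\<lambda>n::int. - koebe (-1 * (q\<^sup>2) powi n)) = (\<lambda>n. (-1) powi (2 * n) * q powi (2 * n) / (1 + q powi (2 * n)) ^ 2)"
  proof
    fix n
    have "-1 * (q\<^sup>2) powi n = - (q powi (2 * n))"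
      by (simp add: e)
    moreover have "(-1 :: complex) powi (2 * n) = 1"
      by (simp add: power_int_mult)
    ultimately show "- koebe (-1 * (q\<^sup>2) powi n) = (-1) powi (2 * n) * q powi (2 * n) / (1 + q powi (2 * n)) ^ 2"
      by (simp only: k) simp
  qed
  finally have 1: "((\<lambda>n. (-1) powi (2 * n) * q powi (2 * n) / (1 + q powi (2 * n)) ^ 2) has_sum - koebe_sum (q\<^sup>2) (-1)) UNIV" .
  have "((\<lambda>n::int. koebe (-q * (q\<^sup>2) powi n)) has_sum koebe_sum (q\<^sup>2) (-q)) UNIV"
    by (rule koebe_has_sum[OF p]) (use q in simp)
  also have "(\<lambda>n::int. koebe (-q * (q\<^sup>2) powi n)) = (\<lambda>n. (-1) powi (2 * n + 1) * q powi (2 * n + 1) / (1 + q powi (2 * n + 1)) ^ 2)"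
  proof
    fix n
    have "-q * (q\<^sup>2) powi n = - (q powi (2 * n + 1))"
      using q by (simp add: e power_int_add)
    moreover have "(-1 :: complex) powi (2 * n + 1) = -1"
      by (simp add: power_int_add power_int_mult)
    ultimately show "koebe (-q * (q\<^sup>2) powi n) = (-1) powi (2 * n + 1) * q powi (2 * n + 1) / (1 + q powi (2 * n + 1)) ^ 2"
      by (simp only: k) simp
  qed
  finally have 2: "((\<lambda>n. (-1) powi (2 * n + 1) * q powi (2 * n + 1) / (1 + q powi (2 * n + 1)) ^ 2) has_sum koebe_sum (q\<^sup>2) (-q)) UNIV" .
  from has_sum_int_even_odd[OF 1 2] show ?thesis by simp
qed

text \<open>For the period \<open>q\<^sup>2\<close> the half periods are \<open>-1\<close>, \<open>q\<close> and \<open>-q\<close>. With \<open>e\<^sub>1, e\<^sub>2, e\<^sub>3\<close> the values of the bilateral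
  sum there, \<open>(e\<^sub>2 - e\<^sub>1) (e\<^sub>3 - e\<^sub>1) + (e\<^sub>1 - e\<^sub>3) (e\<^sub>2 - e\<^sub>3) = (e\<^sub>3 - e\<^sub>1)\<^sup>2\<close>.\<close>

lemma koebe_alt_sum_square:
  assumes q: "q \<noteq> 0" "norm q < 1"
  shows "koebe_alt_sum q ^ 2 = koebe_sum q (-1) / 2 + 3 * koebe2_sum q (-1)"
proof -
  define p where "p = q\<^sup>2"
  have p: "p \<noteq> 0" "norm p < 1"
    using q by (auto simp: p_def norm_power power_less_one_iff)
  have e: "p powi n = q powi (2 * n)" for n
    by (simp add: p_def power_int_mult)
  have nz1: "-1 * p powi n \<noteq> 1" for n
  proof
    assume *: "-1 * p powi n = 1"
    have "norm (p powi n) = norm (-1 * p powi n)" by simp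
    also have "\<dots> = 1" unfolding * by simp
    finally have "norm (p powi n) = 1" .
    hence "n = 0" using norm_power_int_eq_1_iff[OF p] by blast
    with * show False by simp
  qed
  have odd: "norm (q * p powi n) \<noteq> 1" for n
  proof
    assume "norm (q * p powi n) = 1"
    also have "q * p powi n = q powi (2 * n + 1)" using q by (simp add: e power_int_add)
    finally have "2 * n + 1 = 0" using norm_power_int_eq_1_iff[OF q] by blast
    thus False by presburger
  qed
  have nz2: "q * p powi n \<noteq> 1" for n using odd[of n] by auto
  have nz3: "-q * p powi n \<noteq> 1" for n
  proof
    assume *: "-q * p powi n = 1"
    have "norm (q * p powi n) = norm (-q * p powi n)" by simp
    also have "\<dots> = 1" unfolding * by simp
    finally show False using odd[of n] by simp
  qed
  \<comment> \<open>Half period s = -1 with s s = p^0 and x = q; in \<open>B\<close> it is s = -q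
    with s s = p^1 and x = -1.\<close>
  have A: "(koebe_sum p q - koebe_sum p (-1)) * (koebe_sum p (-q) - koebe_sum p (-1)) = koebe_sum p (-1) / 2 + 3 * koebe2_sum p (-1)"
    using koebe_sum_half_period[OF p, of "-1" 0 q] nz1 nz2 nz3 q by simp
  have B: "(koebe_sum p (-1) - koebe_sum p (-q)) * (koebe_sum p q - koebe_sum p (-q)) = koebe_sum p (-q) / 2 + 3 * koebe2_sum p (-q)"
    using koebe_sum_half_period[OF p, of "-q" 1 "-1"] nz1 nz2 nz3 q by (simp add: p_def power2_eq_square)
  \<comment> \<open>The orbit of -1 under q splits into the orbits of -1 and -q under q^2, so the
    constants of \<open>A\<close> and \<open>B\<close> add up to the one for period q.\<close>
  have ev: "-1 * p powi n = -1 * q powi (2 * n)" and od: "-q * p powi n = -1 * q powi (2 * n + 1)" for n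
    using q by (simp_all add: e power_int_add)
  have "((\<lambda>n. koebe (-1 * q powi n)) has_sum (koebe_sum p (-1) + koebe_sum p (-q))) UNIV"
    using koebe_has_sum[OF p, of "-1"] koebe_has_sum[OF p, of "-q"] q unfolding ev od
    by (intro has_sum_int_even_odd) simp_all
  moreover have "((\<lambda>n. koebe (-1 * q powi n)) has_sum koebe_sum q (-1)) UNIV"
    by (rule koebe_has_sum[OF q]) simp
  ultimately have C: "koebe_sum q (-1) = koebe_sum p (-1) + koebe_sum p (-q)"
    using has_sum_unique by blast
  have h2: "((\<lambda>n. koebe (x * p' powi n) ^ 2) has_sum koebe2_sum p' x) UNIV" if "p' \<noteq> 0" "norm p' < 1" "x \<noteq> 0" for x p'
    unfolding koebe2_sum_def by (rule has_sum_infsum[OF koebe_square_summable[OF that]])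
  have "((\<lambda>n. koebe (-1 * q powi n) ^ 2) has_sum (koebe2_sum p (-1) + koebe2_sum p (-q))) UNIV"
    using h2[OF p, of "-1"] h2[OF p, of "-q"] q unfolding ev od
    by (intro has_sum_int_even_odd) simp_all
  moreover have "((\<lambda>n. koebe (-1 * q powi n) ^ 2) has_sum koebe2_sum q (-1)) UNIV"
    by (rule h2[OF q]) simp
  ultimately have D: "koebe2_sum q (-1) = koebe2_sum p (-1) + koebe2_sum p (-q)"
    using has_sum_unique by blast
  have U: "koebe_alt_sum q = koebe_sum p (-q) - koebe_sum p (-1)"
    unfolding koebe_alt_sum_def p_def by (rule infsumI[OF koebe_alt_has_sum[OF q]])
  have "koebe_alt_sum q ^ 2 = (koebe_sum p (-q) - koebe_sum p (-1)) ^ 2"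
    unfolding U ..
  also have "\<dots> = (koebe_sum p q - koebe_sum p (-1)) * (koebe_sum p (-q) - koebe_sum p (-1))
      + (koebe_sum p (-1) - koebe_sum p (-q)) * (koebe_sum p q - koebe_sum p (-q))"
    by (simp add: power2_eq_square algebra_simps)
  finally show ?thesis unfolding A B C D by (simp add: add_divide_distrib algebra_simps)
qed

subsection \<open>Lambert series as Taylor coefficients\<close>

lemma has_sum_int_split:
  fixes f :: "int \<Rightarrow> complex"
  assumes "((\<lambda>n. f (int (Suc n))) has_sum A) UNIV" "((\<lambda>n. f (- int (Suc n))) has_sum B) UNIV"
  shows "(f has_sum (f 0 + A + B)) UNIV"
proof -
  have bij: "bij_betw (\<lambda>n. int (Suc n)) UNIV {0<..}" "bij_betw (\<lambda>n. - int (Suc n)) UNIV {..<0}"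
    by (rule bij_betw_byWitness[where f' = "\<lambda>n. nat (n - 1)"]; auto)
       (rule bij_betw_byWitness[where f' = "\<lambda>n. nat (- n - 1)"]; auto)
  have "(f has_sum A) {0<..}" "(f has_sum B) {..<0}"
    using assms has_sum_reindex_bij_betw[OF bij(1), of f A] has_sum_reindex_bij_betw[OF bij(2), of f B] by auto
  moreover have "(f has_sum f 0) {0}"
    by (rule has_sum_finiteI) auto
  ultimately have "(f has_sum (f 0 + A + B)) ({0} \<union> {0<..} \<union> {..<0})"
    by (intro has_sum_Un_disjoint) auto
  also have "{0} \<union> {0<..} \<union> {..<0} = (UNIV :: int set)" by auto
  finally show ?thesis .
qed

text \<open>This is the coefficient of z^k in the square of the sum of r z^r, so
  \<open>koebe z ^ 2\<close> generates (r^3 - r) / 6.\<close>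

lemma sum_mult_diff: "(\<Sum>i\<le>k. of_nat i * of_nat (k - i) :: 'a :: field_char_0) = (of_nat k ^ 3 - of_nat k) / 6"
proof -
  have 1: "(\<Sum>i\<le>k. of_nat i :: 'a) = of_nat k * (of_nat k + 1) / 2"
    by (induction k) (simp_all add: field_simps)
  have 2: "(\<Sum>i\<le>k. of_nat i ^ 2 :: 'a) = of_nat k * (of_nat k + 1) * (2 * of_nat k + 1) / 6"
    by (induction k) (simp_all add: field_simps power2_eq_square)
  have "(\<Sum>i\<le>k. of_nat i * of_nat (k - i) :: 'a) = (\<Sum>i\<le>k. of_nat k * of_nat i - of_nat i ^ 2)"
    by (intro sum.cong refl) (simp add: of_nat_diff algebra_simps power2_eq_square)
  also have "\<dots> = of_nat k * (\<Sum>i\<le>k. of_nat i) - (\<Sum>i\<le>k. of_nat i ^ 2)"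
    by (simp add: sum_subtractf sum_distrib_left)
  also have "\<dots> = (of_nat k ^ 3 - of_nat k) / 6"
    unfolding 1 2 by (simp add: field_simps power2_eq_square power3_eq_cube)
  finally show ?thesis .
qed

text \<open>Only \<open>j = 1\<close> and \<open>j = 3\<close> are meaningful; then \<open>koebe_gen j z\<close> is the sum of \<open>r\<^sup>j z\<^sup>r\<close>.\<close>

definition koebe_gen :: "nat \<Rightarrow> complex \<Rightarrow> complex" where
  "koebe_gen j z = (if j = 1 then koebe z else koebe z + 6 * koebe z ^ 2)"

lemma koebe_gen_inverse: "z \<noteq> 0 \<Longrightarrow> koebe_gen j (inverse z) = koebe_gen j z"
  by (simp add: koebe_gen_def koebe_inverse)

lemma summable_on_power_times_geometric:
  fixes z :: complex
  assumes "norm z < 1"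
  shows "(\<lambda>r::nat. of_nat r ^ j * z ^ r) summable_on UNIV"
proof (rule norm_summable_imp_summable_on)
  show "summable (\<lambda>r. norm (of_nat r ^ j * z ^ r))"
    using summable_power_times_geometric[of "norm z" j] assms by (simp add: norm_mult norm_power)
qed

text \<open>For j = 3, adding 6 times the Cauchy square of the series for j = 1 turns r into r +
  (r^3 - r) = r^3.\<close>

lemma koebe_gen_has_sum:
  assumes "norm z < 1" "j \<in> {1, 3}"
  shows "((\<lambda>r::nat. of_nat r ^ j * z ^ r) has_sum koebe_gen j z) UNIV"
proof -
  have 1: "(\<lambda>r. of_nat r * z ^ r) sums koebe z"
  proof -
    have "(\<lambda>r. z * (of_nat (Suc r) * z ^ r)) sums (z * (1 / (1 - z)\<^sup>2))"
      by (intro sums_mult geometric_deriv_sums assms)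
    hence "(\<lambda>r. (\<lambda>r. of_nat r * z ^ r) (Suc r)) sums koebe z"
      by (simp add: koebe_def mult_ac)
    thus ?thesis by (subst (asm) sums_Suc_iff) simp
  qed
  have n: "summable (\<lambda>r. norm (of_nat r * z ^ r))"
    using summable_power_times_geometric[of "norm z" 1] assms by (simp add: norm_mult norm_power)
  have "(\<lambda>k. \<Sum>i\<le>k. (of_nat i * z ^ i) * (of_nat (k - i) * z ^ (k - i))) sums (koebe z * koebe z)"
    using Cauchy_product_sums[OF n n] 1 by (simp add: sums_iff)
  also have "(\<lambda>k. \<Sum>i\<le>k. (of_nat i * z ^ i) * (of_nat (k - i) * z ^ (k - i))) = (\<lambda>k. (of_nat k ^ 3 - of_nat k) / 6 * z ^ k)"
  proof
    fix k
    have "(\<Sum>i\<le>k. (of_nat i * z ^ i) * (of_nat (k - i) * z ^ (k - i))) = (\<Sum>i\<le>k. (of_nat i * of_nat (k - i)) * z ^ k)"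
      by (intro sum.cong refl) (simp add: mult_ac power_add[symmetric])
    also have "\<dots> = (of_nat k ^ 3 - of_nat k) / 6 * z ^ k"
      unfolding sum_distrib_right[symmetric] sum_mult_diff ..
    finally show "(\<Sum>i\<le>k. (of_nat i * z ^ i) * (of_nat (k - i) * z ^ (k - i))) = (of_nat k ^ 3 - of_nat k) / 6 * z ^ k" .
  qed
  finally have "(\<lambda>k. (of_nat k ^ 3 - of_nat k) / 6 * z ^ k) sums (koebe z ^ 2)"
    by (simp add: power2_eq_square)
  from sums_add[OF 1 sums_mult[OF this, of 6]]
  have "(\<lambda>r. of_nat r * z ^ r + 6 * ((of_nat r ^ 3 - of_nat r) / 6 * z ^ r)) sums (koebe z + 6 * koebe z ^ 2)" .
  also have "(\<lambda>r. of_nat r * z ^ r + 6 * ((of_nat r ^ 3 - of_nat r) / 6 * z ^ r)) = (\<lambda>r. of_nat r ^ 3 * z ^ r)"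
    by (simp add: fun_eq_iff field_simps)
  finally have 3: "(\<lambda>r. of_nat r ^ 3 * z ^ r) sums (koebe z + 6 * koebe z ^ 2)" .
  have s: "(\<lambda>r::nat. of_nat r ^ j * z ^ r) sums koebe_gen j z"
    using 1 3 assms(2) by (auto simp: koebe_gen_def)
  have "((\<lambda>r::nat. of_nat r ^ j * z ^ r) has_sum infsum (\<lambda>r. of_nat r ^ j * z ^ r) UNIV) UNIV"
    by (rule has_sum_infsum[OF summable_on_power_times_geometric[OF assms(1)]])
  with s has_sum_imp_sums[OF this] show ?thesis
    using sums_unique2 by force
qed

lemma summable_on_comparison_complex:
  fixes f :: "'a \<Rightarrow> complex" and g :: "'a \<Rightarrow> complex"
  assumes "g summable_on A" "\<And>x. x \<in> A \<Longrightarrow> norm (f x) \<le> norm (g x)"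
  shows "f summable_on A"
proof -
  have "(\<lambda>x. norm (g x)) summable_on A"
    using assms(1) by (rule summable_on_iff_abs_summable_on_complex[THEN iffD1])
  hence "(\<lambda>x. norm (f x)) summable_on A"
    by (rule summable_on_comparison_test) (use assms(2) in auto)
  thus ?thesis by (rule summable_on_iff_abs_summable_on_complex[THEN iffD2])
qed

lemma geometric_has_sum_Suc:
  fixes z :: complex
  assumes "norm z < 1"
  shows "((\<lambda>n. z ^ Suc n) has_sum (z / (1 - z))) UNIV"
proof (rule norm_summable_imp_has_sum)
  show "summable (\<lambda>n. norm (z ^ Suc n))"
    using assms by (simp add: norm_mult norm_power summable_mult summable_geometric)
  have "(\<lambda>n. z * z ^ n) sums (z * (1 / (1 - z)))"
    by (intro sums_mult geometric_sums assms)
  thus "(\<lambda>n. z ^ Suc n) sums (z / (1 - z))" by simp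
qed

lemma exp_has_sum:
  fixes z :: "'a :: {real_normed_field, banach}"
  shows "((\<lambda>m. z ^ m / fact m) has_sum exp z) UNIV"
proof (rule norm_summable_imp_has_sum)
  show "summable (\<lambda>m. norm (z ^ m / fact m))"
    using summable_norm_exp[of z] by (simp add: divide_inverse norm_mult mult_ac scaleR_conv_of_real)
  show "(\<lambda>m. z ^ m / fact m) sums exp z"
    using exp_converges[of z] by (simp add: divide_inverse scaleR_conv_of_real mult_ac)
qed

section \<open>Lambert series as rearranged double series\<close>

context
  fixes q :: complex
  assumes q: "q \<noteq> 0" "norm q < 1"
begin

text \<open>For r \<ge> 1 the factor |q|^(r n) is at most |q|^n, which gives a product majorant; r =
  0, where q^r = 1, is removed by j \<ge> 1. Values |y| > 1 are allowed, as needed for y = - exp u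
  near u = 0.\<close>

lemma lambert_double_summable:
  assumes y: "norm (y * q) < 1" and j: "j \<ge> 1"
  shows "(\<lambda>(r::nat, n::nat). of_nat r ^ j * y ^ r * (q ^ r) ^ Suc n) summable_on UNIV \<times> UNIV"
proof (rule summable_on_comparison_complex)
  show "(\<lambda>(r, n). (of_nat r ^ j * (y * q) ^ r) * (of_nat n ^ 0 * q ^ n)) summable_on UNIV \<times> UNIV"
    by (intro summable_on_times summable_on_power_times_geometric y q)
  fix z :: "nat \<times> nat" assume "z \<in> UNIV \<times> UNIV"
  obtain r n where z: "z = (r, n)" by (cases z)
  show "norm (case z of (r, n) \<Rightarrow> of_nat r ^ j * y ^ r * (q ^ r) ^ Suc n)
      \<le> norm (case z of (r, n) \<Rightarrow> of_nat r ^ j * (y * q) ^ r * (of_nat n ^ 0 * q ^ n))"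
  proof (cases "r = 0")
    case True
    thus ?thesis using j by (simp add: z power_0_left)
  next
    case False
    have "norm q ^ (r * n) \<le> norm q ^ n"
      using q False by (intro power_decreasing) auto
    hence "norm (of_nat r ^ j * y ^ r * q ^ r) * norm q ^ (r * n) \<le> norm (of_nat r ^ j * y ^ r * q ^ r) * norm q ^ n"
      by (intro mult_left_mono) auto
    moreover have "(q ^ r) ^ Suc n = q ^ r * q ^ (r * n)" by (simp add: power_mult)
    ultimately show ?thesis
      by (simp only: z prod.case) (simp add: norm_mult norm_power power_mult_distrib mult_ac)
  qed
qed

lemma lambert_coeff_has_sum:
  assumes y: "norm (y * q) < 1" and j: "j \<ge> 1"
  shows "((\<lambda>r::nat. of_nat r ^ j * y ^ r * (q ^ r / (1 - q ^ r))) has_sum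
     (\<Sum>\<^sub>\<infinity>(r::nat, n::nat). of_nat r ^ j * y ^ r * (q ^ r) ^ Suc n)) UNIV"
proof (rule has_sum_SigmaD)
  show "((\<lambda>(r::nat, n::nat). of_nat r ^ j * y ^ r * (q ^ r) ^ Suc n) has_sum
     (\<Sum>\<^sub>\<infinity>(r::nat, n::nat). of_nat r ^ j * y ^ r * (q ^ r) ^ Suc n)) (UNIV \<times> UNIV)"
    using has_sum_infsum[OF lambert_double_summable[OF assms]] by simp
  show "((\<lambda>n. case (r, n) of (r, n) \<Rightarrow> of_nat r ^ j * y ^ r * (q ^ r) ^ Suc n) has_sum
      (of_nat r ^ j * y ^ r * (q ^ r / (1 - q ^ r)))) UNIV" for r :: nat
  \<comment> \<open>For r = 0 the geometric series diverges, but the weight r^j makes every term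
    0.\<close>
  proof (cases "r = 0")
    case False
    hence "norm (q ^ r) < 1" using q by (simp add: norm_power power_less_one_iff)
    from has_sum_cmult_right[OF geometric_has_sum_Suc[OF this]] show ?thesis by simp
  qed (use j in \<open>simp add: power_0_left\<close>)
qed

text \<open>One double series in two orders: summing over n yields the Lambert coefficients, summing
  over r yields \<open>koebe_gen\<close>.\<close>

lemma koebe_gen_orbit_has_sum:
  assumes y: "norm (y * q) < 1" and j: "j \<in> {1, 3}"
  shows "((\<lambda>n. koebe_gen j (y * q ^ Suc n)) has_sum
     (\<Sum>\<^sub>\<infinity>r::nat. of_nat r ^ j * y ^ r * (q ^ r / (1 - q ^ r)))) UNIV"
proof (rule has_sum_SigmaD)
  have j': "j \<ge> 1" using j by auto
  have "((\<lambda>(r::nat, n::nat). of_nat r ^ j * y ^ r * (q ^ r) ^ Suc n) has_sum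
     (\<Sum>\<^sub>\<infinity>r::nat. of_nat r ^ j * y ^ r * (q ^ r / (1 - q ^ r)))) (UNIV \<times> UNIV)"
    using has_sum_infsum[OF lambert_double_summable[OF y j']] infsumI[OF lambert_coeff_has_sum[OF y j']] by simp
  thus "((\<lambda>(n::nat, r::nat). of_nat r ^ j * y ^ r * (q ^ r) ^ Suc n) has_sum
     (\<Sum>\<^sub>\<infinity>r::nat. of_nat r ^ j * y ^ r * (q ^ r / (1 - q ^ r)))) (UNIV \<times> UNIV)"
    by (subst has_sum_swap) simp
  show "((\<lambda>r. case (n, r) of (n, r) \<Rightarrow> of_nat r ^ j * y ^ r * (q ^ r) ^ Suc n) has_sum koebe_gen j (y * q ^ Suc n)) UNIV" for n
  proof -
    have "norm (y * q ^ Suc n) = norm (y * q) * norm q ^ n"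
      by (simp add: norm_mult norm_power)
    also have "\<dots> \<le> norm (y * q) * 1"
      using q by (intro mult_left_mono power_le_one) auto
    finally have "norm (y * q ^ Suc n) < 1" using y by simp
    from koebe_gen_has_sum[OF this j] show ?thesis
      by (simp add: power_mult_distrib mult_ac flip: power_mult)
  qed
qed

lemma lambert_G_has_sum:
  assumes "j \<ge> 1"
  shows "((\<lambda>r::nat. of_nat r ^ j * (-1) ^ r * (q ^ r / (1 - q ^ r))) has_sum lambert_G j q) UNIV"
proof -
  have "norm (-1 * q) < 1" using q by simp
  from lambert_coeff_has_sum[OF this assms] obtain S
    where S: "((\<lambda>r::nat. of_nat r ^ j * (-1) ^ r * (q ^ r / (1 - q ^ r))) has_sum S) UNIV" by blast
  from has_sum_imp_sums[OF S] have "(\<lambda>r. of_nat (Suc r) ^ j * (-1) ^ Suc r * (q ^ Suc r / (1 - q ^ Suc r))) sums S"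
    using assms by (subst sums_Suc_iff) simp
  hence "lambert_G j q = S"
    unfolding lambert_G_def by (subst sums_unique[symmetric]) (auto simp: mult_ac)
  with S show ?thesis by simp
qed

text \<open>Each exp (c u)^r is expanded in powers of u and the double series in r and m is
  rearranged; the majorant converges while |q| exp |u| < 1. The values c = 1 and c = -1 serve the
  two halves of the orbit.\<close>

lemma lambert_fps_expansion:
  assumes j: "j \<ge> 1" and c: "norm c = 1"
  shows "(\<lambda>u. \<Sum>\<^sub>\<infinity>r::nat. of_nat r ^ j * (- exp (c * u)) ^ r * (q ^ r / (1 - q ^ r)))
     has_fps_expansion Abs_fps (\<lambda>m. c ^ m * lambert_G (j + m) q / fact m)"
proof (rule has_fps_expansionI)
  have "((\<lambda>u. norm q * exp (norm u)) \<longlongrightarrow> norm q * exp (norm (0 :: complex))) (nhds 0)"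
    by (intro tendsto_intros) (auto simp: tendsto_norm_zero_iff filterlim_ident)
  hence "eventually (\<lambda>u::complex. norm q * exp (norm u) < 1) (nhds 0)"
    by (rule order_tendstoD) (use q in simp)
  thus "eventually (\<lambda>u. (\<lambda>m. fps_nth (Abs_fps (\<lambda>m. c ^ m * lambert_G (j + m) q / fact m)) m * u ^ m) sums
     (\<Sum>\<^sub>\<infinity>r::nat. of_nat r ^ j * (- exp (c * u)) ^ r * (q ^ r / (1 - q ^ r)))) (nhds 0)"
  proof eventually_elim
    case (elim u)
    define d where "d = (\<lambda>r::nat. of_nat r ^ j * (-1) ^ r * (q ^ r / (1 - q ^ r)))"
    have "(\<lambda>r. norm (of_nat r ^ j * of_real (exp (norm u)) ^ r * (q ^ r / (1 - q ^ r)))) summable_on UNIV"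
      using lambert_coeff_has_sum[of "of_real (exp (norm u))", OF _ j] elim
      by (intro summable_on_iff_abs_summable_on_complex[THEN iffD1]) (auto simp: summable_on_def norm_mult mult.commute)
    also have "(\<lambda>r. norm (of_nat r ^ j * of_real (exp (norm u)) ^ r * (q ^ r / (1 - q ^ r)))) = (\<lambda>r. norm (d r) * exp (real r * norm u))"
      by (simp add: d_def norm_mult norm_divide norm_power exp_of_nat_mult fun_eq_iff mult_ac)
    finally have sd: "(\<lambda>r. norm (d r) * exp (real r * norm u)) summable_on UNIV" .
    have "(\<lambda>(r, m). norm (d r) * ((real r * norm u) ^ m / fact m)) summable_on UNIV \<times> UNIV"
    proof (rule summable_on_SigmaI)
      show "((\<lambda>m. case (r, m) of (r, m) \<Rightarrow> norm (d r) * ((real r * norm u) ^ m / fact m)) has_sum norm (d r) * exp (real r * norm u)) UNIV" for r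
        unfolding prod.case by (intro has_sum_cmult_right exp_has_sum)
    qed (use sd in auto)
    also have "(\<lambda>(r, m). norm (d r) * ((real r * norm u) ^ m / fact m)) = (\<lambda>z. norm (case z of (r, m) \<Rightarrow> d r * ((c * of_nat r * u) ^ m / fact m)))"
      using c by (auto simp: fun_eq_iff norm_mult norm_divide norm_power)
    finally have "(\<lambda>(r, m). d r * ((c * of_nat r * u) ^ m / fact m)) summable_on UNIV \<times> UNIV"
      by (rule summable_on_iff_abs_summable_on_complex[THEN iffD2])
    then obtain S where S: "((\<lambda>(r, m). d r * ((c * of_nat r * u) ^ m / fact m)) has_sum S) (UNIV \<times> UNIV)"
      by (auto simp: summable_on_def)
    have "((\<lambda>r. d r * exp (c * of_nat r * u)) has_sum S) UNIV"
      by (rule has_sum_SigmaD[OF S]) (unfold prod.case, intro has_sum_cmult_right exp_has_sum)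
    also have "(\<lambda>r. d r * exp (c * of_nat r * u)) = (\<lambda>r. of_nat r ^ j * (- exp (c * u)) ^ r * (q ^ r / (1 - q ^ r)))"
    proof
      fix r
      have "exp (c * of_nat r * u) = exp (c * u) ^ r"
        by (simp add: exp_of_nat_mult[symmetric] mult_ac)
      thus "d r * exp (c * of_nat r * u) = of_nat r ^ j * (- exp (c * u)) ^ r * (q ^ r / (1 - q ^ r))"
        by (simp add: d_def power_minus[of "exp (c * u)"] mult_ac)
    qed
    finally have 1: "S = (\<Sum>\<^sub>\<infinity>r::nat. of_nat r ^ j * (- exp (c * u)) ^ r * (q ^ r / (1 - q ^ r)))"
      by (rule infsumI[symmetric])
    have "((\<lambda>(m, r). d r * ((c * of_nat r * u) ^ m / fact m)) has_sum S) (UNIV \<times> UNIV)"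
      using S by (subst has_sum_swap) simp
    hence "((\<lambda>m. lambert_G (j + m) q * ((c * u) ^ m / fact m)) has_sum S) UNIV"
    proof (rule has_sum_SigmaD)
      fix m
      from has_sum_cmult_left[OF lambert_G_has_sum[of "j + m"], of "(c * u) ^ m / fact m"] j
      show "((\<lambda>r. case (m, r) of (m, r) \<Rightarrow> d r * ((c * of_nat r * u) ^ m / fact m)) has_sum lambert_G (j + m) q * ((c * u) ^ m / fact m)) UNIV"
        by (simp add: d_def power_add power_mult_distrib mult_ac)
    qed
    from has_sum_imp_sums[OF this] show ?case
      unfolding 1 by (simp add: power_mult_distrib mult_ac)
  qed
qed

text \<open>The index 0 contributes \<open>H\<close>, positive indices the expansion with c = 1 and,
  by invariance under inversion, negative ones that with c = -1. The odd powers of u cancel between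
  the two halves.\<close>

lemma koebe_gen_sum_fps_expansion:
  assumes j: "j \<in> {1, 3}" and H: "(\<lambda>u. koebe_gen j (- exp u)) has_fps_expansion H"
  shows "(\<lambda>u. \<Sum>\<^sub>\<infinity>n::int. koebe_gen j (- exp u * q powi n)) has_fps_expansion
     (H + Abs_fps (\<lambda>m. (1 + (-1) ^ m) * lambert_G (j + m) q / fact m))"
proof -
  define L where "L = (\<lambda>c u. \<Sum>\<^sub>\<infinity>r::nat. of_nat r ^ j * (- exp (c * u)) ^ r * (q ^ r / (1 - q ^ r)))"
  have j': "j \<ge> 1" using j by auto
  have "(\<lambda>u. koebe_gen j (- exp u) + L 1 u + L (-1) u) has_fps_expansion
     (H + Abs_fps (\<lambda>m. 1 ^ m * lambert_G (j + m) q / fact m) + Abs_fps (\<lambda>m. (-1) ^ m * lambert_G (j + m) q / fact m))"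
    unfolding L_def by (intro has_fps_expansion_add H lambert_fps_expansion j') auto
  also have "(H + Abs_fps (\<lambda>m. 1 ^ m * lambert_G (j + m) q / fact m) + Abs_fps (\<lambda>m. (-1) ^ m * lambert_G (j + m) q / fact m))
      = H + Abs_fps (\<lambda>m. (1 + (-1) ^ m) * lambert_G (j + m) q / fact m)"
    by (simp add: fps_eq_iff add_divide_distrib algebra_simps)
  also have "((\<lambda>u. koebe_gen j (- exp u) + L 1 u + L (-1) u) has_fps_expansion
      H + Abs_fps (\<lambda>m. (1 + (-1) ^ m) * lambert_G (j + m) q / fact m)) \<longleftrightarrow> ?thesis"
  proof (rule has_fps_expansion_cong)
    have "((\<lambda>u. norm (- exp (1 * u) * q)) \<longlongrightarrow> norm (- exp (1 * 0) * q)) (nhds 0)"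
         "((\<lambda>u. norm (- exp (-1 * u) * q)) \<longlongrightarrow> norm (- exp (-1 * 0) * q)) (nhds 0)"
      by (intro tendsto_intros filterlim_ident)+
    hence "eventually (\<lambda>u. norm (- exp (1 * u) * q) < 1) (nhds 0)" "eventually (\<lambda>u. norm (- exp (-1 * u) * q) < 1) (nhds 0)"
      by (auto elim!: order_tendstoD simp: q)
    thus "\<forall>\<^sub>F u in nhds 0. koebe_gen j (- exp u) + L 1 u + L (-1) u = (\<Sum>\<^sub>\<infinity>n::int. koebe_gen j (- exp u * q powi n))"
    proof eventually_elim
      case (elim u)
      have "((\<lambda>n. koebe_gen j (- exp u * q powi n)) has_sum (koebe_gen j (- exp u * q powi 0) + L 1 u + L (-1) u)) UNIV"
      proof (rule has_sum_int_split)
        show "((\<lambda>n. koebe_gen j (- exp u * q powi int (Suc n))) has_sum L 1 u) UNIV"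
          using koebe_gen_orbit_has_sum[OF elim(1) j] by (simp add: L_def del: of_nat_Suc power_Suc)
        have "koebe_gen j (- exp u * q powi (- int (Suc n))) = koebe_gen j (- exp (-1 * u) * q ^ Suc n)" for n
        proof -
          have "- exp u * q powi (- int (Suc n)) = inverse (- exp (-1 * u) * q ^ Suc n)"
            by (simp add: power_int_minus exp_minus del: of_nat_Suc power_Suc)
          moreover have "- exp (-1 * u) * q ^ Suc n \<noteq> 0" using q by simp
          ultimately show ?thesis by (simp only: koebe_gen_inverse simp_thms)
        qed
        with koebe_gen_orbit_has_sum[OF elim(2) j]
        show "((\<lambda>n. koebe_gen j (- exp u * q powi - int (Suc n))) has_sum L (-1) u) UNIV"
          by (simp add: L_def del: of_nat_Suc power_Suc)
      qed
      thus ?case by (simp add: infsumI)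
    qed
  qed simp
  finally show ?thesis .
qed

end

section \<open>The term of index 0 as a formal power series\<close>

context
  fixes V :: "'a :: field_char_0 fps"
  assumes V: "V = inverse (1 + fps_exp 1)"
begin

lemma deriv_inverse_1_plus_exp: "fps_deriv V = V ^ 2 - V"
proof -
  have nz: "fps_nth (1 + fps_exp 1 :: 'a fps) 0 \<noteq> 0" by simp
  have "V * (1 + fps_exp 1) = 1"
    unfolding V using nz by (rule inverse_mult_eq_1)
  moreover have "V ^ 2 * fps_exp 1 = V * (V * (1 + fps_exp 1)) - V ^ 2"
    by (simp add: algebra_simps power2_eq_square)
  ultimately have e: "V ^ 2 * fps_exp 1 = V - V ^ 2" by simp
  have "fps_deriv V = - fps_deriv (1 + fps_exp 1) * V ^ 2"
    unfolding V by (rule fps_inverse_deriv[OF nz])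
  thus ?thesis using e by (simp add: algebra_simps)
qed

text \<open>With W = V^2 - V the Riccati equation gives W' = (2V - 1) W, and (2V - 1)^2 = 1 +
  4W.\<close>

lemma deriv2_of_riccati:
  shows "fps_deriv (fps_deriv (V ^ 2 - V)) = (V ^ 2 - V) + 6 * (V ^ 2 - V) ^ 2"
proof -
  have d: "fps_deriv (V ^ 2 - V) = (2 * V - 1) * (V ^ 2 - V)"
    by (simp add: power2_eq_square[of V] deriv_inverse_1_plus_exp algebra_simps)
  have d': "fps_deriv (2 * V - 1) = 2 * (V ^ 2 - V)"
    by (simp add: deriv_inverse_1_plus_exp)
  have "fps_deriv (fps_deriv (V ^ 2 - V)) = 2 * (V ^ 2 - V) * (V ^ 2 - V) + (2 * V - 1) * ((2 * V - 1) * (V ^ 2 - V))"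
    unfolding d fps_deriv_mult d' by (simp add: algebra_simps)
  also have "\<dots> = (V ^ 2 - V) + 6 * (V ^ 2 - V) ^ 2"
    by (simp add: algebra_simps power2_eq_square)
  finally show ?thesis .
qed

lemma riccati_square: "- fps_exp 1 * V ^ 2 = V ^ 2 - V"
proof -
  have nz: "fps_nth (1 + fps_exp 1 :: 'a fps) 0 \<noteq> 0" by simp
  have "fps_deriv V = - fps_deriv (1 + fps_exp 1) * V ^ 2"
    unfolding V by (rule fps_inverse_deriv[OF nz])
  thus ?thesis using deriv_inverse_1_plus_exp by simp
qed

end

definition koebe_fps :: "complex fps" where
  "koebe_fps = inverse (1 + fps_exp 1) ^ 2 - inverse (1 + fps_exp 1)"

lemma koebe_fps_expansion: "(\<lambda>u. koebe (- exp u)) has_fps_expansion koebe_fps"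
proof -
  have "(\<lambda>u::complex. - exp u * inverse (1 + exp u) ^ 2) has_fps_expansion - fps_exp 1 * inverse (1 + fps_exp 1) ^ 2"
    by (intro fps_expansion_intros) auto
  also have "- fps_exp 1 * inverse (1 + fps_exp 1) ^ 2 = koebe_fps"
    unfolding koebe_fps_def by (rule riccati_square[OF refl])
  also have "(\<lambda>u::complex. - exp u * inverse (1 + exp u) ^ 2) = (\<lambda>u. koebe (- exp u))"
    by (simp add: koebe_def fun_eq_iff divide_inverse power_inverse)
  finally show ?thesis .
qed

lemma koebe_fps_ode: "fps_deriv (fps_deriv koebe_fps) = koebe_fps + 6 * koebe_fps ^ 2"
  unfolding koebe_fps_def by (rule deriv2_of_riccati[OF refl])

text \<open>The series Y. The factor 1 + (-1)^m leaves only even m, hence only Lambert series with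
  odd exponents.\<close>

definition koebe_sum_fps :: "complex \<Rightarrow> complex fps" where
  "koebe_sum_fps q = koebe_fps + Abs_fps (\<lambda>m. (1 + (-1) ^ m) * lambert_G (1 + m) q / fact m)"

context
  fixes q :: complex
  assumes q: "q \<noteq> 0" "norm q < 1"
begin

lemma koebe_sum_fps_expansion: "(\<lambda>u. koebe_sum q (- exp u)) has_fps_expansion koebe_sum_fps q"
proof -
  have "(\<lambda>u. koebe_gen 1 (- exp u)) has_fps_expansion koebe_fps"
    using koebe_fps_expansion by (simp add: koebe_gen_def)
  from koebe_gen_sum_fps_expansion[OF q _ this] show ?thesis
    unfolding koebe_sum_def koebe_sum_fps_def by (simp add: koebe_gen_def)
qed

lemma koebe_gen_sum:
  assumes "x \<noteq> 0"
  shows "(\<Sum>\<^sub>\<infinity>n::int. koebe_gen 3 (x * q powi n)) = koebe_sum q x + 6 * koebe2_sum q x"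
proof (rule infsumI)
  show "((\<lambda>n::int. koebe_gen 3 (x * q powi n)) has_sum (koebe_sum q x + 6 * koebe2_sum q x)) UNIV"
    unfolding koebe_gen_def koebe2_sum_def
    by (simp, intro has_sum_add has_sum_cmult_right koebe_has_sum has_sum_infsum koebe_square_summable q assms)
qed

text \<open>Termwise differentiation of the bilateral sum is avoided: the sum of koebe + 6 koebe^2
  has its own expansion with \<open>lambert_G (3 + m)\<close>, and its coefficients are those of the
  formal second derivative.\<close>

lemma koebe_sum_fps_deriv2_expansion:
  "(\<lambda>u. koebe_sum q (- exp u) + 6 * koebe2_sum q (- exp u)) has_fps_expansion fps_deriv (fps_deriv (koebe_sum_fps q))"
proof -
  have "(\<lambda>u. koebe_gen 3 (- exp u)) has_fps_expansion koebe_fps + fps_const 6 * koebe_fps ^ 2"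
    unfolding koebe_gen_def by (simp, intro fps_expansion_intros koebe_fps_expansion)
  hence "(\<lambda>u. koebe_gen 3 (- exp u)) has_fps_expansion fps_deriv (fps_deriv koebe_fps)"
    by (simp add: koebe_fps_ode numeral_fps_const)
  from koebe_gen_sum_fps_expansion[OF q insertI2[OF singletonI] this]
  have "(\<lambda>u. koebe_sum q (- exp u) + 6 * koebe2_sum q (- exp u)) has_fps_expansion
      (fps_deriv (fps_deriv koebe_fps) + Abs_fps (\<lambda>m. (1 + (-1) ^ m) * lambert_G (3 + m) q / fact m))"
    using koebe_gen_sum[of "- exp u" for u] by (simp only: neg_equal_0_iff_equal exp_not_eq_zero simp_thms)
  also have "Abs_fps (\<lambda>m. (1 + (-1) ^ m) * lambert_G (3 + m) q / fact m)
      = fps_deriv (fps_deriv (Abs_fps (\<lambda>m. (1 + (-1) ^ m) * lambert_G (1 + m) q / fact m)))"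
  proof (rule fps_ext)
    fix m
    have "(fact (m + 2) :: complex) = of_nat (m + 1) * (of_nat (m + 2) * fact m)"
      by (simp add: algebra_simps)
    thus "fps_nth (Abs_fps (\<lambda>m. (1 + (-1) ^ m) * lambert_G (3 + m) q / fact m)) m
      = fps_nth (fps_deriv (fps_deriv (Abs_fps (\<lambda>m. (1 + (-1) ^ m) * lambert_G (1 + m) q / fact m)))) m"
      by (simp add: add_ac numeral_3_eq_3 del: of_nat_Suc of_nat_add fact_Suc)
  qed
  finally show ?thesis unfolding koebe_sum_fps_def by simp
qed

text \<open>The second derivative is the sum of \<open>koebe\<close> plus 6 times
  \<open>koebe2_sum\<close>, and \<open>koebe_sum_square\<close> expresses the latter through the
  square of the former. The values of \<open>b\<close> and \<open>c\<close> result from this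
  elimination.\<close>

lemma koebe_sum_fps_ode:
  "\<exists>b c. fps_deriv (fps_deriv (koebe_sum_fps q)) = fps_const c + fps_const b * koebe_sum_fps q + 6 * koebe_sum_fps q ^ 2"
proof -
  let ?Y = "koebe_sum_fps q"
  define b where "b = 1 - 12 * koebe_sum q 1"
  define c where "c = - 6 * koebe'_sum q 1"
  have "(\<lambda>u. c + b * koebe_sum q (- exp u) + 6 * koebe_sum q (- exp u) ^ 2) has_fps_expansion
      fps_const c + fps_const b * ?Y + fps_const 6 * ?Y ^ 2"
    by (intro fps_expansion_intros koebe_sum_fps_expansion)
  also have "?this \<longleftrightarrow> (\<lambda>u. koebe_sum q (- exp u) + 6 * koebe2_sum q (- exp u)) has_fps_expansion
      fps_const c + fps_const b * ?Y + fps_const 6 * ?Y ^ 2"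
  proof (rule has_fps_expansion_cong)
    \<comment> \<open>Near u = 0 no point of the orbit equals 1: the three conditions handle
      positive n, negative n and n = 0.\<close>
    have "((\<lambda>u. norm (- exp u * q)) \<longlongrightarrow> norm (- exp 0 * q)) (nhds 0)"
         "((\<lambda>u. norm (- exp (- u) * q)) \<longlongrightarrow> norm (- exp (- 0) * q)) (nhds 0)"
         "((\<lambda>u. Re (exp u)) \<longlongrightarrow> Re (exp 0)) (nhds 0)"
      by (intro tendsto_intros filterlim_ident)+
    hence "eventually (\<lambda>u. norm (- exp u * q) < 1) (nhds 0)" "eventually (\<lambda>u. norm (- exp (- u) * q) < 1) (nhds 0)"
      "eventually (\<lambda>u. Re (exp u) > 0) (nhds 0)"
      by (auto elim!: order_tendstoD simp: q)
    thus "\<forall>\<^sub>F u in nhds 0. c + b * koebe_sum q (- exp u) + 6 * koebe_sum q (- exp u) ^ 2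
        = koebe_sum q (- exp u) + 6 * koebe2_sum q (- exp u)"
    proof eventually_elim
      case (elim u)
      have "- exp u * q powi n \<noteq> 1" for n
      proof -
        have ne1: "z \<noteq> 1" if "norm z < 1" for z :: complex using that by auto
        have pos: "norm (y * q ^ Suc k) < 1" if "norm (y * q) < 1" for y k
        proof -
          have "norm (y * q ^ Suc k) = norm (y * q) * norm q ^ k"
            by (simp add: norm_mult norm_power)
          also have "\<dots> \<le> norm (y * q) * 1"
            using q by (intro mult_left_mono power_le_one) auto
          finally show ?thesis using that by simp
        qed
        have "n = 0 \<or> n = int (Suc (nat n - 1)) \<or> n = - int (Suc (nat (- n) - 1))"
          by linarith
        then consider "n = 0" | k where "n = int (Suc k)" | k where "n = - int (Suc k)"
          by blast
        thus ?thesis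
        proof cases
          case 1
          have "exp u \<noteq> -1" using elim(3) by auto
          thus ?thesis using 1 by (simp add: minus_equation_iff)
        next
          case (2 k)
          have "- exp u * q ^ Suc k \<noteq> 1" by (rule ne1[OF pos[OF elim(1)]])
          thus ?thesis by (simp only: 2 power_int_of_nat simp_thms)
        next
          case (3 k)
          have "- exp u * q powi n = inverse (- exp (- u) * q ^ Suc k)"
            by (simp add: 3 power_int_minus exp_minus del: of_nat_Suc power_Suc)
          moreover have "- exp (- u) * q ^ Suc k \<noteq> 1"
            by (rule ne1[OF pos[OF elim(2)]])
          ultimately show ?thesis by (simp only: inverse_eq_1_iff simp_thms)
        qed
      qed
      hence "koebe_sum q (- exp u) ^ 2 = koebe2_sum q (- exp u) + 2 * koebe_sum q 1 * koebe_sum q (- exp u) + koebe'_sum q 1"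
        by (intro koebe_sum_square q) auto
      thus ?case by (simp add: b_def c_def algebra_simps)
    qed
  qed simp
  finally have "fps_const c + fps_const b * ?Y + fps_const 6 * ?Y ^ 2 = fps_deriv (fps_deriv ?Y)"
    using fps_expansion_unique_complex koebe_sum_fps_deriv2_expansion by blast
  hence "fps_deriv (fps_deriv ?Y) = fps_const c + fps_const b * ?Y + 6 * ?Y ^ 2"
    by (simp add: numeral_fps_const)
  thus ?thesis by blast
qed

text \<open>By \<open>koebe_alt_sum_square\<close> both sides are half the second derivative of the
  bilateral sum in u at u = 0, that is at x = -1.\<close>

lemma koebe_alt_sum_eq_fps_nth: "koebe_alt_sum q ^ 2 = fps_nth (koebe_sum_fps q) 2"
proof -
  have "fps_nth (fps_deriv (fps_deriv (koebe_sum_fps q))) 0 = koebe_sum q (-1) + 6 * koebe2_sum q (-1)"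
    using has_fps_expansion_imp_0_eq_fps_nth_0[OF koebe_sum_fps_deriv2_expansion] by simp
  hence "2 * fps_nth (koebe_sum_fps q) 2 = koebe_sum q (-1) + 6 * koebe2_sum q (-1)"
    by (simp add: numeral_2_eq_2)
  hence "2 * fps_nth (koebe_sum_fps q) 2 / 2 = (koebe_sum q (-1) + 6 * koebe2_sum q (-1)) / 2"
    by (rule arg_cong)
  thus ?thesis unfolding koebe_alt_sum_square[OF q] by (simp add: add_divide_distrib)
qed

end

subsection \<open>Squares of theta functions\<close>

lemma theta3_null_has_sum:
  assumes "norm q < 1"
  shows "((\<lambda>j::int. q powi (j\<^sup>2)) has_sum theta3_null q) UNIV"
proof -
  have "(\<lambda>n. q ^ n\<^sup>2) summable_on UNIV"
  proof (rule summable_on_comparison_complex)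
    show "(\<lambda>n. of_nat n ^ 0 * q ^ n) summable_on UNIV"
      by (rule summable_on_power_times_geometric[OF assms])
    show "norm (q ^ n\<^sup>2) \<le> norm (of_nat n ^ 0 * q ^ n)" for n
      using assms by (simp add: norm_power power_decreasing power2_eq_square)
  qed
  moreover have "q powi ((int n)\<^sup>2) = q ^ n\<^sup>2" "q powi ((- int n)\<^sup>2) = q ^ n\<^sup>2" for n
    by (simp_all flip: of_nat_power)
  ultimately have "(\<lambda>j::int. q powi (j\<^sup>2)) summable_on UNIV"
    by (intro summable_on_intI) (simp_all only:)
  thus ?thesis unfolding theta3_null_def by (rule has_sum_infsum)
qed

lemma theta3_null_mult_has_sum:
  assumes "norm a < 1" "norm b < 1"
  shows "((\<lambda>(x::int, y::int). a powi (x\<^sup>2) * b powi (y\<^sup>2)) has_sum (theta3_null a * theta3_null b)) UNIV"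
proof -
  have s: "(\<lambda>(x::int, y::int). a powi (x\<^sup>2) * b powi (y\<^sup>2)) summable_on UNIV \<times> UNIV"
    using theta3_null_has_sum[OF assms(1)] theta3_null_has_sum[OF assms(2)]
    by (intro summable_on_times) (auto simp: summable_on_def)
  then obtain S where S: "((\<lambda>(x::int, y::int). a powi (x\<^sup>2) * b powi (y\<^sup>2)) has_sum S) (UNIV \<times> UNIV)"
    by (auto simp: summable_on_def)
  have "((\<lambda>x::int. a powi (x\<^sup>2) * theta3_null b) has_sum S) UNIV"
    by (rule has_sum_SigmaD[OF S]) (unfold prod.case, intro has_sum_cmult_right theta3_null_has_sum assms)
  moreover have "((\<lambda>x::int. a powi (x\<^sup>2) * theta3_null b) has_sum (theta3_null a * theta3_null b)) UNIV"
    by (intro has_sum_cmult_left theta3_null_has_sum assms)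
  ultimately have "S = theta3_null a * theta3_null b"
    by (rule has_sum_unique)
  with S show ?thesis by simp
qed

lemma minus_powi_square: "(- z) powi (x\<^sup>2) = (if even x then 1 else - 1) * z powi (x\<^sup>2)" for z :: complex
  by (simp add: power_int_minus_left)

text \<open>The substitution parametrises the pairs of equal parity and turns x^2 + y^2 into 2 (u^2
  + v^2), the source of the argument q^2 in the theta identities.\<close>

lemma even_pairs_reindex:
  "((\<lambda>(u, v). f (u + v, u - v)) has_sum S) UNIV \<longleftrightarrow> (f has_sum S) {(x, y). even (x + y)}"
  for f :: "int \<times> int \<Rightarrow> complex"
proof -
  have "bij_betw (\<lambda>(u, v). (u + v, u - v)) UNIV {(x, y). even (x + y :: int)}"
    by (rule bij_betw_byWitness[where f' = "\<lambda>(x, y). ((x + y) div 2, (x - y) div 2)"]) (auto, presburger+)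
  from has_sum_reindex_bij_betw[OF this, of f S] show ?thesis
    by (simp add: case_prod_unfold)
qed

context
  fixes q :: complex
  assumes q: "q \<noteq> 0" "norm q < 1"
begin

lemma theta_pair_terms:
  "q powi ((u + v)\<^sup>2) * q powi ((u - v)\<^sup>2) = (q\<^sup>2) powi (u\<^sup>2) * (q\<^sup>2) powi (v\<^sup>2)"
proof -
  have e: "(q\<^sup>2) powi n = q powi (2 * n)" for n by (simp add: power_int_mult)
  have "q powi ((u + v)\<^sup>2) * q powi ((u - v)\<^sup>2) = q powi ((u + v)\<^sup>2 + (u - v)\<^sup>2)"
    using q by (subst power_int_add) auto
  also have "(u + v)\<^sup>2 + (u - v)\<^sup>2 = 2 * u\<^sup>2 + 2 * v\<^sup>2"
    by (simp add: power2_eq_square algebra_simps)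
  also have "q powi (2 * u\<^sup>2 + 2 * v\<^sup>2) = (q\<^sup>2) powi (u\<^sup>2) * (q\<^sup>2) powi (v\<^sup>2)"
    using q by (subst power_int_add) (auto simp: e)
  finally show ?thesis .
qed

text \<open>The terms of the two squares differ by the sign (-1)^(x + y), so only pairs with x + y
  even survive, doubled.\<close>

lemma theta3_null_square_sum:
  "theta3_null q ^ 2 + theta3_null (- q) ^ 2 = 2 * theta3_null (q\<^sup>2) ^ 2"
proof -
  define f where "f = (\<lambda>(x::int, y::int). q powi (x\<^sup>2) * q powi (y\<^sup>2))"
  have nq: "norm (- q) < 1" "norm (q\<^sup>2) < 1" using q by (auto simp: norm_power power_less_one_iff)
  have "((\<lambda>z. f z + (case z of (x, y) \<Rightarrow> (- q) powi (x\<^sup>2) * (- q) powi (y\<^sup>2))) has_sum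
      (theta3_null q * theta3_null q + theta3_null (-q) * theta3_null (-q))) UNIV"
    unfolding f_def by (intro has_sum_add theta3_null_mult_has_sum q nq)
  also have "(\<lambda>z. f z + (case z of (x, y) \<Rightarrow> (- q) powi (x\<^sup>2) * (- q) powi (y\<^sup>2)))
      = (\<lambda>z. if z \<in> {(x, y). even (x + y)} then 2 * f z else 0)"
    by (auto simp: f_def minus_powi_square fun_eq_iff)
  also have "((\<lambda>z. if z \<in> {(x, y). even (x + y)} then 2 * f z else 0) has_sum
      (theta3_null q * theta3_null q + theta3_null (-q) * theta3_null (-q))) UNIV \<longleftrightarrow>
      ((\<lambda>z. 2 * f z) has_sum (theta3_null q * theta3_null q + theta3_null (-q) * theta3_null (-q))) {(x, y). even (x + y)}"
    by (rule has_sum_cong_neutral) auto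
  finally have 1: "((\<lambda>z. 2 * f z) has_sum (theta3_null q * theta3_null q + theta3_null (-q) * theta3_null (-q))) {(x, y). even (x + y)}" .
  have "((\<lambda>z. 2 * (case z of (x, y) \<Rightarrow> (q\<^sup>2) powi (x\<^sup>2) * (q\<^sup>2) powi (y\<^sup>2))) has_sum (2 * (theta3_null (q\<^sup>2) * theta3_null (q\<^sup>2)))) UNIV"
    by (intro has_sum_cmult_right theta3_null_mult_has_sum nq)
  also have "(\<lambda>z. 2 * (case z of (x, y) \<Rightarrow> (q\<^sup>2) powi (x\<^sup>2) * (q\<^sup>2) powi (y\<^sup>2))) = (\<lambda>(u, v). 2 * f (u + v, u - v))"
    by (auto simp: f_def theta_pair_terms fun_eq_iff)
  finally have "((\<lambda>z. 2 * f z) has_sum (2 * (theta3_null (q\<^sup>2) * theta3_null (q\<^sup>2)))) {(x, y). even (x + y)}"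
    by (subst (asm) even_pairs_reindex[of "\<lambda>z. 2 * f z"])
  from has_sum_unique[OF 1 this] show ?thesis by (simp add: power2_eq_square)
qed

text \<open>The terms carry the sign (-1)^y. Exchanging x and y reverses it where x + y is odd, so
  that part sums to 0; elsewhere (-1)^(u - v) = (-1)^u (-1)^v turns q^2 into -(q^2).\<close>

lemma theta3_null_mult_minus:
  "theta3_null q * theta3_null (- q) = theta3_null (- (q\<^sup>2)) ^ 2"
proof -
  define f where "f = (\<lambda>(x::int, y::int). q powi (x\<^sup>2) * (- q) powi (y\<^sup>2))"
  have nq: "norm (- q) < 1" "norm (- (q\<^sup>2)) < 1" using q by (auto simp: norm_power power_less_one_iff)
  have H: "(f has_sum (theta3_null q * theta3_null (-q))) UNIV"
    unfolding f_def by (intro theta3_null_mult_has_sum q nq)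
  define E where "E = {(x::int, y::int). even (x + y)}"
  define Od where "Od = {(x::int, y::int). odd (x + y)}"
  have "f summable_on Od"
    by (rule summable_on_subset_banach[of _ UNIV]) (use H in \<open>auto simp: summable_on_def\<close>)
  then obtain T where T: "(f has_sum T) Od" by (auto simp: summable_on_def)
  have bij: "bij_betw (\<lambda>(x, y). (y, x)) Od Od"
    by (rule bij_betw_byWitness[where f' = "\<lambda>(x, y). (y, x)"]) (auto simp: Od_def)
  have "((\<lambda>z. f (case z of (x, y) \<Rightarrow> (y, x))) has_sum T) Od"
    using has_sum_reindex_bij_betw[OF bij, of f T] T by simp
  also have "?this \<longleftrightarrow> ((\<lambda>z. - f z) has_sum T) Od"
    by (intro has_sum_cong) (auto simp: f_def Od_def minus_powi_square)
  finally have "((\<lambda>z. - f z) has_sum T) Od" .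
  from has_sum_unique[OF this has_sum_uminusI[OF T]] have T0: "T = 0" by simp
  have "((\<lambda>(x::int, y::int). (- (q\<^sup>2)) powi (x\<^sup>2) * (- (q\<^sup>2)) powi (y\<^sup>2)) has_sum (theta3_null (- (q\<^sup>2)) * theta3_null (- (q\<^sup>2)))) UNIV"
    by (intro theta3_null_mult_has_sum nq)
  also have "(\<lambda>(x::int, y::int). (- (q\<^sup>2)) powi (x\<^sup>2) * (- (q\<^sup>2)) powi (y\<^sup>2)) = (\<lambda>(u, v). f (u + v, u - v))"
    unfolding f_def prod.case minus_powi_square
    by (intro ext) (auto simp: minus_powi_square theta_pair_terms[symmetric])
  finally have "(f has_sum (theta3_null (- (q\<^sup>2)) * theta3_null (- (q\<^sup>2)))) E"
    unfolding even_pairs_reindex[of f] E_def .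
  from has_sum_Un_disjoint[OF this T] have "(f has_sum (theta3_null (- (q\<^sup>2)) * theta3_null (- (q\<^sup>2)) + T)) (E \<union> Od)"
    by (auto simp: E_def Od_def)
  also have "E \<union> Od = UNIV" by (auto simp: E_def Od_def)
  finally show ?thesis using has_sum_unique[OF H] T0 by (simp add: power2_eq_square)
qed

end

section \<open>Uniqueness for the two functional equations\<close>

text \<open>Comparing the lowest order term \<open>q\<^sup>M\<close> of \<open>f - g\<close>, the linear relation excludes even \<open>M\<close> and the
  quadratic one excludes odd \<open>M\<close>.\<close>

lemma two_square_uniqueness:
  fixes f g F G :: "complex \<Rightarrow> complex"
  assumes hol: "F holomorphic_on ball 0 1" "G holomorphic_on ball 0 1"
    and F0: "F 0 = 1" "G 0 = 1"
    and f: "\<And>z. z \<noteq> 0 \<Longrightarrow> norm z < 1 \<Longrightarrow> f z = 1 + 4 * z * F z"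
    and g: "\<And>z. z \<noteq> 0 \<Longrightarrow> norm z < 1 \<Longrightarrow> g z = 1 + 4 * z * G z"
    and f1: "\<And>z. z \<noteq> 0 \<Longrightarrow> norm z < 1 \<Longrightarrow> f z + f (- z) = 2 * f (z\<^sup>2)"
    and g1: "\<And>z. z \<noteq> 0 \<Longrightarrow> norm z < 1 \<Longrightarrow> g z + g (- z) = 2 * g (z\<^sup>2)"
    and f2: "\<And>z. z \<noteq> 0 \<Longrightarrow> norm z < 1 \<Longrightarrow> f z * f (- z) = f (- (z\<^sup>2)) ^ 2"
    and g2: "\<And>z. z \<noteq> 0 \<Longrightarrow> norm z < 1 \<Longrightarrow> g z * g (- z) = g (- (z\<^sup>2)) ^ 2"
    and z: "z \<noteq> 0" "norm z < 1"
  shows "f z = g z"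
proof -
  have "(\<lambda>z. F z - G z) constant_on ball 0 1"
  proof (rule ccontr)
    assume nc: "\<not> (\<lambda>z. F z - G z) constant_on ball 0 1"
    \<comment> \<open>As F - G vanishes at 0 without being constant, its zero there has finite order
      m > 0, and the cofactor \<open>d\<close> has no zero on a small disc.\<close>
    obtain d r m where m: "0 < m" and r: "0 < r" "ball (0::complex) r \<subseteq> ball 0 1"
      and hd: "d holomorphic_on ball (0::complex) r"
      and eq: "\<And>w. w \<in> ball 0 r \<Longrightarrow> F w - G w = (w - 0) ^ m * d w"
      and d0: "\<And>w. w \<in> ball 0 r \<Longrightarrow> d w \<noteq> 0"
      by (rule holomorphic_factor_zero_nonconstant[OF holomorphic_on_diff[OF hol] open_ball connected_ball _ _ nc, of 0])
         (simp, simp add: F0, rule that)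
    define M where "M = Suc m"
    have fg: "f w = g w + 4 * w ^ M * d w" if "w \<noteq> 0" "norm w < r" for w
    proof -
      have "F w = G w + w ^ m * d w" using eq[of w] that by (simp add: algebra_simps)
      moreover have "norm w < 1" using r(2) that by (auto simp: subset_iff)
      ultimately show ?thesis using f[of w] g[of w] that(1) by (simp add: M_def algebra_simps)
    qed
    have dcont: "(d \<longlongrightarrow> d 0) (at 0)"
      using holomorphic_on_imp_continuous_on[OF hd] r(1)
      by (simp add: continuous_on_eq_continuous_at isCont_def)
    have FGcont: "(F \<longlongrightarrow> 1) (at 0)" "(G \<longlongrightarrow> 1) (at 0)"
      using holomorphic_on_imp_continuous_on[OF hol(1)] holomorphic_on_imp_continuous_on[OF hol(2)] F0
      by (auto simp: continuous_on_eq_continuous_at isCont_def dest!: bspec[of _ _ 0])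
    have lim_neg: "filterlim (\<lambda>w::complex. - w) (at 0) (at 0)"
      by (rule filterlim_atI) (auto intro!: tendsto_eq_intros simp: eventually_at_filter)
    have lim_sq: "filterlim (\<lambda>w::complex. w\<^sup>2) (at 0) (at 0)"
      by (rule filterlim_atI) (auto intro!: tendsto_eq_intros simp: eventually_at_filter)
    have lim_nsq: "filterlim (\<lambda>w::complex. - (w\<^sup>2)) (at 0) (at 0)"
      by (rule filterlim_atI) (auto intro!: tendsto_eq_intros simp: eventually_at_filter)
    note dl = dcont filterlim_compose[OF dcont lim_neg] filterlim_compose[OF dcont lim_sq] filterlim_compose[OF dcont lim_nsq]
    have ev: "eventually (\<lambda>w::complex. w \<noteq> 0 \<and> norm w < r \<and> norm w < 1 \<and> norm (w\<^sup>2) < r \<and> norm (w\<^sup>2) < 1) (at 0)"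
    proof -
      have "eventually (\<lambda>w::complex. w \<noteq> 0) (at 0)" by (simp add: eventually_at_filter)
      moreover have "((\<lambda>w::complex. norm w) \<longlongrightarrow> norm (0::complex)) (at 0)" "((\<lambda>w::complex. norm (w\<^sup>2)) \<longlongrightarrow> norm ((0::complex)\<^sup>2)) (at 0)"
        by (intro tendsto_intros)+
      hence "eventually (\<lambda>w::complex. norm w < r) (at 0)" "eventually (\<lambda>w::complex. norm w < 1) (at 0)"
          "eventually (\<lambda>w::complex. norm (w\<^sup>2) < r) (at 0)" "eventually (\<lambda>w::complex. norm (w\<^sup>2) < 1) (at 0)"
        using r(1) by (auto elim!: order_tendstoD)
      ultimately show ?thesis by eventually_elim auto
    qed
    have r1: "w ^ M * d w + (- w) ^ M * d (- w) = 2 * w ^ (2 * M) * d (w\<^sup>2)"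
      if "w \<noteq> 0" "norm w < r" "norm w < 1" "norm (w\<^sup>2) < r" for w
    proof -
      have "4 * (w ^ M * d w + (- w) ^ M * d (- w)) = (f w + f (- w)) - (g w + g (- w))"
        using fg[of w] fg[of "-w"] that by (simp add: algebra_simps)
      also have "\<dots> = 2 * f (w\<^sup>2) - 2 * g (w\<^sup>2)"
        using f1[OF that(1,3)] g1[OF that(1,3)] by simp
      also have "\<dots> = 4 * (2 * w ^ (2 * M) * d (w\<^sup>2))"
        using fg[of "w\<^sup>2"] that by (simp only: power_mult) (simp add: algebra_simps)
      finally have "4 * (w ^ M * d w + (- w) ^ M * d (- w)) = 4 * (2 * w ^ (2 * M) * d (w\<^sup>2))" .
      thus ?thesis by (rule mult_left_cancel[THEN iffD1, rotated]) simp
    qed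
    show False
    proof (cases "even M")
      case True
      \<comment> \<open>Divided by w^M, the linear relation tends to 2 d(0) = 0.\<close>
      have lim: "((\<lambda>w. d w + d (- w) - 2 * w ^ M * d (w\<^sup>2)) \<longlongrightarrow> d 0 + d 0 - 2 * 0 ^ M * d 0) (at 0)"
        by (rule tendsto_diff[OF tendsto_add[OF dl(1,2)]
              tendsto_mult[OF tendsto_mult[OF tendsto_const tendsto_power[OF tendsto_ident_at]] dl(3)]])
      have zero: "eventually (\<lambda>w. d w + d (- w) - 2 * w ^ M * d (w\<^sup>2) = 0) (at 0)"
        using ev
      proof eventually_elim
        case (elim w)
        have "w ^ M * d w + w ^ M * d (- w) = 2 * (w ^ M * w ^ M) * d (w\<^sup>2)"
          using r1[of w] elim True by (simp add: mult_2[of M] power_add)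
        hence "w ^ M * (d w + d (- w) - 2 * w ^ M * d (w\<^sup>2)) = 0"
          by (simp only: right_diff_distrib distrib_left) simp
        moreover have "w ^ M \<noteq> 0" using elim by simp
        ultimately show ?case by (simp only: mult_eq_0_iff simp_thms)
      qed
      have "d 0 + d 0 - 2 * 0 ^ M * d 0 = 0"
        by (rule tendsto_unique[OF at_neq_bot lim tendsto_eventually[OF zero]])
      thus False using d0[of 0] r(1) by (simp add: M_def)
    next
      case False
      \<comment> \<open>The quadratic relation divided by 4 w^M, with d(w) eliminated by the linear
        one, and divided once more by w, because f(-w) - g(w) = -4 w (F(-w) + G(w)). In the limit it
        reads -8 d(0) = 0; here the common normalisation 1 + 4 q + ... enters.\<close>
      let ?A = "\<lambda>w. - 4 * d (- w) * (F (- w) + G w) + 2 * w ^ m * d (w\<^sup>2) * f (- w) + w ^ m * d (- (w\<^sup>2)) * (f (- (w\<^sup>2)) + g (- (w\<^sup>2)))"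
      have fg_lim: "(f \<longlongrightarrow> 1) (at 0)" "(g \<longlongrightarrow> 1) (at 0)"
      proof -
        have e1: "eventually (\<lambda>w::complex. w \<noteq> 0 \<and> norm w < 1) (at 0)"
          using ev by eventually_elim auto
        have "((\<lambda>w. 1 + 4 * w * F w) \<longlongrightarrow> 1 + 4 * 0 * 1) (at 0)" "((\<lambda>w. 1 + 4 * w * G w) \<longlongrightarrow> 1 + 4 * 0 * 1) (at 0)"
          by (intro tendsto_intros FGcont)+
        moreover have "eventually (\<lambda>w. 1 + 4 * w * F w = f w) (at 0)" "eventually (\<lambda>w. 1 + 4 * w * G w = g w) (at 0)"
          using e1 by (eventually_elim, simp add: f g)+
        ultimately have "(f \<longlongrightarrow> 1 + 4 * 0 * 1) (at 0)" "(g \<longlongrightarrow> 1 + 4 * 0 * 1) (at 0)"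
          by (blast intro: Lim_transform_eventually)+
        thus "(f \<longlongrightarrow> 1) (at 0)" "(g \<longlongrightarrow> 1) (at 0)" by simp_all
      qed
      \<comment> \<open>Positions used below: 2, 3, 4 are the limits of d at -w, w^2, -(w^2); 6 is
        that of G; 9 and 10 are F and f at -w; 11 and 12 are f and g at -(w^2).\<close>
      note lims = dl FGcont fg_lim filterlim_compose[OF FGcont(1) lim_neg] filterlim_compose[OF fg_lim(1) lim_neg]
         filterlim_compose[OF fg_lim(1) lim_nsq] filterlim_compose[OF fg_lim(2) lim_nsq]
      have lim: "(?A \<longlongrightarrow> - 4 * d 0 * (1 + 1) + 2 * 0 ^ m * d 0 * 1 + 0 ^ m * d 0 * (1 + 1)) (at 0)"
        by (rule tendsto_add[OF tendsto_add[OF tendsto_mult[OF tendsto_mult[OF tendsto_const lims(2)] tendsto_add[OF lims(9,6)]]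
              tendsto_mult[OF tendsto_mult[OF tendsto_mult[OF tendsto_const tendsto_power[OF tendsto_ident_at]] lims(3)] lims(10)]]
              tendsto_mult[OF tendsto_mult[OF tendsto_power[OF tendsto_ident_at] lims(4)] tendsto_add[OF lims(11,12)]]])
      have zero: "eventually (\<lambda>w. ?A w = 0) (at 0)"
        using ev
      proof eventually_elim
        case (elim w)
        have M0: "w ^ M \<noteq> 0" using elim by simp
        have d1: "d w = d (- w) + 2 * w ^ M * d (w\<^sup>2)"
        proof -
          have "w ^ M * d w - w ^ M * d (- w) = 2 * (w ^ M * w ^ M) * d (w\<^sup>2)"
            using r1[of w] elim False by (simp add: mult_2[of M] power_add)
          hence "w ^ M * (d w - d (- w) - 2 * w ^ M * d (w\<^sup>2)) = 0"
            by (simp only: right_diff_distrib) simp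
          with M0 have "d w - d (- w) - 2 * w ^ M * d (w\<^sup>2) = 0"
            by (simp only: mult_eq_0_iff simp_thms)
          thus ?thesis by (simp add: algebra_simps)
        qed
        have e1: "f w = g w + 4 * w ^ M * d w" "f (- w) = g (- w) - 4 * w ^ M * d (- w)"
          using fg[of w] fg[of "- w"] elim False by auto
        have e2: "f (- (w\<^sup>2)) = g (- (w\<^sup>2)) - 4 * w ^ M * w ^ M * d (- (w\<^sup>2))"
          using fg[of "- (w\<^sup>2)"] elim False by (simp add: power_mult[symmetric] mult_2 power_add)
        have e3: "f (- w) - g w = - 4 * w * (F (- w) + G w)"
          using f[of "- w"] g[of w] elim by (simp add: algebra_simps)
        have "f w * f (- w) - g w * g (- w) = f (- (w\<^sup>2)) ^ 2 - g (- (w\<^sup>2)) ^ 2"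
          using f2[of w] g2[of w] elim by simp
        also have "\<dots> = (f (- (w\<^sup>2)) - g (- (w\<^sup>2))) * (f (- (w\<^sup>2)) + g (- (w\<^sup>2)))"
          by (simp add: power2_eq_square algebra_simps)
        also have "f (- (w\<^sup>2)) - g (- (w\<^sup>2)) = - 4 * w ^ M * w ^ M * d (- (w\<^sup>2))"
          using e2 by simp
        also have "f w * f (- w) - g w * g (- w) = 4 * w ^ M * (d w * f (- w) - g w * d (- w))"
        proof -
          have "g (- w) = f (- w) + 4 * w ^ M * d (- w)" using e1(2) by simp
          thus ?thesis by (simp only: e1(1)) (simp add: algebra_simps)
        qed
        finally have "4 * w ^ M * (d w * f (- w) - g w * d (- w) + w ^ M * d (- (w\<^sup>2)) * (f (- (w\<^sup>2)) + g (- (w\<^sup>2)))) = 0"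
          by (simp add: algebra_simps)
        hence "d w * f (- w) - g w * d (- w) + w ^ M * d (- (w\<^sup>2)) * (f (- (w\<^sup>2)) + g (- (w\<^sup>2))) = 0"
          using M0 by (simp only: mult_eq_0_iff simp_thms zero_neq_numeral[symmetric])
        hence "d (- w) * (f (- w) - g w) + 2 * w ^ M * d (w\<^sup>2) * f (- w) + w ^ M * d (- (w\<^sup>2)) * (f (- (w\<^sup>2)) + g (- (w\<^sup>2))) = 0"
          unfolding d1 by (simp add: algebra_simps)
        hence "w * ?A w = 0"
          unfolding e3 M_def by (simp add: algebra_simps)
        thus ?case using elim by simp
      qed
      have "- 4 * d 0 * (1 + 1) + 2 * 0 ^ m * d 0 * 1 + 0 ^ m * d 0 * (1 + 1) = 0"
        by (rule tendsto_unique[OF at_neq_bot lim tendsto_eventually[OF zero]])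
      thus False using d0[of 0] r(1) m by (simp add: zero_power)
    qed
  qed
  then obtain c where c: "\<And>w. w \<in> ball 0 1 \<Longrightarrow> F w - G w = c"
    by (auto simp: constant_on_def)
  from c[of 0] F0 have "c = 0" by simp
  with c[of z] z f[of z] g[of z] show ?thesis by simp
qed

subsection \<open>The two-square Lambert series\<close>

text \<open>With z = exp u this is 1 / (2 cosh u).\<close>

definition sq_kernel :: "complex \<Rightarrow> complex" where "sq_kernel z = z / (1 + z\<^sup>2)"

text \<open>Because (1 + z^2) - (1 + (z Q)^2) = z^2 (1 - Q^2), the product is a pure difference;
  unlike in \<open>koebe_mult\<close>, no multiple of the kernel itself remains.\<close>

lemma sq_kernel_mult:
  assumes "1 + z\<^sup>2 \<noteq> 0" "1 + (z * Q)\<^sup>2 \<noteq> 0" "Q\<^sup>2 \<noteq> 1"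
  shows "sq_kernel z * sq_kernel (z * Q) = Q / (1 - Q\<^sup>2) * (1 / (1 + (z * Q)\<^sup>2) - 1 / (1 + z\<^sup>2))"
proof -
  define A B C where "A = 1 + z\<^sup>2" and "B = 1 + (z * Q)\<^sup>2" and "C = 1 - Q\<^sup>2"
  have nz: "A \<noteq> 0" "B \<noteq> 0" "C \<noteq> 0" using assms by (auto simp: A_def B_def C_def)
  have e: "A - B = z\<^sup>2 * C" by (simp add: A_def B_def C_def power2_eq_square algebra_simps)
  have "Q / C * (1 / B - 1 / A) = Q * (A - B) / (A * B * C)"
    using nz by (simp add: field_simps)
  also have "\<dots> = z / A * (z * Q / B)"
    unfolding e using nz by (simp add: field_simps power2_eq_square)
  finally show ?thesis unfolding sq_kernel_def A_def B_def C_def ..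
qed

lemma sq_kernel_inverse: "z \<noteq> 0 \<Longrightarrow> sq_kernel (inverse z) = sq_kernel z"
proof -
  assume z: "z \<noteq> 0"
  have "1 + (inverse z)\<^sup>2 = (1 + z\<^sup>2) / z\<^sup>2" using z by (simp add: field_simps)
  thus ?thesis using z by (simp add: sq_kernel_def power2_eq_square)
qed

lemma sq_kernel_bigo: "sq_kernel \<in> O[at 0](\<lambda>z. z)" "(\<lambda>z. sq_kernel (inverse z)) \<in> O[at 0](\<lambda>z. z)"
proof -
  have "((\<lambda>z::complex. 1 / (1 + z\<^sup>2)) \<longlongrightarrow> 1) (at 0)" by (auto intro!: tendsto_eq_intros)
  thus "sq_kernel \<in> O[at 0](\<lambda>z. z)" "(\<lambda>z. sq_kernel (inverse z)) \<in> O[at 0](\<lambda>z. z)"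
    by (rule bigo_ident_at_0; simp add: sq_kernel_inverse; simp add: sq_kernel_def)+
qed

text \<open>The function 1 / (1 + z^2) tends to 1 at 0 and to 0 at infinity, hence this step
  function.\<close>

lemma kernel_telescope_summable:
  fixes p x :: complex
  assumes p: "p \<noteq> 0" "norm p < 1" and x: "x \<noteq> 0" and nz: "\<And>n. 1 + (x * p powi n)\<^sup>2 \<noteq> 0"
  shows "(\<lambda>n::int. 1 / (1 + (x * p powi n)\<^sup>2) - (if n \<ge> 0 then 1 else 0)) summable_on UNIV"
proof -
  have lim: "((\<lambda>z::complex. c * z / (1 + z\<^sup>2)) \<longlongrightarrow> 0) (at 0)" for c
    by (auto intro!: tendsto_eq_intros)
  define k where "k = (\<lambda>z::complex. z\<^sup>2 / (1 + z\<^sup>2))"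
  have k: "k \<in> O[at 0](\<lambda>z. z)"
    using lim[of 1] by (rule bigo_ident_at_0) (simp add: k_def power2_eq_square)
  have "inverse x \<noteq> 0" using x by simp
  note s = summable_on_geometric_orbit(2)[OF k x p] summable_on_geometric_orbit(2)[OF k this p]
  have pos: "1 / (1 + (x * p powi int n)\<^sup>2) - (if int n \<ge> 0 then 1 else 0) = - k (x * p ^ n)" for n
    using nz[of "int n"] by (simp add: k_def field_simps)
  have neg: "1 / (1 + (x * p powi (- int n))\<^sup>2) = k (inverse x * p ^ n)" for n
  proof -
    define z where "z = inverse x * p ^ n"
    have z: "z \<noteq> 0" using x p by (simp add: z_def)
    have e: "x * p powi (- int n) = inverse z"
      by (simp add: z_def power_int_minus)
    hence "1 + (inverse z)\<^sup>2 \<noteq> 0" using nz[of "- int n"] by simp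
    moreover have "1 + (inverse z)\<^sup>2 = (1 + z\<^sup>2) / z\<^sup>2" using z by (simp add: field_simps)
    ultimately show ?thesis
      unfolding e z_def[symmetric] k_def using z by simp
  qed
  show ?thesis
  proof (rule summable_on_intI)
    show "(\<lambda>n. 1 / (1 + (x * p powi int n)\<^sup>2) - (if int n \<ge> 0 then 1 else 0)) summable_on UNIV"
      unfolding pos by (rule summable_on_uminus[THEN iffD2, OF s(1)])
    \<comment> \<open>The reflected half contains the index 0, where the step function is 1 and not
      0; hence the correction -1.\<close>
    have "((\<lambda>n. k (inverse x * p ^ n) + (if n = 0 then - 1 else 0)) has_sum (infsum (\<lambda>n. k (inverse x * p ^ n)) UNIV + - 1)) UNIV"
    proof (intro has_sum_add has_sum_infsum s)
      show "((\<lambda>n::nat. if n = 0 then - 1 else 0 :: complex) has_sum - 1) UNIV"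
        by (rule has_sum_finite_neutralI[of "{0}"]) auto
    qed
    also have "(\<lambda>n. k (inverse x * p ^ n) + (if n = 0 then - 1 else 0))
        = (\<lambda>n. 1 / (1 + (x * p powi (- int n))\<^sup>2) - (if - int n \<ge> 0 then 1 else 0))"
      unfolding neg by (auto simp: fun_eq_iff)
    finally show "(\<lambda>n. 1 / (1 + (x * p powi (- int n))\<^sup>2) - (if - int n \<ge> 0 then 1 else 0)) summable_on UNIV"
      unfolding summable_on_def by blast
  qed
qed

text \<open>Telescoping against a step of height 1 gives e. The value is independent of x, which
  makes even and odd indices cancel in \<open>two_square_sum_mult_minus\<close>.\<close>

lemma sq_kernel_orbit_has_sum:
  assumes p: "p \<noteq> 0" "norm p < 1" and x: "x \<noteq> 0" and nz: "\<And>n. 1 + (x * p powi n)\<^sup>2 \<noteq> 0" and e: "e \<noteq> 0"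
  shows "((\<lambda>n. sq_kernel (x * p powi n) * sq_kernel (x * p powi (n + e))) has_sum
     (p powi e / (1 - (p powi e)\<^sup>2) * of_int e)) UNIV"
proof -
  have "norm (p powi (e * 2)) \<noteq> 1"
    using norm_power_int_eq_1_iff[OF p, of "e * 2"] e by simp
  moreover have "p powi (e * 2) = (p powi e)\<^sup>2" by (simp add: power_int_mult)
  ultimately have Q: "(p powi e)\<^sup>2 \<noteq> 1" by auto
  have sh: "x * p powi (n + e) = x * p powi n * p powi e" for n
    using p by (simp add: power_int_add)
  note S = has_sum_infsum[OF kernel_telescope_summable[OF p x nz]]
  have "((\<lambda>n. 1 / (1 + (x * p powi (n + e))\<^sup>2) - 1 / (1 + (x * p powi n)\<^sup>2)) has_sum of_int e) UNIV"
    using has_sum_telescope_int[OF S S, of e] by simp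
  hence "((\<lambda>n. p powi e / (1 - (p powi e)\<^sup>2) * (1 / (1 + (x * p powi (n + e))\<^sup>2) - 1 / (1 + (x * p powi n)\<^sup>2)))
      has_sum (p powi e / (1 - (p powi e)\<^sup>2) * of_int e)) UNIV"
    by (rule has_sum_cmult_right)
  also have "(\<lambda>n. p powi e / (1 - (p powi e)\<^sup>2) * (1 / (1 + (x * p powi (n + e))\<^sup>2) - 1 / (1 + (x * p powi n)\<^sup>2)))
     = (\<lambda>n. sq_kernel (x * p powi n) * sq_kernel (x * p powi (n + e)))"
    using sq_kernel_mult[OF nz _ Q] nz[of "n + e" for n] unfolding sh by (simp add: fun_eq_iff)
  finally show ?thesis .
qed

definition two_square_sum :: "complex \<Rightarrow> complex" where
  "two_square_sum q = 2 * (\<Sum>\<^sub>\<infinity>n::int. sq_kernel (q powi n))"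

lemma has_sum_Suc_iff:
  fixes h :: "nat \<Rightarrow> complex"
  assumes "h 0 = 0"
  shows "((\<lambda>n. h (Suc n)) has_sum S) UNIV \<longleftrightarrow> (h has_sum S) UNIV"
proof -
  have "bij_betw Suc UNIV {0<..}"
    by (rule bij_betw_byWitness[where f' = "\<lambda>n. n - 1"]) auto
  from has_sum_reindex_bij_betw[OF this, of h S]
  have "((\<lambda>n. h (Suc n)) has_sum S) UNIV \<longleftrightarrow> (h has_sum S) {0<..}" .
  also have "\<dots> \<longleftrightarrow> (h has_sum S) UNIV"
    by (rule has_sum_cong_neutral) (use assms in auto)
  finally show ?thesis .
qed

lemma has_sum_int_reflect:
  fixes f :: "int \<Rightarrow> complex"
  assumes "((\<lambda>n. f (int n)) has_sum A) UNIV" "((\<lambda>n. f (- 1 - int n)) has_sum B) UNIV"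
  shows "(f has_sum (A + B)) UNIV"
proof -
  have bij: "bij_betw int UNIV {0..}" "bij_betw (\<lambda>n. - 1 - int n) UNIV {..<0}"
    by (rule bij_betw_byWitness[where f' = nat]; auto)
       (rule bij_betw_byWitness[where f' = "\<lambda>n. nat (- n - 1)"]; auto)
  have "(f has_sum A) {0..}" "(f has_sum B) {..<0}"
    using assms has_sum_reindex_bij_betw[OF bij(1), of f A] has_sum_reindex_bij_betw[OF bij(2), of f B] by auto
  hence "(f has_sum (A + B)) ({0..} \<union> {..<0})"
    by (intro has_sum_Un_disjoint) auto
  also have "{0..} \<union> {..<0} = (UNIV :: int set)" by auto
  finally show ?thesis .
qed

context
  fixes q :: complex
  assumes q: "q \<noteq> 0" "norm q < 1"
begin

lemma one_plus_square_nonzero: "1 + (1 * q powi n)\<^sup>2 \<noteq> 0" "1 + (1 * (q\<^sup>2) powi n)\<^sup>2 \<noteq> 0" "1 + (q * (q\<^sup>2) powi n)\<^sup>2 \<noteq> 0"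
proof -
  have *: "1 + (q powi m)\<^sup>2 \<noteq> 0" for m
  proof
    assume "1 + (q powi m)\<^sup>2 = 0"
    hence e: "(q powi m)\<^sup>2 = - 1" by (simp add: add_eq_0_iff)
    have "norm (q powi m) ^ 2 = norm ((q powi m)\<^sup>2)" by (simp add: norm_power)
    also have "\<dots> = 1" unfolding e by simp
    finally have "norm (q powi m) ^ 2 = 1" .
    hence "norm (q powi m) = 1"
      by (intro power2_eq_imp_eq[of "norm (q powi m)" 1]) (simp_all only: one_power2 norm_ge_zero zero_le_one)
    hence "m = 0" using norm_power_int_eq_1_iff[OF q] by blast
    with e show False by simp
  qed
  have e: "(q\<^sup>2) powi n = q powi (2 * n)" by (simp add: power_int_mult)
  have "q * (q\<^sup>2) powi n = q powi (2 * n + 1)" using q by (simp add: e power_int_add)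
  thus "1 + (1 * q powi n)\<^sup>2 \<noteq> 0" "1 + (1 * (q\<^sup>2) powi n)\<^sup>2 \<noteq> 0" "1 + (q * (q\<^sup>2) powi n)\<^sup>2 \<noteq> 0"
    using *[of n] *[of "2 * n"] *[of "2 * n + 1"] e by simp_all
qed

lemma sq_kernel_summable: "(\<lambda>n::int. sq_kernel (q powi n)) summable_on UNIV"
  using summable_on_geometric_orbit_int(2)[OF sq_kernel_bigo _ q, of 1] by simp

lemma sq_kernel_has_sum: "((\<lambda>n::int. sq_kernel (q powi n)) has_sum (two_square_sum q / 2)) UNIV"
  using has_sum_infsum[OF sq_kernel_summable] by (simp add: two_square_sum_def)

end

lemma sq_kernel_minus: "sq_kernel ((- q) powi n) = (if even n then 1 else - 1) * sq_kernel (q powi n)"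
  by (simp add: sq_kernel_def power_int_minus_left)

text \<open>The index 0 contributes 2 (1/2) = 1, and n and -n contribute equally.\<close>

lemma two_square_sum_nat:
  assumes q: "q \<noteq> 0" "norm q < 1"
  shows "two_square_sum q = 1 + 4 * q * (\<Sum>n. q ^ n / (1 + q ^ (2 * n + 2)))"
proof -
  define h where "h = (\<lambda>n. q ^ n / (1 + q ^ (2 * n + 2)))"
  have sk: "sq_kernel (q powi int (Suc n)) = q * h n" for n
    by (simp add: sq_kernel_def h_def power_int_of_nat del: of_nat_Suc) (simp add: power2_eq_square power_add mult_2)
  have "inj (\<lambda>n. int (Suc n))" by (simp add: inj_def)
  hence "(\<lambda>n. sq_kernel (q powi int (Suc n))) summable_on UNIV"
    using summable_on_reindex[of "\<lambda>n. int (Suc n)" UNIV "\<lambda>n. sq_kernel (q powi n)"]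
      summable_on_subset_banach[OF sq_kernel_summable[OF q], of "range (\<lambda>n. int (Suc n))"]
    by (simp add: o_def)
  then obtain S where S: "((\<lambda>n. sq_kernel (q powi int (Suc n))) has_sum S) UNIV"
    by (auto simp: summable_on_def)
  have "(\<lambda>n. q * h n) sums S"
    using has_sum_imp_sums[OF S] unfolding sk .
  hence "(\<lambda>n. inverse q * (q * h n)) sums (inverse q * S)"
    by (rule sums_mult)
  hence hs: "suminf h = inverse q * S"
    using q by (simp add: sums_iff mult.assoc[symmetric])
  have "sq_kernel (q powi (- int (Suc n))) = sq_kernel (q powi int (Suc n))" for n
    unfolding power_int_minus using q by (intro sq_kernel_inverse) simp
  hence "((\<lambda>n. sq_kernel (q powi (- int (Suc n)))) has_sum S) UNIV"
    using S by simp
  from has_sum_unique[OF sq_kernel_has_sum[OF q] has_sum_int_split[OF S this]]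
  have "two_square_sum q = 1 + 4 * S"
    by (simp add: sq_kernel_def field_simps)
  thus ?thesis using hs q unfolding h_def by simp
qed

lemma two_square_sum_add:
  assumes q: "q \<noteq> 0" "norm q < 1"
  shows "two_square_sum q + two_square_sum (- q) = 2 * two_square_sum (q\<^sup>2)"
proof -
  have nq: "- q \<noteq> 0" "norm (- q) < 1" "q\<^sup>2 \<noteq> 0" "norm (q\<^sup>2) < 1" using q by (auto simp: norm_power power_less_one_iff)
  have e: "(q\<^sup>2) powi n = q powi (2 * n)" for n by (simp add: power_int_mult)
  let ?f = "\<lambda>n. sq_kernel (q powi n) + sq_kernel ((- q) powi n)"
  have f: "?f n = (if even n then 2 * sq_kernel (q powi n) else 0)" for n
    by (simp add: sq_kernel_minus)
  have "(?f has_sum (two_square_sum q / 2 + two_square_sum (- q) / 2)) UNIV"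
    by (intro has_sum_add sq_kernel_has_sum q nq)
  moreover have "(?f has_sum (2 * (two_square_sum (q\<^sup>2) / 2) + 0)) UNIV"
  proof (rule has_sum_int_even_odd)
    have "((\<lambda>n. 2 * sq_kernel ((q\<^sup>2) powi n)) has_sum (2 * (two_square_sum (q\<^sup>2) / 2))) UNIV"
      by (intro has_sum_cmult_right sq_kernel_has_sum nq)
    thus "((\<lambda>n. ?f (2 * n)) has_sum (2 * (two_square_sum (q\<^sup>2) / 2))) UNIV"
      unfolding f e by simp
    show "((\<lambda>n. ?f (2 * n + 1)) has_sum 0) UNIV"
      unfolding f by simp
  qed
  ultimately have "two_square_sum q / 2 + two_square_sum (- q) / 2 = 2 * (two_square_sum (q\<^sup>2) / 2) + 0"
    by (rule has_sum_unique)
  thus ?thesis by (simp add: field_simps)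
qed

text \<open>In the convolution only d = 0 survives, where squaring the kernel gives the terms of
  \<open>koebe_alt_sum\<close>. For odd d the involution n -> - d - n reverses the sign; for even d
  \<noteq> 0 the even and the odd n have opposite sums.\<close>

lemma two_square_sum_mult_minus:
  assumes q: "q \<noteq> 0" "norm q < 1"
  shows "two_square_sum q * two_square_sum (- q) = 4 * koebe_alt_sum (q\<^sup>2)"
proof -
  have nq: "- q \<noteq> 0" "norm (- q) < 1" "q\<^sup>2 \<noteq> 0" "norm (q\<^sup>2) < 1" using q by (auto simp: norm_power power_less_one_iff)
  have e: "(q\<^sup>2) powi n = q powi (2 * n)" for n by (simp add: power_int_mult)
  define f where "f = (\<lambda>n. sq_kernel (q powi n))"
  define g where "g = (\<lambda>n. sq_kernel ((- q) powi n))"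
  have g: "g n = (if even n then 1 else - 1) * f n" for n
    by (simp add: f_def g_def sq_kernel_minus)
  have fs: "f summable_on UNIV" "g summable_on UNIV"
    unfolding f_def g_def by (intro sq_kernel_summable q nq)+
  note conv = has_sum_int_convolution[OF fs]
  have "(\<Sum>\<^sub>\<infinity>n. f n * g (n + d)) = (if d = 0 then koebe_alt_sum (q\<^sup>2) else 0)" for d
  proof -
    consider "d = 0" | "odd d" | "even d" "d \<noteq> 0" by blast
    thus ?thesis
    proof cases
      case 1
      have "f n * g n = (-1) powi n * (q\<^sup>2) powi n / (1 + (q\<^sup>2) powi n) ^ 2" for n
      proof -
        have "(-1 :: complex) powi n = (if even n then 1 else - 1)" by (simp add: power_int_minus_left)
        moreover have "(q\<^sup>2) powi n = (q powi n)\<^sup>2"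
          unfolding e by (subst mult.commute) (simp add: power_int_mult)
        ultimately show ?thesis
          unfolding g f_def sq_kernel_def by (simp add: power2_eq_square)
      qed
      thus ?thesis using 1 by (simp add: koebe_alt_sum_def)
    next
      case 2
      obtain S where S: "((\<lambda>n. f n * g (n + d)) has_sum S) UNIV"
        using conv(2)[of d] by (auto simp: summable_on_def)
      have bij: "bij_betw (\<lambda>n. - d - n) UNIV UNIV"
        by (rule bij_betw_byWitness[where f' = "\<lambda>n. - d - n"]) auto
      have fm: "f (- n) = f n" for n
        using q by (simp add: f_def power_int_minus sq_kernel_inverse)
      have "((\<lambda>n. f (- d - n) * g (- d - n + d)) has_sum S) UNIV"
        using has_sum_reindex_bij_betw[OF bij, of "\<lambda>n. f n * g (n + d)" S] S by simp
      also have "(\<lambda>n. f (- d - n) * g (- d - n + d)) = (\<lambda>n. - (f n * g (n + d)))"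
      proof
        fix n
        have "f (- d - n) = f (n + d)" using fm[of "n + d"] by (simp add: algebra_simps)
        thus "f (- d - n) * g (- d - n + d) = - (f n * g (n + d))"
          using 2 fm[of n] by (simp add: g)
      qed
      finally have "((\<lambda>n. - (f n * g (n + d))) has_sum S) UNIV" .
      from has_sum_unique[OF this has_sum_uminusI[OF S]] have "S = 0" by simp
      with infsumI[OF S] 2 show ?thesis by auto
    next
      case 3
      then obtain k where k: "d = 2 * k" "k \<noteq> 0" by auto
      have T: "((\<lambda>n. sq_kernel (x * (q\<^sup>2) powi n) * sq_kernel (x * (q\<^sup>2) powi (n + k))) has_sum
        ((q\<^sup>2) powi k / (1 - ((q\<^sup>2) powi k)\<^sup>2) * of_int k)) UNIV" if "x = 1 \<or> x = q" for x
        using that one_plus_square_nonzero[OF q] q by (intro sq_kernel_orbit_has_sum nq k) auto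
      let ?C = "(q\<^sup>2) powi k / (1 - ((q\<^sup>2) powi k)\<^sup>2) * of_int k"
      have "((\<lambda>n. f n * g (n + d)) has_sum (?C + - ?C)) UNIV"
      proof (rule has_sum_int_even_odd)
        have "f (2 * n) * g (2 * n + d) = sq_kernel (1 * (q\<^sup>2) powi n) * sq_kernel (1 * (q\<^sup>2) powi (n + k))" for n
          unfolding g e by (simp add: f_def k distrib_left)
        thus "((\<lambda>n. f (2 * n) * g (2 * n + d)) has_sum ?C) UNIV" using T[of 1] by simp
        have "f (2 * n + 1) * g (2 * n + 1 + d) = - (sq_kernel (q * (q\<^sup>2) powi n) * sq_kernel (q * (q\<^sup>2) powi (n + k)))" for n
        proof -
          have fo: "f (2 * m + 1) = sq_kernel (q * (q\<^sup>2) powi m)" for m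
            using q by (simp add: f_def e power_int_add mult.commute)
          have i: "2 * n + 1 + d = 2 * (n + k) + 1" using k by simp
          have "g (2 * n + 1 + d) = - f (2 * n + 1 + d)" using k by (simp add: g)
          thus ?thesis unfolding i fo by simp
        qed
        thus "((\<lambda>n. f (2 * n + 1) * g (2 * n + 1 + d)) has_sum - ?C) UNIV"
          using has_sum_uminusI[OF T[of q]] by simp
      qed
      from infsumI[OF this] show ?thesis using 3 by simp
    qed
  qed
  with conv(1) have "((\<lambda>d::int. if d = 0 then koebe_alt_sum (q\<^sup>2) else 0) has_sum (infsum f UNIV * infsum g UNIV)) UNIV"
    by simp
  moreover have "((\<lambda>d::int. if d = 0 then koebe_alt_sum (q\<^sup>2) else 0) has_sum koebe_alt_sum (q\<^sup>2)) UNIV"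
    by (rule has_sum_finite_neutralI[of "{0}"]) auto
  ultimately have "infsum f UNIV * infsum g UNIV = koebe_alt_sum (q\<^sup>2)"
    by (rule has_sum_unique)
  thus ?thesis unfolding two_square_sum_def f_def g_def by simp
qed

text \<open>The diagonal of the convolution is the even part of the alternating sum. The terms
  \<open>H d\<close> off the diagonal form twice the Lambert series \<open>L\<close>, and by
  interchange of summation \<open>L\<close> is also the sum over the positive odd indices; the
  negative odd ones give the second copy.\<close>

lemma two_square_sum_minus_square:
  assumes q: "q \<noteq> 0" "norm q < 1"
  shows "two_square_sum (- q) ^ 2 = 4 * koebe_alt_sum q"
proof -
  have nq: "- q \<noteq> 0" "norm (- q) < 1" "q\<^sup>2 \<noteq> 0" "norm (q\<^sup>2) < 1" using q by (auto simp: norm_power power_less_one_iff)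
  have e: "(q\<^sup>2) powi n = q powi (2 * n)" for n by (simp add: power_int_mult)
  define f where "f = (\<lambda>n. sq_kernel ((- q) powi n))"
  have fs: "f summable_on UNIV" unfolding f_def by (intro sq_kernel_summable nq)
  define S2 where "S2 = (\<Sum>\<^sub>\<infinity>n. f n * f n)"
  define H where "H = (\<lambda>d::int. (- q) powi d / (1 - ((- q) powi d)\<^sup>2) * of_int d)"
  \<comment> \<open>The values -q^(2n+1) with n \<ge> 0 are y (q^2)^(n+1) for y = -1/q. Although |y|
    > 1, the product y q^2 = -q has norm below 1, so the Lambert lemmas apply with base q^2.\<close>
  define L where "L = (\<lambda>r::nat. of_nat r ^ 1 * (- inverse q) ^ r * ((q\<^sup>2) ^ r / (1 - (q\<^sup>2) ^ r)))"
  have y0: "- inverse q * q\<^sup>2 = - q" using q by (simp add: power2_eq_square field_simps)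
  have y: "norm (- inverse q * q\<^sup>2) < 1" unfolding y0 using q by simp
  have ls: "(L has_sum infsum L UNIV) UNIV"
    using lambert_coeff_has_sum[OF nq(3,4) y, of 1] unfolding L_def by (intro has_sum_infsum) (auto simp: summable_on_def)
  have HL: "H (int n) = L n" "H (- int n) = L n" for n
  proof -
    have "(- inverse q) ^ n * (q\<^sup>2) ^ n = (- q) ^ n"
      by (simp only: power_mult_distrib[symmetric] y0)
    moreover have "((- q) ^ n)\<^sup>2 = (q\<^sup>2) ^ n"
      by (simp add: power_mult[symmetric] mult.commute)
    ultimately show L: "H (int n) = L n" by (simp add: H_def L_def mult_ac)
    define z where "z = (- q) ^ n"
    have z: "z \<noteq> 0" using q by (simp add: z_def)
    have "inverse z / (1 - (inverse z)\<^sup>2) = - (z / (1 - z\<^sup>2))"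
    proof (cases "z\<^sup>2 = 1")
      case False
      hence "1 - z\<^sup>2 \<noteq> 0" by simp
      have "1 - (inverse z)\<^sup>2 = - (1 - z\<^sup>2) / z\<^sup>2" using z by (simp add: field_simps)
      thus ?thesis using z \<open>1 - z\<^sup>2 \<noteq> 0\<close> by (simp add: field_simps power2_eq_square)
    next
      \<comment> \<open>This occurs only for n = 0; both quotients are then 0 by division by
        0.\<close>
      case True
      hence "(inverse z)\<^sup>2 = 1" by (simp add: power_inverse)
      with True show ?thesis by simp
    qed
    note * = this
    have "H (- int n) = inverse z / (1 - (inverse z)\<^sup>2) * (- of_nat n)"
      by (simp only: H_def z_def power_int_minus power_int_of_nat of_int_minus of_int_of_nat_eq)
    also have "\<dots> = z / (1 - z\<^sup>2) * of_nat n" unfolding * by simp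
    also have "\<dots> = H (int n)"
      by (simp only: H_def z_def power_int_of_nat of_int_of_nat_eq)
    finally have "H (- int n) = H (int n)" .
    with L show "H (- int n) = L n" by simp
  qed
  have L0: "L 0 = 0" by (simp add: L_def)
  have ls': "((\<lambda>n. L (Suc n)) has_sum infsum L UNIV) UNIV"
    using ls has_sum_Suc_iff[of L, OF L0] by simp
  have "(H has_sum (H 0 + infsum L UNIV + infsum L UNIV)) UNIV"
    by (rule has_sum_int_split) (simp_all only: HL ls')
  hence Hs: "(H has_sum (2 * infsum L UNIV)) UNIV" by (simp add: H_def)
  have "(\<Sum>\<^sub>\<infinity>n. f n * f (n + d)) = (if d = 0 then S2 else 0) + H d" for d
  proof (cases "d = 0")
    case False
    from sq_kernel_orbit_has_sum[OF nq(1,2) _ one_plus_square_nonzero(1)[OF nq(1,2)] False]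
    have "((\<lambda>n. f n * f (n + d)) has_sum H d) UNIV" by (simp add: f_def H_def)
    from infsumI[OF this] False show ?thesis by simp
  qed (simp add: S2_def H_def)
  with has_sum_int_convolution(1)[OF fs fs]
  have "((\<lambda>d::int. (if d = 0 then S2 else 0) + H d) has_sum (infsum f UNIV * infsum f UNIV)) UNIV" by simp
  moreover have "((\<lambda>d::int. (if d = 0 then S2 else 0) + H d) has_sum (S2 + 2 * infsum L UNIV)) UNIV"
  proof (intro has_sum_add Hs)
    show "((\<lambda>d::int. if d = 0 then S2 else 0) has_sum S2) UNIV"
      by (rule has_sum_finite_neutralI[of "{0}"]) auto
  qed
  ultimately have sq: "infsum f UNIV * infsum f UNIV = S2 + 2 * infsum L UNIV"
    by (rule has_sum_unique)
  have "((\<lambda>n::int. (-1) powi n * q powi n / (1 + q powi n) ^ 2) has_sum (S2 + (infsum L UNIV + infsum L UNIV))) UNIV"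
  proof (rule has_sum_int_even_odd)
    have "((\<lambda>n. f n * f n) has_sum S2) UNIV"
      using has_sum_int_convolution(2)[OF fs fs, of 0] unfolding S2_def by (intro has_sum_infsum) simp
    also have "(\<lambda>n. f n * f n) = (\<lambda>n. (-1) powi (2 * n) * q powi (2 * n) / (1 + q powi (2 * n)) ^ 2)"
    proof
      fix n
      have "(-1 :: complex) powi (2 * n) = 1" by (simp add: power_int_minus_left)
      moreover have "q powi (2 * n) = ((- q) powi n)\<^sup>2"
        by (subst mult.commute) (simp add: power_int_minus_left power_int_mult)
      ultimately show "f n * f n = (-1) powi (2 * n) * q powi (2 * n) / (1 + q powi (2 * n)) ^ 2"
        unfolding f_def sq_kernel_def by (simp add: power2_eq_square)
    qed
    finally show "((\<lambda>n. (-1) powi (2 * n) * q powi (2 * n) / (1 + q powi (2 * n)) ^ 2) has_sum S2) UNIV" .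
    have o: "(-1) powi (2 * n + 1) * q powi (2 * n + 1) / (1 + q powi (2 * n + 1)) ^ 2 = koebe (- (q powi (2 * n + 1)))" for n
    proof -
      have "(-1 :: complex) powi (2 * n + 1) = -1" by (simp add: power_int_minus_left)
      thus ?thesis by (simp only: koebe_def) simp
    qed
    have "((\<lambda>n. koebe (- inverse q * (q\<^sup>2) ^ Suc n)) has_sum infsum L UNIV) UNIV"
      using koebe_gen_orbit_has_sum[OF nq(3,4) y, of 1] by (simp only: koebe_gen_def L_def) simp
    moreover have c: "- inverse q * (q\<^sup>2) ^ Suc n = - (q powi (2 * int n + 1))" for n
    proof -
      have "q powi (2 * int n + 1) = q ^ (2 * n + 1)"
      proof -
        have "2 * int n + 1 = int (2 * n + 1)" by simp
        thus ?thesis by (simp only: power_int_of_nat)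
      qed
      moreover have "(q\<^sup>2) ^ Suc n = q * q ^ (2 * n + 1)"
        by (simp only: power_mult[symmetric]) simp
      ultimately show ?thesis using q by simp
    qed
    ultimately have K: "((\<lambda>n. koebe (- (q powi (2 * int n + 1)))) has_sum infsum L UNIV) UNIV" by simp
    show "((\<lambda>n. (-1) powi (2 * n + 1) * q powi (2 * n + 1) / (1 + q powi (2 * n + 1)) ^ 2) has_sum (infsum L UNIV + infsum L UNIV)) UNIV"
      unfolding o
    proof (rule has_sum_int_reflect[OF K])
      have "koebe (- (q powi (2 * (- 1 - int n) + 1))) = koebe (- (q powi (2 * int n + 1)))" for n
      proof -
        have "2 * (- 1 - int n) + 1 = - (2 * int n + 1)" by simp
        hence "- (q powi (2 * (- 1 - int n) + 1)) = inverse (- (q powi (2 * int n + 1)))"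
          by (simp only: power_int_minus inverse_minus_eq)
        thus ?thesis using koebe_inverse[of "- (q powi (2 * int n + 1))"] q by simp
      qed
      with K show "((\<lambda>n. koebe (- (q powi (2 * (- 1 - int n) + 1)))) has_sum infsum L UNIV) UNIV" by simp
    qed
  qed
  hence "koebe_alt_sum q = S2 + (infsum L UNIV + infsum L UNIV)"
    unfolding koebe_alt_sum_def by (rule infsumI)
  with sq show ?thesis unfolding two_square_sum_def f_def by (simp add: power2_eq_square)
qed

section \<open>The two-square identity\<close>

lemma holomorphic_suminf:
  fixes f :: "nat \<Rightarrow> complex \<Rightarrow> complex"
  assumes hol: "\<And>n. f n holomorphic_on ball 0 1"
    and bound: "\<And>r n z. 0 < r \<Longrightarrow> r < 1 \<Longrightarrow> norm z \<le> r \<Longrightarrow> norm (f n z) \<le> C r * r ^ n"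
  shows "(\<lambda>z. \<Sum>n. f n z) holomorphic_on ball 0 1"
proof (rule holomorphic_uniform_sequence[where f = "\<lambda>n z. \<Sum>i<n. f i z"])
  show "(\<lambda>z. \<Sum>i<n. f i z) holomorphic_on ball 0 1" for n
    by (intro holomorphic_intros hol)
  fix x :: complex assume x: "x \<in> ball 0 1"
  define r where "r = (1 + norm x) / 2"
  have r: "0 < r" "r < 1" "norm x < r"
    using x by (auto simp: r_def add_pos_nonneg)
  have sub: "norm z \<le> r" if "z \<in> cball x (r - norm x)" for z
    using norm_triangle_ineq4[of x "x - z"] that by (simp add: dist_norm)
  have "uniform_limit (cball x (r - norm x)) (\<lambda>n z. \<Sum>i<n. f i z) (\<lambda>z. \<Sum>i. f i z) sequentially"
    by (rule Weierstrass_m_test[of _ _ "\<lambda>n. C r * r ^ n"])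
       (use bound r sub in \<open>auto intro!: summable_mult summable_geometric\<close>)
  moreover have "cball x (r - norm x) \<subseteq> ball 0 1"
    using sub r by force
  ultimately show "\<exists>d. 0 < d \<and> cball x d \<subseteq> ball 0 1 \<and> uniform_limit (cball x d) (\<lambda>n z. \<Sum>i<n. f i z) (\<lambda>z. \<Sum>i. f i z) sequentially"
    using r by (intro exI[of _ "r - norm x"]) auto
qed auto

lemma theta3_null_nat:
  assumes q: "q \<noteq> 0" "norm q < 1"
  shows "theta3_null q = 1 + 2 * q * (\<Sum>n. q ^ (n\<^sup>2 + 2 * n))"
proof -
  define h where "h = (\<lambda>n::nat. q ^ (n\<^sup>2 + 2 * n))"
  have sk: "q powi ((int (Suc n))\<^sup>2) = q * h n" for n
  proof -
    have "q powi ((int (Suc n))\<^sup>2) = q ^ (Suc n)\<^sup>2" by (simp only: of_nat_power[symmetric] power_int_of_nat)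
    also have "(Suc n)\<^sup>2 = Suc (n\<^sup>2 + 2 * n)" by (simp add: power2_eq_square)
    finally show ?thesis by (simp add: h_def)
  qed
  have "inj (\<lambda>n. int (Suc n))" by (simp add: inj_def)
  moreover have "(\<lambda>n. q powi (n\<^sup>2)) summable_on range (\<lambda>n. int (Suc n))"
    by (rule summable_on_subset_banach[of _ UNIV]) (use theta3_null_has_sum[OF q(2)] in \<open>auto simp: summable_on_def\<close>)
  ultimately have "(\<lambda>n. q powi ((int (Suc n))\<^sup>2)) summable_on UNIV"
    using summable_on_reindex[of "\<lambda>n. int (Suc n)" UNIV "\<lambda>n. q powi (n\<^sup>2)"] by (simp add: o_def)
  then obtain S where S: "((\<lambda>n. q powi ((int (Suc n))\<^sup>2)) has_sum S) UNIV"
    by (auto simp: summable_on_def)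
  have "(\<lambda>n. q * h n) sums S"
    using has_sum_imp_sums[OF S] unfolding sk .
  hence "(\<lambda>n. inverse q * (q * h n)) sums (inverse q * S)"
    by (rule sums_mult)
  hence hs: "suminf h = inverse q * S"
    using q by (simp add: sums_iff mult.assoc[symmetric])
  have "((\<lambda>n. q powi ((- int (Suc n))\<^sup>2)) has_sum S) UNIV"
    using S by (simp only: power2_minus)
  from has_sum_unique[OF theta3_null_has_sum[OF q(2)] has_sum_int_split[OF S this]]
  have "theta3_null q = 1 + 2 * S"
    by simp
  thus ?thesis using hs q unfolding h_def by simp
qed

text \<open>The quadratic relation for the Lambert side holds because
  \<open>two_square_sum_mult_minus\<close> at q and \<open>two_square_sum_minus_square\<close> at
  q^2 both give \<open>4 * koebe_alt_sum (q^2)\<close>.\<close>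

lemma two_square_sum_eq_theta3_null:
  assumes "z \<noteq> 0" "norm z < 1"
  shows "two_square_sum z = theta3_null z ^ 2"
proof -
  define F where "F = (\<lambda>q::complex. \<Sum>n. q ^ n / (1 + q ^ (2 * n + 2)))"
  define k where "k = (\<lambda>q::complex. \<Sum>n::nat. q ^ (n\<^sup>2 + 2 * n))"
  \<comment> \<open>If theta = 1 + 2 q k, then theta^2 = 1 + 4 q (k + q k^2).\<close>
  define G where "G = (\<lambda>q. k q + q * k q ^ 2)"
  have pw: "norm (q ^ (m + n)) \<le> r ^ n" if "0 < r" "r < 1" "norm q \<le> r" for r m n and q :: complex
  proof -
    have "norm (q ^ (m + n)) \<le> 1 * norm q ^ n"
      unfolding power_add norm_mult norm_power using that by (intro mult_right_mono power_le_one) auto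
    also have "\<dots> \<le> r ^ n" using that by (simp add: power_mono)
    finally show ?thesis .
  qed
  have holF: "F holomorphic_on ball 0 1"
    unfolding F_def
  proof (rule holomorphic_suminf[where C = "\<lambda>r. 1 / (1 - r)"])
    have le: "norm (q ^ (2 * n + 2)) \<le> r" if "0 < r" "r < 1" "norm q \<le> r" for q :: complex and r n
      using pw[OF that, of "2 * n + 1" 1] by simp
    show "(\<lambda>q::complex. q ^ n / (1 + q ^ (2 * n + 2))) holomorphic_on ball 0 1" for n
    proof (intro holomorphic_intros)
      fix q :: complex assume "q \<in> ball 0 1"
      then obtain r where "0 < r" "r < 1" "norm q \<le> r"
        using dense[of "norm q" 1] by (auto intro: le_less_trans[OF norm_ge_zero] less_imp_le)
      from le[OF this, of n] \<open>r < 1\<close> have "norm (q ^ (2 * n + 2)) < norm (1 :: complex)" by simp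
      thus "1 + q ^ (2 * n + 2) \<noteq> 0" by (auto simp only: add_eq_0_iff norm_minus_cancel)
    qed
    fix r :: real and n :: nat and q :: complex
    assume r: "0 < r" "r < 1" "norm q \<le> r"
    have "1 - r \<le> norm (1 :: complex) - norm (q ^ (2 * n + 2))" using le[OF r, of n] by simp
    also have "\<dots> \<le> norm (1 + q ^ (2 * n + 2))" by (rule norm_diff_ineq)
    finally have "1 - r \<le> norm (1 + q ^ (2 * n + 2))" .
    moreover have "norm (q ^ n) \<le> r ^ n" using pw[OF r, of 0 n] by simp
    ultimately have "norm (q ^ n) / norm (1 + q ^ (2 * n + 2)) \<le> r ^ n / (1 - r)"
      using r by (intro frac_le) auto
    thus "norm (q ^ n / (1 + q ^ (2 * n + 2))) \<le> 1 / (1 - r) * r ^ n"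
      by (simp only: norm_divide) simp
  qed
  have holk: "k holomorphic_on ball 0 1"
    unfolding k_def
  proof (rule holomorphic_suminf[where C = "\<lambda>_. 1"])
    show "norm (q ^ (n\<^sup>2 + 2 * n)) \<le> 1 * r ^ n" if "0 < r" "r < 1" "norm q \<le> r" for r n and q :: complex
      using pw[OF that, of "n\<^sup>2 + n" n] by (simp add: mult_2 add.assoc)
  qed (intro holomorphic_intros)
  have s1: "(\<lambda>n::nat. if n = 0 then 1 else 0 :: complex) sums 1"
    using sums_single[of 0 "\<lambda>_. 1 :: complex"] by simp
  have "(\<lambda>n. (0 :: complex) ^ n / (1 + 0 ^ (2 * n + 2))) = (\<lambda>n. if n = 0 then 1 else 0)"
    by (auto simp: fun_eq_iff)
  hence F0: "F 0 = 1" unfolding F_def using s1 by (simp only: sums_iff)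
  have "(\<lambda>n::nat. (0 :: complex) ^ (n\<^sup>2 + 2 * n)) = (\<lambda>n. if n = 0 then 1 else 0)"
    by (auto simp: fun_eq_iff)
  hence k0: "k 0 = 1" unfolding k_def using s1 by (simp only: sums_iff)
  show ?thesis
  proof (rule two_square_uniqueness[of F G two_square_sum "\<lambda>q. theta3_null q ^ 2"])
    show "F holomorphic_on ball 0 1" by (rule holF)
    show "G holomorphic_on ball 0 1" unfolding G_def by (intro holomorphic_intros holk)
    show "F 0 = 1" by (rule F0)
    show "G 0 = 1" by (simp add: G_def k0)
    show "z \<noteq> 0" "norm z < 1" by fact+
    fix q :: complex assume q: "q \<noteq> 0" "norm q < 1"
    show "two_square_sum q = 1 + 4 * q * F q" unfolding F_def by (rule two_square_sum_nat[OF q])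
    have "theta3_null q = 1 + 2 * q * k q" unfolding k_def by (rule theta3_null_nat[OF q])
    thus "theta3_null q ^ 2 = 1 + 4 * q * G q" by (simp add: G_def power2_eq_square algebra_simps)
    show "two_square_sum q + two_square_sum (- q) = 2 * two_square_sum (q\<^sup>2)"
      by (rule two_square_sum_add[OF q])
    show "theta3_null q ^ 2 + theta3_null (- q) ^ 2 = 2 * theta3_null (q\<^sup>2) ^ 2"
      by (rule theta3_null_square_sum[OF q])
    have "q\<^sup>2 \<noteq> 0" "norm (q\<^sup>2) < 1" using q by (auto simp: norm_power power_less_one_iff)
    hence "two_square_sum (- (q\<^sup>2)) ^ 2 = 4 * koebe_alt_sum (q\<^sup>2)"
      by (rule two_square_sum_minus_square)
    thus "two_square_sum q * two_square_sum (- q) = two_square_sum (- (q\<^sup>2)) ^ 2"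
      by (simp only: two_square_sum_mult_minus[OF q])
    have "theta3_null q ^ 2 * theta3_null (- q) ^ 2 = (theta3_null q * theta3_null (- q)) ^ 2"
      by (simp add: power_mult_distrib)
    thus "theta3_null q ^ 2 * theta3_null (- q) ^ 2 = (theta3_null (- (q\<^sup>2)) ^ 2) ^ 2"
      by (simp only: theta3_null_mult_minus[OF q])
  qed
qed

lemma koebe_sum_fps_nth_2:
  assumes q: "q \<noteq> 0" "norm q < 1"
  shows "16 * fps_nth (koebe_sum_fps q) 2 = theta3_null (- q) ^ 8"
proof -
  have "16 * fps_nth (koebe_sum_fps q) 2 = (4 * koebe_alt_sum q) ^ 2"
    by (simp add: koebe_alt_sum_eq_fps_nth[OF q, symmetric] power_mult_distrib)
  also have "\<dots> = (two_square_sum (- q) ^ 2) ^ 2"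
    by (simp add: two_square_sum_minus_square[OF q])
  also have "\<dots> = ((theta3_null (- q) ^ 2) ^ 2) ^ 2"
    using q by (simp add: two_square_sum_eq_theta3_null)
  finally show ?thesis by (simp flip: power_mult)
qed

subsection \<open>Bernoulli numbers\<close>

lemma fps_X_div_exp_minus_1_mult:
  "fps_X / (fps_exp 1 - 1) * (fps_exp 1 - 1 :: 'a :: field_char_0 fps) = fps_X"
proof -
  have "subdegree (fps_exp 1 - 1 :: 'a fps) = 1"
    by (rule subdegreeI) auto
  moreover from this have "(fps_exp 1 - 1 :: 'a fps) \<noteq> 0" by auto
  ultimately show ?thesis
    by (intro dvd_div_mult_self) (auto simp: fps_dvd_iff)
qed

text \<open>1 / (exp t + 1) = 1 / (exp t - 1) - 2 / (exp (2 t) - 1); multiplied by t this is B(t) -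
  B(2 t), the origin of the factor 1 - 2^(n+1).\<close>

lemma inverse_1_plus_exp_nth:
  "fps_nth (inverse (1 + fps_exp 1) :: real fps) n = (1 - 2 ^ Suc n) * bernoulli (Suc n) / fact (Suc n)"
proof -
  define B :: "real fps" where "B = fps_X / (fps_exp 1 - 1)"
  define E :: "real fps" where "E = fps_exp 1"
  define B2 where "B2 = fps_compose B (fps_const 2 * fps_X)"
  have BE: "B * (E - 1) = fps_X"
    unfolding B_def E_def by (rule fps_X_div_exp_minus_1_mult)
  have E2: "fps_compose E (fps_const 2 * fps_X) = E * E"
    unfolding E_def by (simp add: fps_exp_compose_linear fps_exp_add_mult[symmetric])
  have "fps_compose (B * (E - 1)) (fps_const 2 * fps_X) = B2 * (E * E - 1)"
    unfolding B2_def by (subst fps_compose_mult_distrib) (simp_all add: fps_compose_sub_distrib E2)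
  hence B2E: "B2 * (E * E - 1) = fps_const 2 * fps_X"
    unfolding BE by simp
  have nz: "E - 1 \<noteq> 0" using BE by auto
  have "(B - B2) * (E + 1) * (E - 1) = (B * (E - 1)) * (E + 1) - B2 * (E * E - 1)"
    by (simp add: algebra_simps)
  also have "\<dots> = fps_X * (E + 1) - fps_const 2 * fps_X" unfolding BE B2E ..
  also have "\<dots> = fps_X * (E - 1)"
    by (simp add: algebra_simps numeral_fps_const[symmetric])
  finally have "(B - B2) * (E + 1) = fps_X" using nz by simp
  hence "(B - B2) * (E + 1) * inverse (E + 1) = fps_X * inverse (E + 1)" by simp
  moreover have "(E + 1) * inverse (E + 1) = 1"
    by (subst mult.commute, rule inverse_mult_eq_1) (simp add: E_def)
  ultimately have eq: "B - B2 = fps_X * inverse (1 + E)" by (simp add: mult.assoc add.commute)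
  have "fps_nth (inverse (1 + E)) n = fps_nth (fps_X * inverse (1 + E)) (Suc n)" by simp
  also have "\<dots> = fps_nth B (Suc n) - 2 ^ Suc n * fps_nth B (Suc n)"
    unfolding eq[symmetric] B2_def by (simp add: fps_compose_linear)
  also have "fps_nth B (Suc n) = bernoulli (Suc n) / fact (Suc n)"
    by (simp add: bernoulli_def B_def del: fact_Suc)
  finally show ?thesis unfolding E_def by (simp add: algebra_simps diff_divide_distrib del: fact_Suc)
qed

text \<open>The series \<open>v\<close> is \<open>- tanh (t / 2) / 2\<close>; its Riccati equation \<open>v' = v\<^sup>2 - 1 / 4\<close> determines the signs.\<close>

lemma inverse_1_plus_exp_sign:
  fixes v :: "real fps"
  defines "v \<equiv> inverse (1 + fps_exp 1) - fps_const (1 / 2)"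
  shows "(even n \<longrightarrow> fps_nth v n = 0) \<and> (\<forall>k. n = 2 * k + 1 \<longrightarrow> (-1) ^ Suc k * fps_nth v n \<ge> 0)"
proof (induction n rule: less_induct)
  case (less n)
  have d: "fps_deriv v = v ^ 2 - fps_const (1 / 4)"
  proof -
    have "fps_deriv v = inverse (1 + fps_exp 1) ^ 2 - inverse (1 + fps_exp 1)"
      unfolding v_def by (simp add: deriv_inverse_1_plus_exp[OF refl])
    also have "inverse (1 + fps_exp 1) = v + fps_const (1 / 2)" by (simp add: v_def)
    also have "(v + fps_const (1 / 2)) ^ 2 - (v + fps_const (1 / 2)) = v ^ 2 + (2 * fps_const (1 / 2) - 1) * v + (fps_const (1 / 2) * fps_const (1 / 2) - fps_const (1 / 2))"
      by (simp add: power2_eq_square algebra_simps)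
    also have "2 * fps_const (1 / 2 :: real) = 1"
      unfolding numeral_fps_const by simp
    finally show ?thesis by simp
  qed
  have rec: "real (Suc m) * fps_nth v (Suc m) = (\<Sum>i\<le>m. fps_nth v i * fps_nth v (m - i)) - (if m = 0 then 1 / 4 else 0)" for m
  proof -
    have "real (Suc m) * fps_nth v (Suc m) = fps_nth (fps_deriv v) m" by simp
    also have "\<dots> = (\<Sum>i\<le>m. fps_nth v i * fps_nth v (m - i)) - (if m = 0 then 1 / 4 else 0)"
      unfolding d by (simp add: power2_eq_square fps_mult_nth atLeast0AtMost)
    finally show ?thesis .
  qed
  have v0: "fps_nth v 0 = 0" by (simp add: v_def)
  show ?case
  proof (cases n)
    case 0
    thus ?thesis using v0 by auto
  next
    case (Suc m)
    have IH: "even i \<Longrightarrow> fps_nth v i = 0" "i = 2 * k + 1 \<Longrightarrow> (-1) ^ Suc k * fps_nth v i \<ge> 0" if "i \<le> m" for i k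
      using less[of i] that Suc by auto
    show ?thesis
    proof (cases "even n")
      case True
      have "(\<Sum>i\<le>m. fps_nth v i * fps_nth v (m - i)) = 0"
      proof (rule sum.neutral, safe)
        fix i assume "i \<le> m"
        moreover have "odd m" using True Suc by simp
        ultimately show "fps_nth v i * fps_nth v (m - i) = 0"
          using IH(1)[of i] IH(1)[of "m - i"] by (cases "even i") auto
      qed
      moreover have "odd m" using True Suc by simp
      hence "m \<noteq> 0" using odd_pos by blast
      ultimately have "fps_nth v n = 0" using rec[of m] Suc by simp
      thus ?thesis using True by auto
    next
      case False
      have "(-1) ^ Suc k * fps_nth v n \<ge> 0" if k: "n = 2 * k + 1" for k
      proof -
        have m: "m = 2 * k" using k Suc by simp
        have "0 \<le> (-1) ^ Suc k * ((\<Sum>i\<le>m. fps_nth v i * fps_nth v (m - i)) - (if m = 0 then 1 / 4 else 0))"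
        proof (cases "k = 0")
          case True
          thus ?thesis using v0 m by simp
        next
          case False
          have "0 \<le> (-1) ^ Suc k * (fps_nth v i * fps_nth v (m - i))" if i: "i \<le> m" for i
          proof (cases "even i")
            case True
            thus ?thesis using IH(1)[of i] i by simp
          next
            case False
            then obtain a where a: "i = 2 * a + 1" by (auto elim!: oddE)
            define b where "b = k - Suc a"
            have b: "m - i = 2 * b + 1" "k = a + b + 1" using a i m by (auto simp: b_def)
            \<comment> \<open>Two odd indices have signs that combine because Suc a + Suc b = Suc
              k.\<close>
            have "0 \<le> ((-1) ^ Suc a * fps_nth v i) * ((-1) ^ Suc b * fps_nth v (m - i))"
              by (rule mult_nonneg_nonneg[OF IH(2)[OF i a] IH(2)[OF _ b(1)]]) simp
            also have "\<dots> = (-1) ^ Suc k * (fps_nth v i * fps_nth v (m - i))"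
              by (simp add: b(2) power_add mult_ac)
            finally show ?thesis .
          qed
          hence "0 \<le> (\<Sum>i\<le>m. (-1) ^ Suc k * (fps_nth v i * fps_nth v (m - i)))"
            by (intro sum_nonneg) auto
          thus ?thesis using False m by (simp add: sum_distrib_left)
        qed
        also have "\<dots> = real n * ((-1) ^ Suc k * fps_nth v n)"
          unfolding rec[symmetric] Suc by (simp only: mult_ac)
        finally show ?thesis
          using mult_le_cancel_left_pos[of "real n" 0 "(-1) ^ Suc k * fps_nth v n"] k by simp
      qed
      thus ?thesis using False by auto
    qed
  qed
qed

text \<open>By the sign lemma the absolute value in \<open>coeff_a\<close> is (-1)^k times the
  Bernoulli number, which cancels the factor (-1)^k there.\<close>

lemma inverse_1_plus_exp_nth_odd:
  "fps_nth (inverse (1 + fps_exp 1) :: real fps) (2 * k + 1) = - 2 * coeff_a k / fact (2 * k + 1)"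
proof -
  define c where "c = fps_nth (inverse (1 + fps_exp 1) :: real fps) (2 * k + 1)"
  have c: "c = (1 - 2 ^ (2 * k + 2)) * bernoulli (2 * k + 2) / fact (2 * k + 2)"
    unfolding c_def using inverse_1_plus_exp_nth[of "2 * k + 1"] by simp
  have "(-1) ^ Suc k * c \<ge> 0"
    using inverse_1_plus_exp_sign[of "2 * k + 1"] by (auto simp: c_def)
  also have "(-1) ^ Suc k * c = ((2 ^ (2 * k + 2) - 1) / fact (2 * k + 2)) * ((-1) ^ k * bernoulli (2 * k + 2))"
    unfolding c by (simp add: field_simps del: fact_Suc)
  finally have "(-1) ^ k * bernoulli (2 * k + 2) \<ge> 0"
  proof (rule contrapos_pp)
    have "(1::real) < 2 ^ (2 * k + 2)" by (rule one_less_power) auto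
    hence p: "(2 ^ (2 * k + 2) - 1) / fact (2 * k + 2) > (0::real)" by simp
    assume "\<not> (-1) ^ k * bernoulli (2 * k + 2) \<ge> 0"
    thus "\<not> ((2 ^ (2 * k + 2) - 1) / fact (2 * k + 2)) * ((-1) ^ k * bernoulli (2 * k + 2)) \<ge> 0"
      using mult_pos_neg[OF p] by (simp only: not_le)
  qed
  hence "\<bar>bernoulli (2 * k + 2)\<bar> = (-1) ^ k * bernoulli (2 * k + 2)"
    by (cases "even k") auto
  hence "(-1) ^ k * \<bar>bernoulli (2 * k + 2)\<bar> = bernoulli (2 * k + 2)" by simp
  hence a: "coeff_a k = (2 ^ (2 * k + 2) - 1) / (4 * (real k + 1)) * bernoulli (2 * k + 2)"
    unfolding coeff_a_def by (simp add: mult_ac)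
  have "(fact (2 * k + 2) :: real) = (2 * real k + 2) * fact (2 * k + 1)"
    by (simp add: algebra_simps)
  hence "c = (1 - 2 ^ (2 * k + 2)) * bernoulli (2 * k + 2) / ((2 * real k + 2) * fact (2 * k + 1))"
    unfolding c by simp
  also have "\<dots> = - 2 * coeff_a k / fact (2 * k + 1)"
  proof -
    define F P b r where "F = (fact (2 * k + 1) :: real)" and "P = (2::real) ^ (2 * k + 2)"
      and "b = bernoulli (2 * k + 2)" and "r = real k + 1"
    have "F \<noteq> 0" "r \<noteq> 0" by (auto simp: F_def r_def)
    hence "(1 - P) * b / ((2 * r) * F) = - 2 * ((P - 1) / (4 * r) * b) / F"
      by (simp add: field_simps)
    thus ?thesis unfolding a F_def P_def b_def r_def by (simp add: algebra_simps del: fact_Suc)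
  qed
  finally show ?thesis unfolding c_def .
qed

lemma inverse_1_plus_exp_nth_complex:
  "fps_nth (inverse (1 + fps_exp 1) :: complex fps) n = of_real (fps_nth (inverse (1 + fps_exp 1)) n)"
proof -
  define W :: "complex fps" where "W = Abs_fps (\<lambda>n. of_real (fps_nth (inverse (1 + fps_exp 1)) n))"
  have r: "inverse (1 + fps_exp 1) * (1 + fps_exp 1 :: real fps) = 1"
    by (rule inverse_mult_eq_1) simp
  have "W * (1 + fps_exp 1) = 1"
  proof (rule fps_ext)
    fix n
    have "fps_nth (W * (1 + fps_exp 1)) n = of_real (fps_nth (inverse (1 + fps_exp 1) * (1 + fps_exp 1 :: real fps)) n)"
      by (auto simp: fps_mult_nth W_def intro!: sum.cong)
    thus "fps_nth (W * (1 + fps_exp 1)) n = fps_nth 1 n" unfolding r by simp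
  qed
  hence "inverse (1 + fps_exp 1) = W"
    by (intro fps_inverse_unique) (simp add: mult.commute)
  thus ?thesis by (simp add: W_def)
qed

lemma koebe_fps_eq_deriv: "koebe_fps = fps_deriv (inverse (1 + fps_exp 1))"
  unfolding koebe_fps_def by (rule deriv_inverse_1_plus_exp[OF refl, symmetric])

lemma koebe_fps_nth_even: "fact (2 * k) * fps_nth koebe_fps (2 * k) = - 2 * of_real (coeff_a k)"
proof -
  have "fact (2 * k) * fps_nth koebe_fps (2 * k) = fact (2 * k + 1) * of_real (fps_nth (inverse (1 + fps_exp 1) :: real fps) (2 * k + 1))"
    unfolding koebe_fps_eq_deriv by (simp add: inverse_1_plus_exp_nth_complex mult_ac)
  also have "\<dots> = fact (2 * k + 1) * (- 2 * of_real (coeff_a k) / fact (2 * k + 1))"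
    unfolding inverse_1_plus_exp_nth_odd by (simp del: fact_Suc)
  finally show ?thesis by (simp del: fact_Suc)
qed

lemma koebe_fps_nth_odd: "fps_nth koebe_fps (Suc 0) = 0"
proof -
  have "fps_nth (inverse (1 + fps_exp 1) - fps_const (1 / 2) :: real fps) 2 = 0"
    using inverse_1_plus_exp_sign[of 2] by auto
  thus ?thesis
    unfolding koebe_fps_eq_deriv by (simp add: inverse_1_plus_exp_nth_complex numeral_2_eq_2)
qed

lemma koebe_sum_fps_nth_even:
  assumes "k \<noteq> 0"
  shows "fact (2 * k) * fps_nth (koebe_sum_fps q) (2 * k) = 2 * (lambert_G (2 * k + 1) q - of_real (coeff_a k))"
  using koebe_fps_nth_even[of k] by (simp add: koebe_sum_fps_def distrib_left del: fact_Suc)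

subsection \<open>The determinant formula\<close>

text \<open>Only coefficients of positive order enter the matrix, so subtracting the constant term
  of \<open>Y\<close> reduces to \<open>det_Hankel_of_quadratic_ode\<close>.\<close>

lemma det_Hankel_of_translated_ode:
  fixes Y :: "complex fps"
  assumes Y1: "fps_nth Y 1 = 0"
    and ode: "fps_deriv (fps_deriv Y) = fps_const c + fps_const b * Y + 6 * Y ^ 2"
  shows "Determinant.det (Matrix.mat n n (\<lambda>(i, j). fact (2 * (i + j + 1)) * fps_nth Y (2 * (i + j + 1))))
       = fps_nth Y 2 ^ (n * (n + 1) div 2) * (\<Prod>r=1..2*n. fact r)"
proof -
  define Y0 where "Y0 = fps_nth Y 0"
  define y where "y = Y - fps_const Y0"
  have Y: "Y = y + fps_const Y0" by (simp add: y_def)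
  \<comment> \<open>The quadratic 6 Y^2 + b Y + c is re-expanded at \<open>Y0\<close>: its value
    there is \<open>2 * a'\<close>, its derivative \<open>4 * b'\<close>.\<close>
  define b' where "b' = (b + 12 * Y0) / 4"
  define a' where "a' = (c + b * Y0 + 6 * Y0 ^ 2) / 2"
  have "fps_deriv (fps_deriv y) = fps_deriv (fps_deriv Y)" by (simp add: y_def)
  also have "\<dots> = fps_const (2 * a') + fps_const (4 * b') * y + 6 * y ^ 2"
  proof -
    have "fps_const (2 * a') = fps_const c + fps_const b * fps_const Y0 + 6 * fps_const Y0 ^ 2"
      by (simp add: a'_def numeral_fps_const)
    moreover have "fps_const (4 * b') = fps_const b + 12 * fps_const Y0"
      by (simp add: b'_def numeral_fps_const)
    ultimately show ?thesis
      unfolding ode by (simp only: Y) (simp add: power2_eq_square algebra_simps)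
  qed
  finally have od: "fps_deriv (fps_deriv y) = fps_const (2 * a') + fps_const (4 * b') * y + 6 * y ^ 2" .
  have y0: "fps_nth y 0 = 0" "fps_nth y 1 = 0" using Y1 by (simp_all add: y_def Y0_def)
  have "2 * fps_nth Y 2 = fps_nth (fps_deriv (fps_deriv y)) 0"
    by (simp add: y_def numeral_2_eq_2)
  also have "\<dots> = 2 * a'" unfolding od using y0 by (simp add: power2_eq_square)
  finally have a: "a' = fps_nth Y 2" by simp
  have "fps_nth y (2 * (i + j + 1)) = fps_nth Y (2 * (i + j + 1))" for i j
    by (simp add: y_def)
  thus ?thesis using det_Hankel_of_quadratic_ode[OF y0 od, of n] unfolding a by simp
qed

text \<open>The Hankel matrix of \<open>koebe_sum_fps q\<close> is twice this one, hence 2^n; the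
  eight-square formula supplies the base of the power.\<close>

lemma det_lambert_G_minus_coeff_a:
  assumes q: "q \<noteq> 0" "norm q < 1"
  shows "2 ^ n * Determinant.det (Matrix.mat n n (\<lambda>(i, j). lambert_G (2 * (i + j + 1) + 1) q - of_real (coeff_a (i + j + 1))))
       = (theta3_null (- q) ^ 8 / 16) ^ (n * (n + 1) div 2) * (\<Prod>r=1..2*n. fact r)"
proof -
  obtain b c where ode: "fps_deriv (fps_deriv (koebe_sum_fps q)) = fps_const c + fps_const b * koebe_sum_fps q + 6 * koebe_sum_fps q ^ 2"
    using koebe_sum_fps_ode[OF q] by blast
  have 1: "fps_nth (koebe_sum_fps q) 1 = 0"
    by (simp add: koebe_sum_fps_def koebe_fps_nth_odd)
  have "Matrix.mat n n (\<lambda>(i, j). fact (2 * (i + j + 1)) * fps_nth (koebe_sum_fps q) (2 * (i + j + 1)))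
     = 2 \<cdot>\<^sub>m Matrix.mat n n (\<lambda>(i, j). lambert_G (2 * (i + j + 1) + 1) q - of_real (coeff_a (i + j + 1)))"
    using koebe_sum_fps_nth_even[of "i + j + 1" q for i j]
    by (intro eq_matI) (simp_all only: dim_row_mat dim_col_mat index_mat index_smult_mat split)
  hence "2 ^ n * Determinant.det (Matrix.mat n n (\<lambda>(i, j). lambert_G (2 * (i + j + 1) + 1) q - of_real (coeff_a (i + j + 1))))
     = Determinant.det (Matrix.mat n n (\<lambda>(i, j). fact (2 * (i + j + 1)) * fps_nth (koebe_sum_fps q) (2 * (i + j + 1))))"
    by (simp only: det_smult dim_col_mat)
  also have "\<dots> = fps_nth (koebe_sum_fps q) 2 ^ (n * (n + 1) div 2) * (\<Prod>r=1..2*n. fact r)"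
    by (rule det_Hankel_of_translated_ode[OF 1 ode])
  also have "fps_nth (koebe_sum_fps q) 2 = theta3_null (- q) ^ 8 / 16"
    using koebe_sum_fps_nth_2[OF q] by (simp add: field_simps)
  finally show ?thesis .
qed

text \<open>This is the degenerate case \<open>q = 0\<close> of the preceding lemma.\<close>

lemma det_coeff_a:
  "(- 2) ^ n * Determinant.det (Matrix.mat n n (\<lambda>(i, j). of_real (coeff_a (i + j + 1)) :: complex))
     = (1 / 16) ^ (n * (n + 1) div 2) * (\<Prod>r=1..2*n. fact r)"
proof -
  have ode: "fps_deriv (fps_deriv koebe_fps) = fps_const 0 + fps_const 1 * koebe_fps + 6 * koebe_fps ^ 2"
    using koebe_fps_ode by simp
  have 1: "fps_nth koebe_fps 1 = 0"
    by (simp add: koebe_fps_nth_odd)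
  have "Matrix.mat n n (\<lambda>(i, j). fact (2 * (i + j + 1)) * fps_nth koebe_fps (2 * (i + j + 1)))
     = (- 2) \<cdot>\<^sub>m Matrix.mat n n (\<lambda>(i, j). of_real (coeff_a (i + j + 1)))"
    using koebe_fps_nth_even[of "i + j + 1" for i j]
    by (intro eq_matI) (simp_all only: dim_row_mat dim_col_mat index_mat index_smult_mat split)
  hence "(- 2) ^ n * Determinant.det (Matrix.mat n n (\<lambda>(i, j). of_real (coeff_a (i + j + 1)) :: complex))
     = Determinant.det (Matrix.mat n n (\<lambda>(i, j). fact (2 * (i + j + 1)) * fps_nth koebe_fps (2 * (i + j + 1))))"
    by (simp only: det_smult dim_col_mat)
  also have "\<dots> = fps_nth koebe_fps 2 ^ (n * (n + 1) div 2) * (\<Prod>r=1..2*n. fact r)"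
    by (rule det_Hankel_of_translated_ode[OF 1 ode])
  \<comment> \<open>The differential equation at 0 reads 2 H_2 = H_0 + 6 H_0^2, with H_0 =
    -1/4.\<close>
  also have "fps_nth koebe_fps 2 = 1 / 16"
  proof -
    define H where "H = koebe_fps"
    have "fps_nth (inverse (1 + fps_exp 1) :: complex fps) 0 = 1 / 2" by simp
    hence H0: "fps_nth H 0 = - (1 / 4)" unfolding H_def koebe_fps_def by (simp add: power2_eq_square)
    have "2 * fps_nth H 2 = fps_nth (fps_deriv (fps_deriv H)) 0" by (simp add: numeral_2_eq_2)
    also have "\<dots> = fps_nth H 0 + 6 * fps_nth H 0 ^ 2"
      unfolding H_def koebe_fps_ode by (simp add: power2_eq_square)
    finally have "2 * fps_nth H 2 = 2 * (1 / 16)" unfolding H0 by (simp add: power2_eq_square)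
    hence "fps_nth H 2 = 1 / 16" by (simp only: mult_cancel_left) simp
    thus ?thesis by (simp only: H_def)
  qed
  finally show ?thesis .
qed

text \<open>Multilinearity in the rows, carried out on each term of the Leibniz formula; every row
  outside S contributes a sign.\<close>

lemma det_diff_expand_subsets:
  fixes x y :: "nat \<Rightarrow> nat \<Rightarrow> complex"
  shows "Determinant.det (Matrix.mat n n (\<lambda>(i, j). x i j - y i j))
     = (\<Sum>S\<in>Pow {1..n}. (- 1) ^ (n - card S) * Determinant.det (Matrix.mat n n (\<lambda>(i, j). if Suc i \<in> S then x i j else y i j)))"
proof -
  have card: "card S \<le> n" if "S \<subseteq> {1..n}" for S
    using card_mono[OF _ that] by simp
  have "(\<Prod>i = 0..<n. x i (p i) - y i (p i)) =
      (\<Sum>S\<in>Pow {1..n}. (- 1) ^ (n - card S) * (\<Prod>i = 0..<n. if Suc i \<in> S then x i (p i) else y i (p i)))" for p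
  proof -
    have "(\<Prod>i = 0..<n. x i (p i) - y i (p i)) = (\<Prod>i\<in>{1..n}. x (i - 1) (p (i - 1)) + - y (i - 1) (p (i - 1)))"
      by (rule prod.reindex_bij_witness[of _ "\<lambda>i. i - 1" Suc]) auto
    also have "\<dots> = (\<Sum>S\<in>Pow {1..n}. (\<Prod>i\<in>S. x (i - 1) (p (i - 1))) * (\<Prod>i\<in>{1..n} - S. - y (i - 1) (p (i - 1))))"
      by (rule prod_add) simp
    also have "\<dots> = (\<Sum>S\<in>Pow {1..n}. (- 1) ^ (n - card S) * (\<Prod>i = 0..<n. if Suc i \<in> S then x i (p i) else y i (p i)))"
    proof (intro sum.cong refl)
      fix S assume "S \<in> Pow {1..n}"
      hence S: "S \<subseteq> {1..n}" "finite S" using finite_subset[of S "{1..n}"] by auto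
      have "(\<Prod>i = 0..<n. if Suc i \<in> S then x i (p i) else y i (p i)) =
         (\<Prod>i\<in>{1..n}. if i \<in> S then x (i - 1) (p (i - 1)) else y (i - 1) (p (i - 1)))"
        by (rule prod.reindex_bij_witness[of _ "\<lambda>i. i - 1" Suc]) auto
      also have "\<dots> = (\<Prod>i\<in>{1..n} - S. if i \<in> S then x (i - 1) (p (i - 1)) else y (i - 1) (p (i - 1))) *
           (\<Prod>i\<in>S. if i \<in> S then x (i - 1) (p (i - 1)) else y (i - 1) (p (i - 1)))"
        by (rule prod.subset_diff) (use S in auto)
      also have "\<dots> = (\<Prod>i\<in>{1..n} - S. y (i - 1) (p (i - 1))) * (\<Prod>i\<in>S. x (i - 1) (p (i - 1)))"
        by (intro arg_cong2[of _ _ _ _ "(*)"] prod.cong) auto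
      finally have e: "(\<Prod>i = 0..<n. if Suc i \<in> S then x i (p i) else y i (p i))
         = (\<Prod>i\<in>{1..n} - S. y (i - 1) (p (i - 1))) * (\<Prod>i\<in>S. x (i - 1) (p (i - 1)))" .
      have "(\<Prod>i\<in>{1..n} - S. - y (i - 1) (p (i - 1))) = (- 1) ^ card ({1..n} - S) * (\<Prod>i\<in>{1..n} - S. y (i - 1) (p (i - 1)))"
        by (rule prod_uminus)
      also have "card ({1..n} - S) = n - card S" using S by (simp add: card_Diff_subset)
      finally show "(\<Prod>i\<in>S. x (i - 1) (p (i - 1))) * (\<Prod>i\<in>{1..n} - S. - y (i - 1) (p (i - 1))) =
          (- 1) ^ (n - card S) * (\<Prod>i = 0..<n. if Suc i \<in> S then x i (p i) else y i (p i))"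
        unfolding e by (simp only: mult_ac)
    qed
    finally show ?thesis .
  qed
  note expand = this
  have det: "Determinant.det (Matrix.mat n n (\<lambda>(i, j). f i j)) = (\<Sum>p | p permutes {0..<n}. signof p * (\<Prod>i = 0..<n. f i (p i)))"
    for f :: "nat \<Rightarrow> nat \<Rightarrow> complex"
  proof -
    have "Determinant.det (Matrix.mat n n (\<lambda>(i, j). f i j))
        = (\<Sum>p | p permutes {0..<n}. signof p * (\<Prod>i = 0..<n. Matrix.mat n n (\<lambda>(i, j). f i j) $$ (i, p i)))"
      by (rule det_def') simp
    also have "\<dots> = (\<Sum>p | p permutes {0..<n}. signof p * (\<Prod>i = 0..<n. f i (p i)))"
    proof (intro sum.cong prod.cong arg_cong2[of _ _ _ _ "(*)"] refl)
      fix p i assume "p \<in> {p. p permutes {0..<n}}" "i \<in> {0..<n}"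
      hence "p i < n" "i < n" using permutes_in_image[of p "{0..<n}" i] by auto
      thus "Matrix.mat n n (\<lambda>(i, j). f i j) $$ (i, p i) = f i (p i)" by simp
    qed
    finally show ?thesis .
  qed
  show ?thesis
    unfolding det expand sum_distrib_left
    by (subst sum.swap) (intro sum.cong refl, simp only: mult_ac)
qed

theorem theorem5p6:
  fixes q :: complex and n :: nat
  assumes "0 < norm q" and "norm q < 1" and "n \<ge> 1"
  shows "theta3_null (-q) ^ (4 * n * (n + 1)) =
    1 + (\<Sum>p=1..n. (-1) ^ (n - p) * 2 ^ (2 * n\<^sup>2 + 3 * n)
          * (\<Prod>r=1..2*n. inverse (fact r))
          * (\<Sum>S | S \<noteq> {} \<and> S \<subseteq> {1..n} \<and> card S = p. Determinant.det (M_matrix n S q)))"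
proof -
  have q: "q \<noteq> 0" "norm q < 1" using assms by auto
  define N where "N = n * (n + 1) div 2"
  define P :: complex where "P = (\<Prod>r=1..2*n. fact r)"
  define K :: complex where "K = 2 ^ (2 * n\<^sup>2 + 3 * n) * (\<Prod>r=1..2*n. inverse (fact r))"
  define D where "D = (\<lambda>S. Determinant.det (M_matrix n S q))"
  have P: "P \<noteq> 0" by (simp add: P_def)
  have PK: "K = 2 ^ (2 * n\<^sup>2 + 3 * n) / P"
    unfolding K_def P_def by (simp add: divide_inverse o_def flip: prod_inversef)
  have N: "2 * N = n * (n + 1)" by (simp add: N_def)
  \<comment> \<open>The power of 16 clears the denominator of theta^8 / 16, and 2^n collects the
    factor 2 of each row.\<close>
  have e16: "(16 :: complex) ^ N * 2 ^ n = 2 ^ (2 * n\<^sup>2 + 3 * n)"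
  proof -
    have "(16 :: complex) ^ N = (2 ^ 4) ^ N" by simp
    also have "\<dots> = 2 ^ (2 * (2 * N))" by (simp only: power_mult[symmetric] mult.assoc[symmetric]) simp
    also have "\<dots> = 2 ^ (2 * n\<^sup>2 + 2 * n)" unfolding N by (simp add: power2_eq_square algebra_simps)
    finally have "(16 :: complex) ^ N * 2 ^ n = 2 ^ (2 * n\<^sup>2 + 2 * n + n)"
      by (simp only: power_add)
    also have "2 * n\<^sup>2 + 2 * n + n = 2 * n\<^sup>2 + 3 * n" by simp
    finally show ?thesis .
  qed
  have M: "M_matrix n S q = Matrix.mat n n (\<lambda>(i, j). if Suc i \<in> S then lambert_G (2 * (i + j + 1) + 1) q else of_real (coeff_a (i + j + 1)))" for S
    unfolding M_matrix_def by (intro eq_matI) auto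
  have total: "K * (\<Sum>S\<in>Pow {1..n}. (- 1) ^ (n - card S) * D S) = theta3_null (- q) ^ (4 * n * (n + 1))"
  proof -
    define A where "A = (\<Sum>S\<in>Pow {1..n}. (- 1) ^ (n - card S) * D S)"
    have A: "A = Determinant.det (Matrix.mat n n (\<lambda>(i, j). lambert_G (2 * (i + j + 1) + 1) q - of_real (coeff_a (i + j + 1))))"
      unfolding A_def D_def M
      by (rule det_diff_expand_subsets[of n "\<lambda>i j. lambert_G (2 * (i + j + 1) + 1) q" "\<lambda>i j. of_real (coeff_a (i + j + 1))", symmetric])
    have "2 ^ n * A = (theta3_null (- q) ^ 8 / 16) ^ N * P"
      unfolding A N_def P_def by (rule det_lambert_G_minus_coeff_a[OF q])
    hence "2 ^ n * A * 16 ^ N = (theta3_null (- q) ^ 8) ^ N * P"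
      by (simp add: power_divide)
    moreover have "(theta3_null (- q) ^ 8) ^ N = theta3_null (- q) ^ (4 * n * (n + 1))"
    proof -
      have "8 * N = 4 * (2 * N)" by simp
      also have "\<dots> = 4 * n * (n + 1)" unfolding N by simp
      finally show ?thesis by (simp only: power_mult[symmetric])
    qed
    ultimately have "(16 ^ N * 2 ^ n) * A = theta3_null (- q) ^ (4 * n * (n + 1)) * P"
      by (simp only: mult_ac)
    thus ?thesis unfolding e16 A_def[symmetric] PK using P by (simp add: field_simps)
  qed
  \<comment> \<open>For the empty subset all rows consist of values of \<open>coeff_a\<close>, so
    \<open>det_coeff_a\<close> applies; this is the leading 1 of the formula.\<close>
  have empty: "K * ((- 1) ^ n * D {}) = 1"
  proof -
    have "(- 2) ^ n * D {} = (1 / 16) ^ N * P"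
      unfolding D_def M N_def P_def using det_coeff_a[of n] by simp
    moreover have "(- 2 :: complex) ^ n = 2 ^ n * (- 1) ^ n"
      by (simp flip: power_mult_distrib)
    ultimately have "16 ^ N * (2 ^ n * (- 1) ^ n * D {}) = 16 ^ N * ((1 / 16) ^ N * P)" by simp
    also have "16 ^ N * ((1 / 16) ^ N * P) = P" by (simp add: power_divide)
    finally have "(16 ^ N * 2 ^ n) * ((- 1) ^ n * D {}) = P" by (simp only: mult_ac)
    thus ?thesis unfolding e16 PK using P by (simp add: field_simps)
  qed
  have "(\<Sum>S\<in>Pow {1..n}. (- 1) ^ (n - card S) * D S) = (- 1) ^ n * D {} + (\<Sum>S\<in>Pow {1..n} - {{}}. (- 1) ^ (n - card S) * D S)"
    by (subst sum.remove[of _ "{}"]) auto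
  also have "(\<Sum>S\<in>Pow {1..n} - {{}}. (- 1) ^ (n - card S) * D S)
     = (\<Sum>p=1..n. \<Sum>S | S \<in> Pow {1..n} - {{}} \<and> card S = p. (- 1) ^ (n - card S) * D S)"
  proof (rule sum.group[symmetric])
    have "card S \<in> {1..n}" if "S \<in> Pow {1..n} - {{}}" for S
    proof -
      have "finite S" "S \<noteq> {}" using that finite_subset[of S "{1..n}"] by auto
      thus ?thesis using that card_mono[of "{1..n}" S] by (auto simp: Suc_le_eq card_gt_0_iff)
    qed
    thus "card ` (Pow {1..n} - {{}}) \<subseteq> {1..n}" by blast
  qed auto
  also have "\<dots> = (\<Sum>p=1..n. (- 1) ^ (n - p) * (\<Sum>S | S \<noteq> {} \<and> S \<subseteq> {1..n} \<and> card S = p. D S))"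
    unfolding sum_distrib_left by (intro sum.cong) auto
  finally have "theta3_null (- q) ^ (4 * n * (n + 1)) = K * ((- 1) ^ n * D {})
      + K * (\<Sum>p=1..n. (- 1) ^ (n - p) * (\<Sum>S | S \<noteq> {} \<and> S \<subseteq> {1..n} \<and> card S = p. D S))"
    using total by (simp add: distrib_left)
  also have "\<dots> = 1 + (\<Sum>p=1..n. (- 1) ^ (n - p) * K * (\<Sum>S | S \<noteq> {} \<and> S \<subseteq> {1..n} \<and> card S = p. D S))"
    unfolding empty sum_distrib_left[of K] by (simp only: mult_ac)
  finally show ?thesis
    unfolding K_def D_def by (simp only: mult.assoc)
qed

end
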